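(* There exists a finite universal numerical constant $c$ such that the following holds. Let $\mathcal M=(A_{ij},v_i,r_i)$ be a model with $N$ products, $M$ resources and capacity $K$, and let $\gamma_0\in\mathbb R_+^M$ be a normalized initial inventory vector, such that Assumptions (A1), (A2), (A3) stated in the context hold with parameters $A_0,B_0,\gamma_{\min},\rho_0,\chi_0$. Then for any time horizon $T$ (with initial inventory $C_0=T\gamma_0$), the regret of the epoch-based re-solving policy described in the context is at most $$ c\cdot\frac{A_0^2B_0^7K^5M^2N\ln T}{\min\{\rho_0^2,\chi_0^2\}}. $$
   Context: **Problem.** There are $N$ products, $M$ resources, $T$ periods, and a capacity $K\in\{1,\dots,N\}$. Product $i$ has preference score $v_i>0$, profit $r_i\in[0,1]$, and each sold unit consumes $A_{ij}\ge 0$ units of resource $j$; all these are known. The initial inventory is $C_0\in\mathbb R_+^M$, and $\gamma_0=C_0/T$. Let $C_t\in\mathbb R^M$ be the inventory at the beginning of period $t$ ($t=1,\dots,T$), with $C_1=C_0$. In period $t$ the retailer offers an assortment $S_t\subseteq[N]$, $|S_t|\le K$, such that $C_{t,j}\ge A_{ij}$ for all $i\in S_t$, $j\in[M]$. The customer purchases $i_t\in S_t\cup\{0\}$ ($0$ = no purchase) with $\Pr[i_t=i\mid S_t]=v_i/(1+\sum_{k\in S_t}v_k)$, where $v_0=1$ (multinomial logit). If $i_t=i\ge1$, the profit is $r_i$ and $C_{t+1}=C_t-A_{i,\cdot}$; if $i_t=0$ the profit is $r_0=0$ and $C_{t+1}=C_t$. An admissible policy is a sequence of maps $\pi_1,\dots,\pi_T$,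 with $\pi_t$ mapping $C_t$ to an assortment $S_t$ satisfying these constraints. Write $R(S)=\sum_{i\in S}r_iv_i/(1+\sum_{i\in S}v_i)$. The regret of a policy $\pi$ is the expected cumulative revenue over $T$ periods of the optimal (dynamic programming) admissible policy minus that of $\pi$, i.e. minus $\mathbb E^\pi[\sum_{t=1}^T r_{i_t}]=\mathbb E^\pi[\sum_{t=1}^TR(S_t)]$. **Fluid approximations.** For $x\in[0,1]^N$ let $R(x)=\frac{\sum_i r_iv_ix_i}{1+\sum_i v_ix_i}$ and $\nu(x)\in\mathbb R^N$ with $\nu(x)_i=\frac{v_ix_i}{1+\sum_kv_kx_k}$. For $\gamma\in\mathbb R_+^M$, $s\ge1$, $$\Phi(\gamma)=\max_{x\in[0,1]^N}R(x)\ \text{ s.t. } \|x\|_1\le K,\ A^\top\nu(x)\le\gamma,$$ $$\Psi(\gamma,s)=\max_{x\in[0,1]^N}\sum_ir_iv_ix_i\ \text{ s.t. } \|x\|_1\le K,\ A^\top\nu(x)\le\gamma,\ 1+\sum_iv_ix_i\le s.$$ The constraint $A^\top\nu(x)\le\gamma$ is equivalent to the linear constraints $\sum_iA_{ij}v_ix_i\le\gamma_j(1+\sum_iv_ix_i)$, $j\in[M]$, so $\Psi(\gamma,s)$ is a linear program. Let $x^F$ denote an optimal solution of $\Phi(\gamma_0)$. **Assumptions.** (A1) $A_0,B_0<\infty$, $v_i\in[0,B_0]$ and $A_{ij}\le A_0$ for all $i,j$. (A2) $\gamma_{\min}>0$ and $\gamma_{0,j}\ge\gamma_{\min}$ for all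 $j$. (A3) $0<\rho_0,\chi_0<\gamma_{\min}$, and for all $\delta\in\mathbb R^M$, $\epsilon\in\mathbb R$ with $\|\delta\|_\infty\le\rho_0$, $|\epsilon|\le\rho_0$: (1) $\sum_iv_ix^F_i>\rho_0$; (2) the set of binding (active) constraints in $\Psi(\gamma_0+\delta,1+\sum_iv_ix_i^F+\epsilon)$ at its optimum is the same as in $\Psi(\gamma_0,1+\sum_iv_ix_i^F)$; (3) writing all $M+2$ linear constraints and the $2N$ bounds $0\le x_i\le1$ of $\Psi$ in the form $\tilde Ax\le\tilde b$ with $\tilde A\in\mathbb R^{(M+2N+2)\times N}$ (rows: the all-ones vector; for each $j\in[M]$ the row with entries $(A_{ij}-\gamma_j)v_i$, $i\in[N]$; the vector $v$; the rows of $I_N$; the rows of $-I_N$; right-hand sides $K$, $\gamma_j$, $s-1$, $1$'s, $0$'s), the sub-matrix of $\tilde A$ formed by the binding constraints in $\Psi(\gamma_0+\delta,1+\sum_iv_ix_i^F+\epsilon)$ is invertible with smallest singular value at least $\chi_0$. **Sampling routine SampleAssortment$(x,K)$** ($x\in[0,1]^N$, $\|x\|_1\le K$). Extend $x$ to $\mathbb R^{N+K}$ by $x_{N+1}=\dots=x_{N+K}=1-\|x\|_1/K$ (with $\|x\|_1$ that of the original vector). Form the $(N+K)\times(N+K)$ doubly stochastic matrix $\mathbf M$ with $\mathbf M_{ij}=x_j/K$ for $i\le K$ and $\mathbf M_{ij}=(1-x_j)/N$ for $i>K$. Take a Birkhoff–von Neumann decomposition $\mathbf M=\sum_{\ell=1}^L\alpha_\ell\mathbf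 P_\ell$ ($\alpha_\ell\ge 0$, $\sum_\ell\alpha_\ell=1$, $\mathbf P_\ell$ permutation matrices), sample $u\in[L]$ with $\Pr[u=\ell]=\alpha_\ell$, and return $z\in\{0,1\}^N$ with $z_i=1$ iff $\sum_{k=1}^K(\mathbf P_u)_{ki}=1$. **Epoch-based re-solving policy.** Compute $x^F$ (assumed computed exactly) and put $\tau_0=T/(1+\sum_iv_ix_i^F)$. For epochs indexed $\tau=\tau_0,\tau_0-1,\tau_0-2,\dots$ as long as $\tau\ge1$: let $t^\tau$ be the number of time periods remaining at the beginning of epoch $\tau$, $\gamma^\tau=C_{T-t^\tau+1}/t^\tau$ the remaining inventory divided by $t^\tau$, and $s^\tau=t^\tau/\tau$; let $x^\tau$ be an optimal solution of $\Psi(\gamma^\tau,s^\tau)$; draw $z^\tau=$ SampleAssortment$(x^\tau,K)$ with fresh independent randomness; offer $S^\tau=\{i:z^\tau_i=1\}$ repeatedly in consecutive periods until a no-purchase occurs, which ends the epoch. The procedure stops when all $T$ periods have elapsed or inventory is depleted, meaning that the assortment to be offered contains a product for which the remaining inventory of some resource is insufficient; it also stops if the program $\Psi(\gamma^\tau,s^\tau)$ is infeasible. After stopping, nothing (the empty assortment) is offered.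
   Formalization: The formal theorem additionally assumes A_0 ≥ 1, B_0 ≥ 1 (only upper bounds, so no model is excluded) and T ≥ 2; as stated the bound fails for T = 1 (it is 0, the regret is positive) and when A_0 or B_0 tends to 0. *)

theory Defs
  imports
    "HOL-Probability.Probability_Mass_Function"
    "HOL-Combinatorics.Permutations"
    "Jordan_Normal_Form.DL_Submatrix"
    "Jordan_Normal_Form.Char_Poly"
begin

section \<open>The model\<close>

text \<open>
  Products are indexed by \<open>{..<n_prod m}\<close> and resources by \<open>{..<n_res m}\<close>. Vectors indexed by
  products or resources are functions on \<open>nat\<close> of which only these indices matter; the numbers of
  products and resources are ordinary variables, so that a constant can be chosen before them.
  A purchase is a \<open>nat option\<close>, where \<open>None\<close> is the no-purchase outcome.
\<close>

record mnl_model =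
  n_prod :: nat
  n_res :: nat
  cap :: nat
  usage :: "nat \<Rightarrow> nat \<Rightarrow> real"
  pref :: "nat \<Rightarrow> real"
  profit :: "nat \<Rightarrow> real"

definition valid_model :: "mnl_model \<Rightarrow> bool" where
  "valid_model m \<longleftrightarrow>
     1 \<le> n_res m \<and> 1 \<le> cap m \<and> cap m \<le> n_prod m \<and>
     (\<forall>i<n_prod m. 0 < pref m i \<and> 0 \<le> profit m i \<and> profit m i \<le> 1) \<and>
     (\<forall>i<n_prod m. \<forall>j<n_res m. 0 \<le> usage m i j)"

text \<open>The multinomial logit choice law, for a finite assortment \<open>S\<close> of products.\<close>

definition mnl_choice :: "mnl_model \<Rightarrow> nat set \<Rightarrow> nat option pmf" where
  "mnl_choice m S = embed_pmf (\<lambda>purchase. case purchase of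
       None \<Rightarrow> 1 / (1 + (\<Sum>k\<in>S. pref m k))
     | Some i \<Rightarrow> if i \<in> S then pref m i / (1 + (\<Sum>k\<in>S. pref m k)) else 0)"

definition reward :: "mnl_model \<Rightarrow> nat option \<Rightarrow> real" where
  "reward m purchase = (case purchase of None \<Rightarrow> 0 | Some i \<Rightarrow> profit m i)"

definition update_inventory :: "mnl_model \<Rightarrow> (nat \<Rightarrow> real) \<Rightarrow> nat option \<Rightarrow> (nat \<Rightarrow> real)" where
  "update_inventory m C purchase = (case purchase of
       None \<Rightarrow> C
     | Some i \<Rightarrow> (\<lambda>j. if j < n_res m then C j - usage m i j else C j))"

definition sufficient_inventory :: "mnl_model \<Rightarrow> (nat \<Rightarrow> real) \<Rightarrow> nat set \<Rightarrow> bool" where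
  "sufficient_inventory m C S \<longleftrightarrow> (\<forall>i\<in>S. \<forall>j<n_res m. usage m i j \<le> C j)"

definition initial_inventory :: "nat \<Rightarrow> (nat \<Rightarrow> real) \<Rightarrow> (nat \<Rightarrow> real)" where
  "initial_inventory T \<gamma>\<^sub>0 = (\<lambda>j. real T * \<gamma>\<^sub>0 j)"


section \<open>Admissible policies and the optimal expected revenue\<close>

definition admissible :: "mnl_model \<Rightarrow> nat \<Rightarrow> (nat \<Rightarrow> (nat \<Rightarrow> real) \<Rightarrow> nat set) \<Rightarrow> bool" where
  "admissible m T \<pi> \<longleftrightarrow> (\<forall>t\<in>{1..T}. \<forall>C.
     \<pi> t C \<subseteq> {..<n_prod m} \<and> card (\<pi> t C) \<le> cap m \<and> sufficient_inventory m C (\<pi> t C))"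

text \<open>Joint law of the inventory and the accumulated revenue after the given number of periods.\<close>

primrec policy_run ::
  "mnl_model \<Rightarrow> (nat \<Rightarrow> real) \<Rightarrow> (nat \<Rightarrow> (nat \<Rightarrow> real) \<Rightarrow> nat set) \<Rightarrow> nat \<Rightarrow> ((nat \<Rightarrow> real) \<times> real) pmf"
where
  "policy_run m C\<^sub>0 \<pi> 0 = return_pmf (C\<^sub>0, 0)"
| "policy_run m C\<^sub>0 \<pi> (Suc t) = bind_pmf (policy_run m C\<^sub>0 \<pi> t) (\<lambda>(C, w).
     map_pmf (\<lambda>purchase. (update_inventory m C purchase, w + reward m purchase))
       (mnl_choice m (\<pi> (Suc t) C)))"

definition policy_revenue ::
  "mnl_model \<Rightarrow> (nat \<Rightarrow> real) \<Rightarrow> nat \<Rightarrow> (nat \<Rightarrow> (nat \<Rightarrow> real) \<Rightarrow> nat set) \<Rightarrow> real" where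
  "policy_revenue m C\<^sub>0 T \<pi> = measure_pmf.expectation (policy_run m C\<^sub>0 \<pi> T) snd"

definition optimal_revenue :: "mnl_model \<Rightarrow> (nat \<Rightarrow> real) \<Rightarrow> nat \<Rightarrow> real" where
  "optimal_revenue m C\<^sub>0 T = (SUP \<pi>\<in>{\<pi>. admissible m T \<pi>}. policy_revenue m C\<^sub>0 T \<pi>)"


section \<open>Fluid approximations\<close>

definition weight :: "mnl_model \<Rightarrow> (nat \<Rightarrow> real) \<Rightarrow> real" where
  "weight m x = (\<Sum>i<n_prod m. pref m i * x i)"

definition fluid_revenue :: "mnl_model \<Rightarrow> (nat \<Rightarrow> real) \<Rightarrow> real" where
  "fluid_revenue m x = (\<Sum>i<n_prod m. profit m i * pref m i * x i) / (1 + weight m x)"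

definition sales :: "mnl_model \<Rightarrow> (nat \<Rightarrow> real) \<Rightarrow> nat \<Rightarrow> real" where
  "sales m x i = pref m i * x i / (1 + weight m x)"

definition Phi_feasible :: "mnl_model \<Rightarrow> (nat \<Rightarrow> real) \<Rightarrow> (nat \<Rightarrow> real) set" where
  "Phi_feasible m \<gamma> = {x.
     (\<forall>i<n_prod m. 0 \<le> x i \<and> x i \<le> 1) \<and>
     (\<Sum>i<n_prod m. \<bar>x i\<bar>) \<le> real (cap m) \<and>
     (\<forall>j<n_res m. (\<Sum>i<n_prod m. usage m i j * sales m x i) \<le> \<gamma> j)}"

definition Phi_optimal :: "mnl_model \<Rightarrow> (nat \<Rightarrow> real) \<Rightarrow> (nat \<Rightarrow> real) \<Rightarrow> bool" where
  "Phi_optimal m \<gamma> = is_arg_max (fluid_revenue m) (\<lambda>x. x \<in> Phi_feasible m \<gamma>)"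

definition Psi_feasible :: "mnl_model \<Rightarrow> (nat \<Rightarrow> real) \<Rightarrow> real \<Rightarrow> (nat \<Rightarrow> real) set" where
  "Psi_feasible m \<gamma> s = {x \<in> Phi_feasible m \<gamma>. 1 + weight m x \<le> s}"

definition Psi_optimal :: "mnl_model \<Rightarrow> (nat \<Rightarrow> real) \<Rightarrow> real \<Rightarrow> (nat \<Rightarrow> real) \<Rightarrow> bool" where
  "Psi_optimal m \<gamma> s =
     is_arg_max (\<lambda>x. \<Sum>i<n_prod m. profit m i * pref m i * x i) (\<lambda>x. x \<in> Psi_feasible m \<gamma> s)"


section \<open>Binding constraints\<close>

text \<open>
  The constraints of \<open>Psi_feasible m \<gamma> s\<close> as a linear system, the rows being in this order:
  cardinality, resources, bound on the total weight, upper bounds, lower bounds.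
\<close>

definition lp_mat :: "mnl_model \<Rightarrow> (nat \<Rightarrow> real) \<Rightarrow> real mat" where
  "lp_mat m \<gamma> = (let N = n_prod m; M = n_res m in
     Matrix.mat (M + 2 * N + 2) N (\<lambda>(k, i).
       if k = 0 then 1
       else if k \<le> M then (usage m i (k - 1) - \<gamma> (k - 1)) * pref m i
       else if k = M + 1 then pref m i
       else if k < M + 2 + N then (if k = M + 2 + i then 1 else 0)
       else (if k = M + 2 + N + i then -1 else 0)))"

definition lp_rhs :: "mnl_model \<Rightarrow> (nat \<Rightarrow> real) \<Rightarrow> real \<Rightarrow> real Matrix.vec" where
  "lp_rhs m \<gamma> s = (let N = n_prod m; M = n_res m in
     Matrix.vec (M + 2 * N + 2) (\<lambda>k.
       if k = 0 then real (cap m)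
       else if k \<le> M then \<gamma> (k - 1)
       else if k = M + 1 then s - 1
       else if k < M + 2 + N then 1
       else 0))"

definition binding :: "mnl_model \<Rightarrow> (nat \<Rightarrow> real) \<Rightarrow> real \<Rightarrow> (nat \<Rightarrow> real) \<Rightarrow> nat set" where
  "binding m \<gamma> s x = {k. k < n_res m + 2 * n_prod m + 2 \<and>
     vec_index (lp_mat m \<gamma> *\<^sub>v Matrix.vec (n_prod m) x) k = vec_index (lp_rhs m \<gamma> s) k}"

definition binding_mat :: "mnl_model \<Rightarrow> (nat \<Rightarrow> real) \<Rightarrow> real \<Rightarrow> (nat \<Rightarrow> real) \<Rightarrow> real mat" where
  "binding_mat m \<gamma> s x = submatrix (lp_mat m \<gamma>) (binding m \<gamma> s x) UNIV"

text \<open>Meaningful for nonempty square matrices, where the singular values of \<open>B\<close> are the square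
  roots of the eigenvalues of \<open>B\<^sup>T B\<close>.\<close>

definition smallest_singular_value :: "real mat \<Rightarrow> real" where
  "smallest_singular_value B = Min (sqrt ` {e. eigenvalue (transpose_mat B * B) e})"


section \<open>Assumptions\<close>

text \<open>
  \<open>A\<^sub>0\<close> and \<open>B\<^sub>0\<close> are mere upper bounds, so taking them \<open>\<ge> 1\<close> excludes no model. A regret bound
  proportional to \<open>A\<^sub>0\<^sup>2 B\<^sub>0\<^sup>7\<close> needs this normalisation: it would vanish in the limit of small bounds
  while the regret of, say, the last periods does not.
\<close>

definition assumption_A1 :: "mnl_model \<Rightarrow> real \<Rightarrow> real \<Rightarrow> bool" where
  "assumption_A1 m A\<^sub>0 B\<^sub>0 \<longleftrightarrow>
     (\<forall>i<n_prod m. 0 \<le> pref m i \<and> pref m i \<le> B\<^sub>0) \<and>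
     (\<forall>i<n_prod m. \<forall>j<n_res m. usage m i j \<le> A\<^sub>0)"

definition assumption_A2 :: "mnl_model \<Rightarrow> (nat \<Rightarrow> real) \<Rightarrow> real \<Rightarrow> bool" where
  "assumption_A2 m \<gamma>\<^sub>0 \<gamma>_min \<longleftrightarrow> 0 < \<gamma>_min \<and> (\<forall>j<n_res m. \<gamma>_min \<le> \<gamma>\<^sub>0 j)"

text \<open>
  Under the bounds on \<open>\<rho>\<^sub>0\<close> below all the programs involved are feasible, so optima exist. The
  conditions on the binding constraints are required at every optimum, which forces optima to be
  unique.
\<close>

definition assumption_A3 ::
  "mnl_model \<Rightarrow> (nat \<Rightarrow> real) \<Rightarrow> real \<Rightarrow> real \<Rightarrow> real \<Rightarrow> (nat \<Rightarrow> real) \<Rightarrow> bool" where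
  "assumption_A3 m \<gamma>\<^sub>0 \<gamma>_min \<rho>\<^sub>0 \<chi>\<^sub>0 xF \<longleftrightarrow>
     0 < \<rho>\<^sub>0 \<and> \<rho>\<^sub>0 < \<gamma>_min \<and> 0 < \<chi>\<^sub>0 \<and> \<chi>\<^sub>0 < \<gamma>_min \<and>
     weight m xF > \<rho>\<^sub>0 \<and>
     (\<forall>\<delta> \<epsilon> x y. (\<forall>j<n_res m. \<bar>\<delta> j\<bar> \<le> \<rho>\<^sub>0) \<and> \<bar>\<epsilon>\<bar> \<le> \<rho>\<^sub>0 \<longrightarrow>
        Psi_optimal m (\<lambda>j. \<gamma>\<^sub>0 j + \<delta> j) (1 + weight m xF + \<epsilon>) x \<longrightarrow>
        Psi_optimal m \<gamma>\<^sub>0 (1 + weight m xF) y \<longrightarrow>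
          binding m (\<lambda>j. \<gamma>\<^sub>0 j + \<delta> j) (1 + weight m xF + \<epsilon>) x
            = binding m \<gamma>\<^sub>0 (1 + weight m xF) y \<and>
          invertible_mat (binding_mat m (\<lambda>j. \<gamma>\<^sub>0 j + \<delta> j) (1 + weight m xF + \<epsilon>) x) \<and>
          \<chi>\<^sub>0 \<le> smallest_singular_value
                 (binding_mat m (\<lambda>j. \<gamma>\<^sub>0 j + \<delta> j) (1 + weight m xF + \<epsilon>) x))"


section \<open>The sampling routine\<close>

definition sampling_mat :: "mnl_model \<Rightarrow> (nat \<Rightarrow> real) \<Rightarrow> nat \<Rightarrow> nat \<Rightarrow> real" where
  "sampling_mat m x i j = (let N = n_prod m; K = cap m;
       x' = (\<lambda>j. if j < N then x j else 1 - (\<Sum>k<N. \<bar>x k\<bar>) / real K)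
     in if i < K then x' j / real K else (1 - x' j) / real N)"

definition perm_mat :: "(nat \<Rightarrow> nat) \<Rightarrow> nat \<Rightarrow> nat \<Rightarrow> real" where
  "perm_mat \<sigma> i j = (if \<sigma> i = j then 1 else 0)"

text \<open>
  \<open>p\<close> is the law of the returned assortment for some Birkhoff--von Neumann decomposition
  (weights \<open>pmf u l\<close>, permutation matrices \<open>perm_mat (\<sigma> l)\<close>).
\<close>

definition sample_assortment :: "mnl_model \<Rightarrow> (nat \<Rightarrow> real) \<Rightarrow> nat set pmf \<Rightarrow> bool" where
  "sample_assortment m x p \<longleftrightarrow> (\<exists>(L::nat) (u::nat pmf) \<sigma>.
     set_pmf u \<subseteq> {..<L} \<and>
     (\<forall>l<L. \<sigma> l permutes {..<n_prod m + cap m}) \<and>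
     (\<forall>i<n_prod m + cap m. \<forall>j<n_prod m + cap m.
        sampling_mat m x i j = (\<Sum>l<L. pmf u l * perm_mat (\<sigma> l) i j)) \<and>
     p = map_pmf (\<lambda>l. {i. i < n_prod m \<and> (\<Sum>k<cap m. perm_mat (\<sigma> l) k i) = 1}) u)"


section \<open>The epoch-based re-solving policy\<close>

text \<open>
  Neither the optimal solution of the linear program nor the decomposition is unique.
  A resolving rule fixes these choices: \<open>draw k \<gamma> s\<close> is the law of the assortment drawn at the
  beginning of epoch number \<open>k = 0, 1, \<dots>\<close> (that is, \<open>\<tau> = \<tau>\<^sub>0 - k\<close>). Since \<open>k\<close>, \<open>\<gamma>\<close>, \<open>s\<close> determine
  \<open>\<tau>\<close>, the remaining time and the remaining inventory, the choices may depend on all of them.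
\<close>

definition resolving_rule ::
  "mnl_model \<Rightarrow> (nat \<Rightarrow> (nat \<Rightarrow> real) \<Rightarrow> real \<Rightarrow> nat set pmf) \<Rightarrow> bool" where
  "resolving_rule m draw \<longleftrightarrow> (\<forall>k \<gamma> s. Psi_feasible m \<gamma> s \<noteq> {} \<longrightarrow>
     (\<exists>x. Psi_optimal m \<gamma> s x \<and> sample_assortment m x (draw k \<gamma> s)))"

text \<open>Phase at the beginning of a period: epoch \<open>k\<close> is about to start; \<open>S\<close> is the assortment of
  the current epoch \<open>k\<close>; or the procedure has stopped.\<close>

datatype phase = Start nat | Offering nat "nat set" | Stopped

definition check_inventory :: "mnl_model \<Rightarrow> (nat \<Rightarrow> real) \<Rightarrow> nat \<Rightarrow> nat set \<Rightarrow> phase" where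
  "check_inventory m C k S = (if sufficient_inventory m C S then Offering k S else Stopped)"

text \<open>The decision taken at the beginning of a period with \<open>n\<close> periods remaining and inventory
  \<open>C\<close>. The result is never of the form \<open>Start k\<close>.\<close>

definition resolve ::
  "mnl_model \<Rightarrow> real \<Rightarrow> (nat \<Rightarrow> (nat \<Rightarrow> real) \<Rightarrow> real \<Rightarrow> nat set pmf) \<Rightarrow>
     nat \<Rightarrow> (nat \<Rightarrow> real) \<Rightarrow> phase \<Rightarrow> phase pmf" where
  "resolve m \<tau>\<^sub>0 draw n C ph = (case ph of
       Stopped \<Rightarrow> return_pmf Stopped
     | Offering k S \<Rightarrow> return_pmf (check_inventory m C k S)
     | Start k \<Rightarrow> (let \<tau> = \<tau>\<^sub>0 - real k; \<gamma> = (\<lambda>j. C j / real n); s = real n / \<tau> in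
         if \<tau> < 1 \<or> Psi_feasible m \<gamma> s = {} then return_pmf Stopped
         else map_pmf (check_inventory m C k) (draw k \<gamma> s)))"

definition offered :: "phase \<Rightarrow> nat set" where
  "offered ph = (case ph of Offering k S \<Rightarrow> S | _ \<Rightarrow> {})"

definition next_phase :: "phase \<Rightarrow> nat option \<Rightarrow> phase" where
  "next_phase ph purchase = (case ph of
       Offering k S \<Rightarrow> (if purchase = None then Start (Suc k) else ph)
     | _ \<Rightarrow> ph)"

text \<open>Joint law of the inventory, the accumulated revenue and the phase after the given number of
  periods, for horizon \<open>T\<close>.\<close>

primrec resolving_run ::
  "mnl_model \<Rightarrow> (nat \<Rightarrow> real) \<Rightarrow> nat \<Rightarrow> real \<Rightarrow> (nat \<Rightarrow> (nat \<Rightarrow> real) \<Rightarrow> real \<Rightarrow> nat set pmf) \<Rightarrow>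
     nat \<Rightarrow> ((nat \<Rightarrow> real) \<times> real \<times> phase) pmf"
where
  "resolving_run m C\<^sub>0 T \<tau>\<^sub>0 draw 0 = return_pmf (C\<^sub>0, 0, Start 0)"
| "resolving_run m C\<^sub>0 T \<tau>\<^sub>0 draw (Suc t) =
     bind_pmf (resolving_run m C\<^sub>0 T \<tau>\<^sub>0 draw t) (\<lambda>(C, w, ph).
     bind_pmf (resolve m \<tau>\<^sub>0 draw (T - t) C ph) (\<lambda>ph'.
     map_pmf (\<lambda>purchase. (update_inventory m C purchase, w + reward m purchase,
                           next_phase ph' purchase))
       (mnl_choice m (offered ph'))))"

definition resolving_revenue ::
  "mnl_model \<Rightarrow> (nat \<Rightarrow> real) \<Rightarrow> nat \<Rightarrow> (nat \<Rightarrow> real) \<Rightarrow>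
     (nat \<Rightarrow> (nat \<Rightarrow> real) \<Rightarrow> real \<Rightarrow> nat set pmf) \<Rightarrow> real" where
  "resolving_revenue m C\<^sub>0 T xF draw = measure_pmf.expectation
     (resolving_run m C\<^sub>0 T (real T / (1 + weight m xF)) draw T) (\<lambda>(C, w, ph). w)"

definition resolving_regret ::
  "mnl_model \<Rightarrow> (nat \<Rightarrow> real) \<Rightarrow> nat \<Rightarrow> (nat \<Rightarrow> real) \<Rightarrow>
     (nat \<Rightarrow> (nat \<Rightarrow> real) \<Rightarrow> real \<Rightarrow> nat set pmf) \<Rightarrow> real" where
  "resolving_regret m C\<^sub>0 T xF draw =
     optimal_revenue m C\<^sub>0 T - resolving_revenue m C\<^sub>0 T xF draw"

end

theory Submission
  imports Defs
begin

text \<open>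
  Let \<open>V = 1 + weight m xF\<close>. Offering a fixed assortment until the first no-purchase is an epoch; its
  expected sales are \<open>pref m i\<close> for each offered product, without any denominator, so in terms of
  epochs the multinomial logit problem is linear.

  The binding matrix at \<open>xF\<close> is invertible, which yields multipliers for the fluid problem: prices
  \<open>\<pi> j\<close> of the resources and \<open>\<sigma>\<close> of time, all nonnegative because \<open>xF\<close> is optimal (\<open>dual_prices\<close>). Let
  \<open>worth n C\<close> be the value at these prices of inventory \<open>C\<close> and \<open>n\<close> periods. By weak duality no offer
  earns more in expectation than the worth that it uses up, so the initial worth, which is \<open>T\<close>
  times the fluid revenue, is an upper bound for every policy (\<open>optimal_revenue_le\<close>). An assortment drawn from a
  solution at which the constraints binding at \<open>xF\<close> are binding earns in expectation exactly what
  it uses up. Hence the re-solving policy loses nothing while the set of binding constraints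
  persists, and its regret is at most the expected worth left when it leaves this regime.

  That worth is at most the number \<open>\<tau>\<close> of epochs to go times the revenue \<open>B\<close> of an epoch, so it
  remains to bound the expected number of epochs to go at the exit. The deviations
  \<open>n - V \<tau>\<close> and \<open>C j - \<gamma>\<^sub>0 j n\<close>, divided by \<open>\<tau>\<close>, are martingales, since the program spreads time and
  inventory evenly over the epochs to go; for resources that are not binding only shortages matter,
  and there the drift is favourable. One epoch adds variance of order \<open>1 / \<tau>\<^sup>2\<close>, so the deviations
  leave the stable region, of radius \<open>\<rho>\<close>, before \<open>\<tau>\<close> epochs to go with probability of order
  \<open>1 / (\<rho>\<^sup>2 \<tau>)\<close>, and summing over \<open>\<tau>\<close> gives \<open>ln T / \<rho>\<^sup>2\<close>.

  The proof carries this out as a backward induction over single periods with an explicit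
  potential. At the start of an epoch it is the sum of the squared deviations (\<open>potential\<close>), within
  an epoch an upper bound for its expectation at the end of the epoch (\<open>epoch_potential\<close>). The
  worth minus a multiple of the potential over \<open>\<tau>\<close> minus a multiple of \<open>ln (1 + \<tau>)\<close> is then a lower
  bound for the revenue to go (\<open>all_covered\<close>), and running out of time or inventory is paid
  for in the same way as leaving the stable region, because the potential is large when it happens.
\<close>

section \<open>Expectations over finite laws\<close>

lemma expectation_bind_finite:
  fixes h :: "'b \<Rightarrow> real"
  assumes "finite (set_pmf p)" "\<And>x. x \<in> set_pmf p \<Longrightarrow> finite (set_pmf (f x))"
  shows "measure_pmf.expectation (bind_pmf p f) h
    = measure_pmf.expectation p (\<lambda>x. measure_pmf.expectation (f x) h)"
proof -
  have "measure_pmf.expectation (bind_pmf p f) h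
      = (\<Sum>a\<in>set_pmf p. pmf p a *\<^sub>R measure_pmf.expectation (f a) h)"
    using assms by (intro pmf_expectation_bind) auto
  also have "\<dots> = measure_pmf.expectation p (\<lambda>x. measure_pmf.expectation (f x) h)"
    using assms(1) by (subst integral_measure_pmf_real[of "set_pmf p"]) (auto simp: mult.commute)
  finally show ?thesis .
qed

lemma expectation_mono_finite:
  fixes f g :: "'a \<Rightarrow> real"
  assumes "finite (set_pmf p)" "\<And>x. x \<in> set_pmf p \<Longrightarrow> f x \<le> g x"
  shows "measure_pmf.expectation p f \<le> measure_pmf.expectation p g"
  using assms by (intro integral_mono_AE integrable_measure_pmf_finite) (auto simp: AE_measure_pmf_iff)

lemma expectation_cong_set_pmf:
  fixes f g :: "'a \<Rightarrow> real"
  assumes "\<And>x. x \<in> set_pmf p \<Longrightarrow> f x = g x"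
  shows "measure_pmf.expectation p f = measure_pmf.expectation p g"
  using assms by (intro integral_cong_AE) (auto simp: AE_measure_pmf_iff)

section \<open>The choice law\<close>

lemma pmf_mnl_choice:
  assumes "finite S" "\<And>i. i \<in> S \<Longrightarrow> 0 \<le> pref m i"
  shows "pmf (mnl_choice m S) purchase = (case purchase of
       None \<Rightarrow> 1 / (1 + (\<Sum>k\<in>S. pref m k))
     | Some i \<Rightarrow> if i \<in> S then pref m i / (1 + (\<Sum>k\<in>S. pref m k)) else 0)"
    (is "_ = ?f purchase")
proof -
  let ?D = "1 + (\<Sum>k\<in>S. pref m k)"
  have D: "?D > 0" using assms(2) by (simp add: add_pos_nonneg sum_nonneg)
  have nn: "0 \<le> ?f x" for x using D assms(2) by (auto split: option.splits)
  have "(\<integral>\<^sup>+x. ennreal (?f x) \<partial>count_space UNIV) = (\<Sum>x\<in>insert None (Some ` S). ennreal (?f x))"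
    using assms(1) by (intro nn_integral_count_space') (auto split: option.splits)
  also have "\<dots> = ennreal (\<Sum>x\<in>insert None (Some ` S). ?f x)"
    using nn by (subst sum_ennreal) auto
  also have "(\<Sum>x\<in>insert None (Some ` S). ?f x) = 1 / ?D + (\<Sum>i\<in>S. pref m i / ?D)"
    using assms(1) by (subst sum.insert) (auto simp: sum.reindex)
  also have "\<dots> = 1"
    using D by (simp add: sum_divide_distrib[symmetric] add_divide_distrib[symmetric])
  finally have one: "(\<integral>\<^sup>+x. ennreal (?f x) \<partial>count_space UNIV) = 1" by simp
  show ?thesis unfolding mnl_choice_def by (rule pmf_embed_pmf[OF nn one])
qed

lemma set_mnl_choice_subset:
  assumes "finite S" "\<And>i. i \<in> S \<Longrightarrow> 0 \<le> pref m i"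
  shows "set_pmf (mnl_choice m S) \<subseteq> insert None (Some ` S)"
proof
  fix a assume "a \<in> set_pmf (mnl_choice m S)"
  then show "a \<in> insert None (Some ` S)"
    by (cases a) (auto simp: set_pmf_eq pmf_mnl_choice[OF assms] split: if_splits)
qed

lemma expectation_mnl_choice:
  fixes f :: "nat option \<Rightarrow> real"
  assumes "finite S" "\<And>i. i \<in> S \<Longrightarrow> 0 \<le> pref m i"
  shows "measure_pmf.expectation (mnl_choice m S) f
    = (f None + (\<Sum>i\<in>S. pref m i * f (Some i))) / (1 + (\<Sum>k\<in>S. pref m k))"
proof -
  let ?D = "1 + (\<Sum>k\<in>S. pref m k)"
  have "measure_pmf.expectation (mnl_choice m S) f
      = (\<Sum>a\<in>insert None (Some ` S). f a * pmf (mnl_choice m S) a)"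
    using assms(1) set_mnl_choice_subset[OF assms] by (intro integral_measure_pmf_real) auto
  also have "\<dots> = f None * (1 / ?D) + (\<Sum>i\<in>S. f (Some i) * (pref m i / ?D))"
    using assms(1) by (subst sum.insert) (auto simp: sum.reindex pmf_mnl_choice[OF assms])
  also have "\<dots> = (f None + (\<Sum>i\<in>S. pref m i * f (Some i))) / ?D"
    by (simp add: add_divide_distrib sum_divide_distrib mult.commute)
  finally show ?thesis .
qed

section \<open>The sampling routine\<close>

lemma sum_perm_mat_permutes:
  assumes "\<sigma> permutes A"
  shows "(\<Sum>k<K. perm_mat \<sigma> k i) = (if i \<in> \<sigma> ` {..<K} then 1 else 0)"
proof (cases "i \<in> \<sigma> ` {..<K}")
  case True
  then obtain k where k: "k < K" "\<sigma> k = i" by auto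
  have "(\<sigma> k' = i) = (k' = k)" for k'
    using k(2) permutes_inj[OF assms] by (auto dest: injD)
  then show ?thesis using True k by (simp add: perm_mat_def)
qed (auto simp: perm_mat_def intro!: sum.neutral)

lemma sample_assortment_finite:
  assumes "sample_assortment m x p"
  shows "finite (set_pmf p)"
proof -
  obtain L :: nat and u :: "nat pmf" and f where "set_pmf u \<subseteq> {..<L}" "p = map_pmf f u"
    using assms unfolding sample_assortment_def by blast
  then show ?thesis using finite_subset[of "set_pmf u" "{..<L}"] by simp
qed

lemma sample_assortment_card:
  assumes "sample_assortment m x p" "S \<in> set_pmf p"
  shows "S \<subseteq> {..<n_prod m} \<and> card S \<le> cap m"
proof -
  obtain L :: nat and u :: "nat pmf" and \<sigma> where u: "set_pmf u \<subseteq> {..<L}"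
    and perm: "\<forall>l<L. \<sigma> l permutes {..<n_prod m + cap m}"
    and p: "p = map_pmf (\<lambda>l. {i. i < n_prod m \<and> (\<Sum>k<cap m. perm_mat (\<sigma> l) k i) = 1}) u"
    using assms(1) unfolding sample_assortment_def by auto
  obtain l where l: "l < L" "S = {i. i < n_prod m \<and> (\<Sum>k<cap m. perm_mat (\<sigma> l) k i) = 1}"
    using assms(2) u by (auto simp: p)
  have sub: "S \<subseteq> \<sigma> l ` {..<cap m}"
    using l perm by (auto simp: sum_perm_mat_permutes split: if_splits)
  have "card S \<le> card (\<sigma> l ` {..<cap m})" using sub by (intro card_mono) auto
  also have "\<dots> \<le> cap m" using card_image_le[of "{..<cap m}" "\<sigma> l"] by simp
  finally show ?thesis using l(2) by auto
qed

text \<open>The first \<open>K\<close> rows of the decomposed matrix are all equal to \<open>x / K\<close>, so a column \<open>i\<close>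
  receives its entry \<open>1\<close> in one of them with probability \<open>x i\<close>.\<close>

lemma expectation_sample_assortment:
  fixes h :: "nat \<Rightarrow> real"
  assumes "sample_assortment m x p" "1 \<le> cap m"
  shows "measure_pmf.expectation p (\<lambda>S. \<Sum>i\<in>S. h i) = (\<Sum>i<n_prod m. h i * x i)"
proof -
  let ?N = "n_prod m" and ?K = "cap m"
  obtain L :: nat and u :: "nat pmf" and \<sigma> where u: "set_pmf u \<subseteq> {..<L}"
    and perm: "\<forall>l<L. \<sigma> l permutes {..<?N + ?K}"
    and dec: "\<forall>i<?N + ?K. \<forall>j<?N + ?K.
        sampling_mat m x i j = (\<Sum>l<L. pmf u l * perm_mat (\<sigma> l) i j)"
    and p: "p = map_pmf (\<lambda>l. {i. i < ?N \<and> (\<Sum>k<?K. perm_mat (\<sigma> l) k i) = 1}) u"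
    using assms(1) unfolding sample_assortment_def by auto
  have marg: "(\<Sum>l<L. pmf u l * (\<Sum>k<?K. perm_mat (\<sigma> l) k i)) = x i" if "i < ?N" for i
  proof -
    have "(\<Sum>l<L. pmf u l * (\<Sum>k<?K. perm_mat (\<sigma> l) k i))
        = (\<Sum>k<?K. \<Sum>l<L. pmf u l * perm_mat (\<sigma> l) k i)"
      by (simp add: sum_distrib_left sum.swap[of _ "{..<L}"])
    also have "\<dots> = (\<Sum>k<?K. x i / real ?K)"
    proof (rule sum.cong[OF refl])
      fix k assume "k \<in> {..<?K}"
      then show "(\<Sum>l<L. pmf u l * perm_mat (\<sigma> l) k i) = x i / real ?K"
        using dec[rule_format, of k i] that by (simp add: sampling_mat_def Let_def)
    qed
    finally show ?thesis using assms(2) by simp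
  qed
  have drawn: "(\<Sum>i\<in>{i. i < ?N \<and> (\<Sum>k<?K. perm_mat (\<sigma> l) k i) = 1}. h i)
      = (\<Sum>i<?N. h i * (\<Sum>k<?K. perm_mat (\<sigma> l) k i))" if "l < L" for l
  proof -
    note entries = sum_perm_mat_permutes[OF perm[rule_format, OF that], where K = ?K]
    have set: "{i. i < ?N \<and> (\<Sum>k<?K. perm_mat (\<sigma> l) k i) = 1} = {i\<in>{..<?N}. i \<in> \<sigma> l ` {..<?K}}"
      unfolding entries by auto
    have "(\<Sum>i<?N. h i * (\<Sum>k<?K. perm_mat (\<sigma> l) k i))
        = (\<Sum>i<?N. if i \<in> \<sigma> l ` {..<?K} then h i else 0)"
      unfolding entries by (intro sum.cong) auto
    then show ?thesis unfolding set by (simp only: sum.inter_filter[OF finite_lessThan])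
  qed
  have scale: "(\<Sum>i<?N. h i * g i) * w = (\<Sum>i<?N. h i * (w * g i))" for g and w :: real
    by (simp add: sum_distrib_left mult_ac)
  have "measure_pmf.expectation p (\<lambda>S. \<Sum>i\<in>S. h i)
      = (\<Sum>l<L. (\<Sum>i\<in>{i. i < ?N \<and> (\<Sum>k<?K. perm_mat (\<sigma> l) k i) = 1}. h i) * pmf u l)"
    unfolding p integral_map_pmf using u by (intro integral_measure_pmf_real) auto
  also have "\<dots> = (\<Sum>l<L. \<Sum>i<?N. h i * (pmf u l * (\<Sum>k<?K. perm_mat (\<sigma> l) k i)))"
    by (intro sum.cong refl) (simp only: drawn lessThan_iff scale)
  also have "\<dots> = (\<Sum>i<?N. h i * (\<Sum>l<L. pmf u l * (\<Sum>k<?K. perm_mat (\<sigma> l) k i)))"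
    by (subst sum.swap) (simp add: sum_distrib_left)
  also have "\<dots> = (\<Sum>i<?N. h i * x i)" by (intro sum.cong refl) (simp add: marg)
  finally show ?thesis .
qed

section \<open>The linear program row by row\<close>

definition lp_row :: "mnl_model \<Rightarrow> (nat \<Rightarrow> real) \<Rightarrow> nat \<Rightarrow> (nat \<Rightarrow> real) \<Rightarrow> real" where
  "lp_row m \<gamma> k x = (\<Sum>i<n_prod m. lp_mat m \<gamma> $$ (k, i) * x i)"

definition usage_rate :: "mnl_model \<Rightarrow> (nat \<Rightarrow> real) \<Rightarrow> nat \<Rightarrow> real" where
  "usage_rate m x j = (\<Sum>i<n_prod m. usage m i j * pref m i * x i)"

definition revenue_rate :: "mnl_model \<Rightarrow> (nat \<Rightarrow> real) \<Rightarrow> real" where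
  "revenue_rate m x = (\<Sum>i<n_prod m. profit m i * pref m i * x i)"

lemma lp_row_explicit:
  shows lp_row_card: "lp_row m \<gamma> 0 x = (\<Sum>i<n_prod m. x i)"
    and lp_row_usage: "j < n_res m \<Longrightarrow> lp_row m \<gamma> (Suc j) x = usage_rate m x j - \<gamma> j * weight m x"
    and lp_row_weight: "lp_row m \<gamma> (n_res m + 1) x = weight m x"
    and lp_row_upper: "i < n_prod m \<Longrightarrow> lp_row m \<gamma> (n_res m + 2 + i) x = x i"
    and lp_row_lower: "i < n_prod m \<Longrightarrow> lp_row m \<gamma> (n_res m + 2 + n_prod m + i) x = - x i"
proof -
  show "lp_row m \<gamma> 0 x = (\<Sum>i<n_prod m. x i)"
    by (simp add: lp_row_def lp_mat_def Let_def)
  show "lp_row m \<gamma> (Suc j) x = usage_rate m x j - \<gamma> j * weight m x" if "j < n_res m"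
    using that by (simp add: lp_row_def lp_mat_def Let_def usage_rate_def weight_def
        sum_distrib_left sum_subtractf[symmetric] algebra_simps)
  show "lp_row m \<gamma> (n_res m + 1) x = weight m x"
    by (simp add: lp_row_def lp_mat_def Let_def weight_def)
  show "lp_row m \<gamma> (n_res m + 2 + i) x = x i" if "i < n_prod m"
  proof -
    have "lp_row m \<gamma> (n_res m + 2 + i) x = (\<Sum>l<n_prod m. if i = l then x l else 0)"
      unfolding lp_row_def using that by (intro sum.cong) (auto simp: lp_mat_def Let_def)
    then show ?thesis using that by simp
  qed
  show "lp_row m \<gamma> (n_res m + 2 + n_prod m + i) x = - x i" if "i < n_prod m"
  proof -
    have "lp_row m \<gamma> (n_res m + 2 + n_prod m + i) x = (\<Sum>l<n_prod m. if i = l then - x l else 0)"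
      unfolding lp_row_def using that by (intro sum.cong) (auto simp: lp_mat_def Let_def)
    then show ?thesis using that by simp
  qed
qed

lemma lp_rhs_explicit:
  shows "lp_rhs m \<gamma> s $ 0 = real (cap m)"
    and "j < n_res m \<Longrightarrow> lp_rhs m \<gamma> s $ Suc j = \<gamma> j"
    and "lp_rhs m \<gamma> s $ (n_res m + 1) = s - 1"
    and "i < n_prod m \<Longrightarrow> lp_rhs m \<gamma> s $ (n_res m + 2 + i) = 1"
    and "i < n_prod m \<Longrightarrow> lp_rhs m \<gamma> s $ (n_res m + 2 + n_prod m + i) = 0"
  by (simp_all add: lp_rhs_def Let_def)

text \<open>The resource constraints of the fluid problems are linear after multiplication by the denominator.\<close>

lemma lp_row_le_rhs_iff:
  shows "lp_row m \<gamma> 0 x \<le> lp_rhs m \<gamma> s $ 0 \<longleftrightarrow> (\<Sum>i<n_prod m. x i) \<le> real (cap m)"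
    and "j < n_res m \<Longrightarrow> lp_row m \<gamma> (Suc j) x \<le> lp_rhs m \<gamma> s $ Suc j \<longleftrightarrow>
      usage_rate m x j \<le> \<gamma> j * (1 + weight m x)"
    and "lp_row m \<gamma> (n_res m + 1) x \<le> lp_rhs m \<gamma> s $ (n_res m + 1) \<longleftrightarrow> 1 + weight m x \<le> s"
    and "i < n_prod m \<Longrightarrow> lp_row m \<gamma> (n_res m + 2 + i) x \<le> lp_rhs m \<gamma> s $ (n_res m + 2 + i) \<longleftrightarrow> x i \<le> 1"
    and "i < n_prod m \<Longrightarrow> lp_row m \<gamma> (n_res m + 2 + n_prod m + i) x
      \<le> lp_rhs m \<gamma> s $ (n_res m + 2 + n_prod m + i) \<longleftrightarrow> 0 \<le> x i"
  unfolding lp_row_card lp_row_weight lp_rhs_explicit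
  by (simp_all only: lp_row_explicit lp_rhs_explicit) (auto simp: algebra_simps)

lemma lp_row_add: "lp_row m \<gamma> k (\<lambda>i. x i + t * y i) = lp_row m \<gamma> k x + t * lp_row m \<gamma> k y"
  by (simp add: lp_row_def sum_distrib_left sum.distrib[symmetric] algebra_simps)

lemma all_rows_iff:
  "(\<forall>k < n_res m + 2 * n_prod m + 2. P k) \<longleftrightarrow>
     P 0 \<and> (\<forall>j<n_res m. P (Suc j)) \<and> P (n_res m + 1) \<and>
     (\<forall>i<n_prod m. P (n_res m + 2 + i)) \<and> (\<forall>i<n_prod m. P (n_res m + 2 + n_prod m + i))"
  (is "?l \<longleftrightarrow> ?r")
proof
  assume r: ?r
  show ?l
  proof (intro allI impI)
    fix k assume k: "k < n_res m + 2 * n_prod m + 2"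
    consider "k = 0" | "k = Suc (k - 1)" "k - 1 < n_res m" | "k = n_res m + 1"
      | "k = n_res m + 2 + (k - (n_res m + 2))" "k - (n_res m + 2) < n_prod m"
      | "k = n_res m + 2 + n_prod m + (k - (n_res m + 2 + n_prod m))"
        "k - (n_res m + 2 + n_prod m) < n_prod m"
      using k by linarith
    then show "P k" using r by cases metis+
  qed
qed auto

lemma sum_rows:
  fixes f :: "nat \<Rightarrow> real"
  shows "(\<Sum>k < n_res m + 2 * n_prod m + 2. f k) =
     f 0 + (\<Sum>j<n_res m. f (Suc j)) + f (n_res m + 1) +
     (\<Sum>i<n_prod m. f (n_res m + 2 + i)) + (\<Sum>i<n_prod m. f (n_res m + 2 + n_prod m + i))"
proof -
  have shift: "sum f {..<a + b} = sum f {..<a} + (\<Sum>i<b. f (a + i))" for a b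
    by (induction b) auto
  have "n_res m + 2 * n_prod m + 2 = n_res m + 2 + n_prod m + n_prod m" by simp
  then have "(\<Sum>k < n_res m + 2 * n_prod m + 2. f k) = (\<Sum>k < n_res m + 2 + n_prod m + n_prod m. f k)"
    by (simp only:)
  also have "\<dots> = (\<Sum>k < Suc (Suc (n_res m)). f k) +
     (\<Sum>i<n_prod m. f (n_res m + 2 + i)) + (\<Sum>i<n_prod m. f (n_res m + 2 + n_prod m + i))"
    unfolding shift[of "n_res m + 2 + n_prod m" "n_prod m"] shift[of "n_res m + 2" "n_prod m"]
    by (simp only: add_2_eq_Suc')
  also have "(\<Sum>k < Suc (Suc (n_res m)). f k) = f 0 + (\<Sum>j<n_res m. f (Suc j)) + f (n_res m + 1)"
    by (subst sum.lessThan_Suc, subst sum.lessThan_Suc_shift) simp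
  finally show ?thesis by simp
qed

lemma binding_iff_row:
  "k \<in> binding m \<gamma> s x \<longleftrightarrow>
     k < n_res m + 2 * n_prod m + 2 \<and> lp_row m \<gamma> k x = lp_rhs m \<gamma> s $ k"
proof -
  have "dim_row (lp_mat m \<gamma>) = n_res m + 2 * n_prod m + 2" "dim_col (lp_mat m \<gamma>) = n_prod m"
    by (simp_all add: lp_mat_def Let_def)
  then show ?thesis
    by (auto simp: binding_def lp_row_def scalar_prod_def atLeast0LessThan)
qed

lemma weight_nonneg:
  assumes "valid_model m" "\<And>i. i < n_prod m \<Longrightarrow> 0 \<le> x i"
  shows "0 \<le> weight m x"
  unfolding weight_def
  using assms by (intro sum_nonneg mult_nonneg_nonneg) (auto simp: valid_model_def less_imp_le)

lemma usage_sales: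
  "(\<Sum>i<n_prod m. usage m i j * sales m x i) = usage_rate m x j / (1 + weight m x)"
  by (simp add: sales_def usage_rate_def sum_divide_distrib mult.assoc)

lemma Phi_feasible_iff:
  assumes "valid_model m"
  shows "x \<in> Phi_feasible m \<gamma> \<longleftrightarrow>
    (\<forall>i<n_prod m. 0 \<le> x i \<and> x i \<le> 1) \<and> (\<Sum>i<n_prod m. x i) \<le> real (cap m) \<and>
    (\<forall>j<n_res m. usage_rate m x j \<le> \<gamma> j * (1 + weight m x))"
proof (cases "\<forall>i<n_prod m. 0 \<le> x i \<and> x i \<le> 1")
  case True
  then have "1 + weight m x > 0" using weight_nonneg[OF assms, of x] by simp
  moreover have "(\<Sum>i<n_prod m. \<bar>x i\<bar>) = (\<Sum>i<n_prod m. x i)"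
    using True by (intro sum.cong) auto
  ultimately show ?thesis
    using True by (simp add: Phi_feasible_def usage_sales pos_divide_le_eq)
qed (auto simp: Phi_feasible_def)

lemma Psi_feasible_iff_rows:
  assumes "valid_model m"
  shows "x \<in> Psi_feasible m \<gamma> s \<longleftrightarrow>
    (\<forall>k < n_res m + 2 * n_prod m + 2. lp_row m \<gamma> k x \<le> lp_rhs m \<gamma> s $ k)"
  unfolding Psi_feasible_def all_rows_iff mem_Collect_eq Phi_feasible_iff[OF assms]
  by (simp only: lp_row_le_rhs_iff cong: imp_cong) blast

lemma Phi_feasible_if_rows:
  assumes "valid_model m"
    and "\<And>k. k < n_res m + 2 * n_prod m + 2 \<Longrightarrow> k \<noteq> n_res m + 1 \<Longrightarrow> lp_row m \<gamma> k x \<le> lp_rhs m \<gamma> s $ k"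
  shows "x \<in> Phi_feasible m \<gamma>"
proof -
  have "\<forall>k < n_res m + 2 * n_prod m + 2. k \<noteq> n_res m + 1 \<longrightarrow> lp_row m \<gamma> k x \<le> lp_rhs m \<gamma> s $ k"
    using assms(2) by blast
  then show ?thesis
    unfolding all_rows_iff Phi_feasible_iff[OF assms(1)]
    by (simp only: lp_row_le_rhs_iff cong: imp_cong) blast
qed

text \<open>An invertible binding matrix provides, for each binding constraint, a direction which changes
  that constraint alone among the binding ones; these directions also express every linear
  functional by the binding rows.\<close>

lemma binding_mat_inverse:
  assumes "invertible_mat (binding_mat m \<gamma> s x)"
  obtains y where
    "\<And>i i'. i < n_prod m \<Longrightarrow> i' < n_prod m \<Longrightarrow>
       (\<Sum>k\<in>binding m \<gamma> s x. y k i * lp_mat m \<gamma> $$ (k, i')) = (if i = i' then 1 else 0)"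
    "\<And>k k'. k \<in> binding m \<gamma> s x \<Longrightarrow> k' \<in> binding m \<gamma> s x \<Longrightarrow>
       lp_row m \<gamma> k (y k') = (if k = k' then 1 else 0)"
proof -
  let ?I = "binding m \<gamma> s x" and ?L = "lp_mat m \<gamma>" and ?N = "n_prod m"
  define B where "B = binding_mat m \<gamma> s x"
  define idx where "idx k = card {a \<in> ?I. a < k}" for k
  have dimL: "dim_row ?L = n_res m + 2 * ?N + 2" "dim_col ?L = ?N"
    by (simp_all add: lp_mat_def Let_def)
  have fin: "finite ?I" by (simp add: binding_def)
  have I: "{i. i < dim_row ?L \<and> i \<in> ?I} = ?I" by (auto simp: dimL binding_def)
  have dimB: "dim_row B = card ?I" "dim_col B = ?N"
    unfolding B_def binding_mat_def dim_submatrix I by (simp_all add: dimL)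
  have inj: "inj_on idx ?I"
    unfolding idx_def by (rule inj_on_inverseI[of _ "pick ?I"]) (rule pick_card_in_set)
  have idx_less: "idx k < card ?I" if "k \<in> ?I" for k
    unfolding idx_def using that fin by (intro psubset_card_mono) auto
  have bij: "bij_betw idx ?I {..<card ?I}"
    unfolding bij_betw_def
  proof
    have "idx ` ?I \<subseteq> {..<card ?I}" using idx_less by blast
    then show "idx ` ?I = {..<card ?I}"
      using card_image[OF inj] by (intro card_subset_eq) simp_all
  qed (rule inj)
  have entry: "B $$ (idx k, i) = ?L $$ (k, i)" if "k \<in> ?I" "i < ?N" for k i
  proof -
    have k: "k < dim_row ?L" and i: "i < dim_col ?L" using that by (simp_all add: dimL binding_def)
    have "card {a \<in> UNIV. a < i} = i" by simp
    then show ?thesis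
      using submatrix_index_card[OF k i that(1) UNIV_I] by (simp add: B_def binding_mat_def idx_def)
  qed
  from assms obtain C where C: "inverts_mat B C" "inverts_mat C B"
    unfolding invertible_mat_def B_def by blast
  have dimC: "dim_row C = ?N" "dim_col C = card ?I"
    using arg_cong[OF C(1)[unfolded inverts_mat_def], of dim_col]
      arg_cong[OF C(2)[unfolded inverts_mat_def], of dim_col] dimB by simp_all
  define y where "y k i = C $$ (i, idx k)" for k i
  show thesis
  proof
    fix i i' assume i: "i < ?N" "i' < ?N"
    have "(\<Sum>k\<in>?I. y k i * ?L $$ (k, i')) = (\<Sum>k\<in>?I. C $$ (i, idx k) * B $$ (idx k, i'))"
      by (intro sum.cong) (auto simp: y_def entry i)
    also have "\<dots> = (\<Sum>l<card ?I. C $$ (i, l) * B $$ (l, i'))"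
      by (rule sum.reindex_bij_betw[OF bij])
    also have "\<dots> = (C * B) $$ (i, i')"
      using i by (simp add: dimB dimC scalar_prod_def atLeast0LessThan)
    also have "\<dots> = (if i = i' then 1 else 0)"
      using C(2) i by (simp add: inverts_mat_def dimC)
    finally show "(\<Sum>k\<in>?I. y k i * ?L $$ (k, i')) = (if i = i' then 1 else 0)" .
  next
    fix k k' assume k: "k \<in> ?I" "k' \<in> ?I"
    have "lp_row m \<gamma> k (y k') = (\<Sum>i<?N. B $$ (idx k, i) * C $$ (i, idx k'))"
      unfolding lp_row_def by (intro sum.cong) (auto simp: y_def entry k)
    also have "\<dots> = (B * C) $$ (idx k, idx k')"
      using idx_less k by (simp add: dimB dimC scalar_prod_def atLeast0LessThan)
    also have "\<dots> = (if idx k = idx k' then 1 else 0)"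
      using C(1) idx_less k by (simp add: inverts_mat_def dimB)
    also have "(idx k = idx k') = (k = k')" using inj k by (auto dest: inj_onD)
    finally show "lp_row m \<gamma> k (y k') = (if k = k' then 1 else 0)" .
  qed
qed

lemma strict_inequalities_stable:
  fixes g h d :: "'a \<Rightarrow> real"
  assumes "finite F" "\<And>k. k \<in> F \<Longrightarrow> g k < h k"
  shows "\<exists>\<epsilon>. 0 < \<epsilon> \<and> \<epsilon> \<le> 1 \<and> (\<forall>k\<in>F. \<forall>t. \<bar>t\<bar> \<le> \<epsilon> \<longrightarrow> g k + t * d k < h k)"
  using assms
proof (induction F rule: finite_induct)
  case empty
  show ?case by (intro exI[of _ 1]) auto
next
  case (insert a F)
  then obtain \<epsilon> where \<epsilon>: "0 < \<epsilon>" "\<epsilon> \<le> 1" "\<forall>k\<in>F. \<forall>t. \<bar>t\<bar> \<le> \<epsilon> \<longrightarrow> g k + t * d k < h k" by auto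
  define \<eta> where "\<eta> = min \<epsilon> ((h a - g a) / (1 + \<bar>d a\<bar>))"
  have pos: "0 < \<eta>" using insert.prems[of a] \<epsilon>(1) by (simp add: \<eta>_def)
  have "g a + t * d a < h a" if "\<bar>t\<bar> \<le> \<eta>" for t
  proof (cases "t = 0")
    case False
    have "t * d a \<le> \<bar>t\<bar> * \<bar>d a\<bar>" by (metis abs_ge_self abs_mult)
    also have "\<dots> < \<bar>t\<bar> * (1 + \<bar>d a\<bar>)" using False by (simp add: distrib_left)
    also have "\<dots> \<le> (h a - g a) / (1 + \<bar>d a\<bar>) * (1 + \<bar>d a\<bar>)"
      using that by (intro mult_right_mono) (auto simp: \<eta>_def)
    also have "\<dots> = h a - g a" by simp
    finally show ?thesis by simp
  qed (use insert.prems[of a] in simp)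
  then show ?case
    using \<epsilon> pos by (intro exI[of _ \<eta>]) (auto simp: \<eta>_def)
qed

section \<open>Dual prices of the fluid problem\<close>

locale fluid_optimum =
  fixes m :: mnl_model and \<gamma>\<^sub>0 :: "nat \<Rightarrow> real" and xF :: "nat \<Rightarrow> real"
  assumes valid: "valid_model m"
    and optimal: "Phi_optimal m \<gamma>\<^sub>0 xF"
begin

abbreviation "V \<equiv> 1 + weight m xF"
abbreviation "active \<equiv> binding m \<gamma>\<^sub>0 V xF"

lemma xF_feasible: "xF \<in> Phi_feasible m \<gamma>\<^sub>0"
  and xF_best: "x \<in> Phi_feasible m \<gamma>\<^sub>0 \<Longrightarrow> fluid_revenue m x \<le> fluid_revenue m xF"
  using optimal by (auto simp: Phi_optimal_def is_arg_max_linorder)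

lemma V_ge_1: "1 \<le> V"
  using xF_feasible weight_nonneg[OF valid, of xF] by (auto simp: Phi_feasible_def)

lemma fluid_revenue_eq: "fluid_revenue m x = revenue_rate m x / (1 + weight m x)"
  by (simp add: fluid_revenue_def revenue_rate_def)

lemma revenue_rate_xF: "revenue_rate m xF = fluid_revenue m xF * V"
  using V_ge_1 by (simp add: fluid_revenue_eq)

text \<open>Clearing the denominator makes \<open>xF\<close> a maximiser of a linear functional over the polyhedron of
  the fluid problem.\<close>

lemma revenue_rate_le:
  assumes "x \<in> Phi_feasible m \<gamma>\<^sub>0"
  shows "revenue_rate m x \<le> fluid_revenue m xF * (1 + weight m x)"
proof -
  have "1 + weight m x > 0"
    using assms weight_nonneg[OF valid, of x] by (auto simp: Phi_feasible_def)
  then show ?thesis using xF_best[OF assms] by (simp add: fluid_revenue_eq pos_divide_le_eq)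
qed

lemma revenue_rate_nonneg:
  assumes "\<And>i. i < n_prod m \<Longrightarrow> 0 \<le> x i"
  shows "0 \<le> revenue_rate m x"
  unfolding revenue_rate_def using assms valid
  by (intro sum_nonneg mult_nonneg_nonneg) (auto simp: valid_model_def less_imp_le)

lemma xF_Psi_optimal: "Psi_optimal m \<gamma>\<^sub>0 V xF"
proof -
  have pos: "0 \<le> fluid_revenue m xF"
    using revenue_rate_nonneg[of xF] V_ge_1 xF_feasible by (auto simp: fluid_revenue_eq Phi_feasible_def)
  have "revenue_rate m x \<le> revenue_rate m xF" if "x \<in> Psi_feasible m \<gamma>\<^sub>0 V" for x
  proof -
    have "revenue_rate m x \<le> fluid_revenue m xF * (1 + weight m x)"
      using that by (intro revenue_rate_le) (simp add: Psi_feasible_def)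
    also have "\<dots> \<le> fluid_revenue m xF * V"
      using that pos by (intro mult_left_mono) (auto simp: Psi_feasible_def)
    finally show ?thesis by (simp add: revenue_rate_xF)
  qed
  then show ?thesis
    using xF_feasible by (auto simp: Psi_optimal_def is_arg_max_linorder Psi_feasible_def revenue_rate_def)
qed

lemma active_tight: "k \<in> active \<Longrightarrow> lp_row m \<gamma>\<^sub>0 k xF = lp_rhs m \<gamma>\<^sub>0 V $ k"
  by (simp add: binding_iff_row)

lemma weight_row_active: "n_res m + 1 \<in> active"
  using lp_row_weight[of m \<gamma>\<^sub>0 xF] lp_rhs_explicit(3)[of m \<gamma>\<^sub>0 V] by (simp add: binding_iff_row)

text \<open>The multipliers are read off from the inverse of the binding matrix. Moving from \<open>xF\<close> so that a
  single binding constraint becomes slack stays feasible, so optimality fixes the sign of its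
  multiplier; the bound on the total weight is no constraint of the fluid problem, can be moved
  both ways, and has multiplier zero.\<close>

lemma multipliers:
  assumes "invertible_mat (binding_mat m \<gamma>\<^sub>0 V xF)"
  obtains L where "\<And>k. 0 \<le> L k" "\<And>k. k \<notin> active \<Longrightarrow> L k = 0" "L (n_res m + 1) = 0"
    "\<And>x. revenue_rate m x - fluid_revenue m xF * weight m x
       = (\<Sum>k < n_res m + 2 * n_prod m + 2. L k * lp_row m \<gamma>\<^sub>0 k x)"
proof -
  let ?N = "n_prod m" and ?R = "fluid_revenue m xF" and ?n = "n_res m + 2 * n_prod m + 2"
  from binding_mat_inverse[OF assms] obtain y where
    y1: "\<And>i i'. i < ?N \<Longrightarrow> i' < ?N \<Longrightarrow>
       (\<Sum>k\<in>active. y k i * lp_mat m \<gamma>\<^sub>0 $$ (k, i')) = (if i = i' then 1 else 0)" and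
    y2: "\<And>k k'. k \<in> active \<Longrightarrow> k' \<in> active \<Longrightarrow> lp_row m \<gamma>\<^sub>0 k (y k') = (if k = k' then 1 else 0)"
    by blast
  define c where "c i = (profit m i - ?R) * pref m i" for i
  have c: "revenue_rate m x - ?R * weight m x = (\<Sum>i<?N. c i * x i)" for x
    by (simp add: revenue_rate_def weight_def c_def sum_distrib_left sum_subtractf[symmetric]
        algebra_simps)
  define L where "L k = (if k \<in> active then \<Sum>i<?N. c i * y k i else 0)" for k
  have feas: "xF \<in> Psi_feasible m \<gamma>\<^sub>0 V"
    using xF_feasible by (simp add: Psi_feasible_def)
  have active_sub: "active \<subseteq> {..<?n}" by (auto simp: binding_iff_row)
  have sign: "0 \<le> t * L k'" if k': "k' \<in> active" and t: "0 \<le> t \<or> k' = n_res m + 1" for k' t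
  proof -
    have slack: "lp_row m \<gamma>\<^sub>0 k xF < lp_rhs m \<gamma>\<^sub>0 V $ k" if "k \<in> {..<?n} - active" for k
      using feas that by (auto simp: Psi_feasible_iff_rows[OF valid] binding_iff_row order_less_le)
    obtain \<epsilon> where \<epsilon>: "0 < \<epsilon>" "\<And>k t. k \<in> {..<?n} - active \<Longrightarrow> \<bar>t\<bar> \<le> \<epsilon> \<Longrightarrow>
        lp_row m \<gamma>\<^sub>0 k xF + t * lp_row m \<gamma>\<^sub>0 k (y k') < lp_rhs m \<gamma>\<^sub>0 V $ k"
      using strict_inequalities_stable[of "{..<?n} - active" "\<lambda>k. lp_row m \<gamma>\<^sub>0 k xF"
          "\<lambda>k. lp_rhs m \<gamma>\<^sub>0 V $ k" "\<lambda>k. lp_row m \<gamma>\<^sub>0 k (y k')"] slack by auto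
    \<comment> \<open>A move along \<open>- y k'\<close>, short enough for the slack constraints and signed like \<open>t\<close>\<close>
    define u where "u = \<epsilon> / (1 + \<bar>t\<bar>) * t"
    have u: "\<bar>u\<bar> \<le> \<epsilon>"
      using \<epsilon>(1) by (simp add: u_def abs_mult field_simps)
    define x where "x i = xF i + (- u) * y k' i" for i
    have "x \<in> Phi_feasible m \<gamma>\<^sub>0"
    proof (rule Phi_feasible_if_rows[OF valid, where s = V])
      fix k assume k: "k < ?n" "k \<noteq> n_res m + 1"
      have row: "lp_row m \<gamma>\<^sub>0 k x = lp_row m \<gamma>\<^sub>0 k xF + (- u) * lp_row m \<gamma>\<^sub>0 k (y k')"
        unfolding x_def by (rule lp_row_add)
      show "lp_row m \<gamma>\<^sub>0 k x \<le> lp_rhs m \<gamma>\<^sub>0 V $ k"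
      proof (cases "k \<in> active")
        case True
        then show ?thesis
          using k' t k \<epsilon>(1) unfolding row by (auto simp: y2 active_tight u_def)
      next
        case False
        then show ?thesis
          using \<epsilon>(2)[of k "- u"] u k unfolding row by (simp add: less_imp_le)
      qed
    qed
    then have "(\<Sum>i<?N. c i * x i) \<le> ?R"
      using revenue_rate_le[of x] c[of x] by (simp add: algebra_simps)
    moreover have "(\<Sum>i<?N. c i * xF i) = ?R"
      using c[of xF] revenue_rate_xF by (simp add: algebra_simps)
    moreover have "(\<Sum>i<?N. c i * x i) = (\<Sum>i<?N. c i * xF i) - u * L k'"
      using k' by (simp add: x_def L_def sum_distrib_left sum_subtractf[symmetric] algebra_simps)
    ultimately have "0 \<le> \<epsilon> / (1 + \<bar>t\<bar>) * (t * L k')" by (simp add: u_def)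
    moreover have "0 < \<epsilon> / (1 + \<bar>t\<bar>)" using \<epsilon>(1) by simp
    ultimately show ?thesis by (simp only: zero_le_mult_iff) auto
  qed
  show thesis
  proof
    show "0 \<le> L k" for k
      using sign[of k 1] by (cases "k \<in> active") (auto simp: L_def)
    show "L k = 0" if "k \<notin> active" for k using that by (simp add: L_def)
    show "L (n_res m + 1) = 0"
      using sign[of "n_res m + 1" 1] sign[of "n_res m + 1" "-1"] weight_row_active by simp
    fix x
    have "(\<Sum>k<?n. L k * lp_row m \<gamma>\<^sub>0 k x) = (\<Sum>k\<in>active. L k * lp_row m \<gamma>\<^sub>0 k x)"
      using active_sub by (intro sum.mono_neutral_right) (auto simp: L_def)
    also have "\<dots> = (\<Sum>k\<in>active. \<Sum>i<?N. \<Sum>i'<?N. c i * x i' * (y k i * lp_mat m \<gamma>\<^sub>0 $$ (k, i')))"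
      by (intro sum.cong refl) (simp add: L_def lp_row_def sum_product mult_ac)
    also have "\<dots> = (\<Sum>i<?N. \<Sum>i'<?N. c i * x i' * (\<Sum>k\<in>active. y k i * lp_mat m \<gamma>\<^sub>0 $$ (k, i')))"
      unfolding sum_distrib_left by (subst sum.swap, rule sum.cong[OF refl], rule sum.swap)
    also have "\<dots> = (\<Sum>i<?N. \<Sum>i'<?N. if i = i' then c i * x i' else 0)"
      by (intro sum.cong refl) (simp add: y1)
    also have "\<dots> = (\<Sum>i<?N. c i * x i)" by simp
    finally show "revenue_rate m x - ?R * weight m x = (\<Sum>k<?n. L k * lp_row m \<gamma>\<^sub>0 k x)"
      by (simp add: c)
  qed
qed

text \<open>The multipliers of the cardinality constraint and of the upper bounds are absorbed by the price
  of time. What remains is complementary slackness: no offer earns more than the inventory and the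
  time that it uses are worth, and an offer under which all constraints binding at \<open>xF\<close> are binding
  earns exactly that.\<close>

lemma dual_prices:
  assumes "invertible_mat (binding_mat m \<gamma>\<^sub>0 V xF)"
  obtains \<pi> \<sigma> where "\<And>j. 0 \<le> \<pi> j" "0 \<le> \<sigma>"
    "(\<Sum>j<n_res m. \<pi> j * \<gamma>\<^sub>0 j) + \<sigma> = fluid_revenue m xF"
    "\<And>x. (\<And>i. i < n_prod m \<Longrightarrow> 0 \<le> x i \<and> x i \<le> 1) \<Longrightarrow> (\<Sum>i<n_prod m. x i) \<le> real (cap m) \<Longrightarrow>
       revenue_rate m x \<le> (\<Sum>j<n_res m. \<pi> j * usage_rate m x j) + \<sigma> * (1 + weight m x)"
    "\<And>\<gamma> s x. (\<And>k. k \<in> active \<Longrightarrow> lp_row m \<gamma> k x = lp_rhs m \<gamma> s $ k) \<Longrightarrow>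
       revenue_rate m x = (\<Sum>j<n_res m. \<pi> j * usage_rate m x j) + \<sigma> * (1 + weight m x)"
    "\<And>j. j < n_res m \<Longrightarrow> Suc j \<notin> active \<Longrightarrow> \<pi> j = 0"
proof -
  let ?N = "n_prod m" and ?M = "n_res m" and ?R = "fluid_revenue m xF"
  from multipliers[OF assms] obtain L where
    nn: "\<And>k. 0 \<le> L k" and supp: "\<And>k. k \<notin> active \<Longrightarrow> L k = 0" and L_weight: "L (?M + 1) = 0" and
    L: "\<And>x. revenue_rate m x - ?R * weight m x = (\<Sum>k < ?M + 2 * ?N + 2. L k * lp_row m \<gamma>\<^sub>0 k x)"
    by blast
  define \<pi> where "\<pi> j = L (Suc j)" for j
  define \<theta> where "\<theta> i = L (?M + 2 + i)" for i
  define \<mu> where "\<mu> i = L (?M + 2 + ?N + i)" for i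
  define \<sigma> where "\<sigma> = L 0 * real (cap m) + (\<Sum>i<?N. \<theta> i)"
  have expand: "revenue_rate m x - ?R * weight m x = L 0 * (\<Sum>i<?N. x i)
      + (\<Sum>j<?M. \<pi> j * usage_rate m x j) - (\<Sum>j<?M. \<pi> j * \<gamma>\<^sub>0 j) * weight m x
      + (\<Sum>i<?N. \<theta> i * x i) - (\<Sum>i<?N. \<mu> i * x i)" for x
  proof -
    have "(\<Sum>j<?M. L (Suc j) * lp_row m \<gamma>\<^sub>0 (Suc j) x)
        = (\<Sum>j<?M. \<pi> j * usage_rate m x j) - (\<Sum>j<?M. \<pi> j * \<gamma>\<^sub>0 j) * weight m x"
      unfolding sum_distrib_right sum_subtractf[symmetric]
      by (intro sum.cong refl) (simp add: lp_row_usage \<pi>_def algebra_simps)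
    moreover have "(\<Sum>i<?N. L (?M + 2 + i) * lp_row m \<gamma>\<^sub>0 (?M + 2 + i) x) = (\<Sum>i<?N. \<theta> i * x i)"
      by (intro sum.cong refl) (simp only: lp_row_upper \<theta>_def lessThan_iff)
    moreover have "(\<Sum>i<?N. L (?M + 2 + ?N + i) * lp_row m \<gamma>\<^sub>0 (?M + 2 + ?N + i) x)
        = - (\<Sum>i<?N. \<mu> i * x i)"
      unfolding sum_negf[symmetric]
      by (intro sum.cong refl) (simp only: lp_row_lower \<mu>_def lessThan_iff mult_minus_right)
    ultimately show ?thesis
      unfolding L sum_rows L_weight lp_row_card by simp
  qed
  have tight: "L 0 * (\<Sum>i<?N. x i) + (\<Sum>i<?N. \<theta> i * x i) = \<sigma>" "(\<Sum>i<?N. \<mu> i * x i) = 0"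
    if b: "\<And>k. k \<in> active \<Longrightarrow> lp_row m \<gamma> k x = lp_rhs m \<gamma> s $ k" for \<gamma> s x
  proof -
    have card: "L 0 * (\<Sum>i<?N. x i) = L 0 * real (cap m)"
      using b[of 0] supp[of 0] by (cases "0 \<in> active") (simp_all add: lp_row_card lp_rhs_explicit)
    have upper: "\<theta> i * x i = \<theta> i" if "i < ?N" for i
    proof (cases "?M + 2 + i \<in> active")
      case True
      then have "x i = 1"
        using b[OF True] lp_row_upper[OF that] lp_rhs_explicit(4)[OF that] by metis
      then show ?thesis by simp
    qed (simp add: \<theta>_def supp)
    have "\<mu> i * x i = 0" if "i < ?N" for i
    proof (cases "?M + 2 + ?N + i \<in> active")
      case True
      then have "- x i = 0"
        using b[OF True] lp_row_lower[OF that] lp_rhs_explicit(5)[OF that] by metis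
      then show ?thesis by simp
    qed (simp add: \<mu>_def supp)
    then show "(\<Sum>i<?N. \<mu> i * x i) = 0" by (intro sum.neutral) simp
    moreover have "(\<Sum>i<?N. \<theta> i * x i) = (\<Sum>i<?N. \<theta> i)" using upper by (intro sum.cong) simp_all
    ultimately show "L 0 * (\<Sum>i<?N. x i) + (\<Sum>i<?N. \<theta> i * x i) = \<sigma>"
      using card by (simp add: \<sigma>_def)
  qed
  \<comment> \<open>Evaluated at \<open>xF\<close>, the expansion says that the prices add up to the optimal revenue.\<close>
  have total: "(\<Sum>j<?M. \<pi> j * \<gamma>\<^sub>0 j) + \<sigma> = ?R"
  proof -
    have "\<pi> j * usage_rate m xF j = \<pi> j * \<gamma>\<^sub>0 j * V" if "j < ?M" for j
    proof (cases "Suc j \<in> active")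
      case True
      then have "usage_rate m xF j = \<gamma>\<^sub>0 j * V"
        using active_tight[OF True] that by (simp add: lp_row_usage lp_rhs_explicit algebra_simps)
      then show ?thesis by simp
    qed (simp add: \<pi>_def supp)
    then have "(\<Sum>j<?M. \<pi> j * usage_rate m xF j) = (\<Sum>j<?M. \<pi> j * \<gamma>\<^sub>0 j) * V"
      unfolding sum_distrib_right by (intro sum.cong refl) simp
    moreover have "revenue_rate m xF = ?R + ?R * weight m xF"
      using revenue_rate_xF by (simp add: algebra_simps)
    ultimately show ?thesis
      using expand[of xF] tight[OF active_tight] by (simp add: algebra_simps)
  qed
  show thesis
  proof
    show "0 \<le> \<pi> j" for j by (simp add: \<pi>_def nn)
    show "0 \<le> \<sigma>" unfolding \<sigma>_def \<theta>_def using nn by (intro add_nonneg_nonneg sum_nonneg) auto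
    show "(\<Sum>j<?M. \<pi> j * \<gamma>\<^sub>0 j) + \<sigma> = ?R" by (rule total)
    show "\<pi> j = 0" if "Suc j \<notin> active" for j using that by (simp add: \<pi>_def supp)
  next
    fix x assume x: "\<And>i. i < ?N \<Longrightarrow> 0 \<le> x i \<and> x i \<le> 1" "(\<Sum>i<?N. x i) \<le> real (cap m)"
    have "L 0 * (\<Sum>i<?N. x i) \<le> L 0 * real (cap m)" using x(2) nn by (intro mult_left_mono) auto
    moreover have "(\<Sum>i<?N. \<theta> i * x i) \<le> (\<Sum>i<?N. \<theta> i)"
      using x(1) nn by (intro sum_mono mult_left_le) (auto simp: \<theta>_def)
    moreover have "0 \<le> (\<Sum>i<?N. \<mu> i * x i)"
      using x(1) nn by (intro sum_nonneg mult_nonneg_nonneg) (auto simp: \<mu>_def)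
    ultimately have "revenue_rate m x - ?R * weight m x
        \<le> (\<Sum>j<?M. \<pi> j * usage_rate m x j) - (\<Sum>j<?M. \<pi> j * \<gamma>\<^sub>0 j) * weight m x + \<sigma>"
      unfolding expand \<sigma>_def by linarith
    then show "revenue_rate m x \<le> (\<Sum>j<?M. \<pi> j * usage_rate m x j) + \<sigma> * (1 + weight m x)"
      unfolding total[symmetric] by (simp add: algebra_simps)
  next
    fix \<gamma> s x assume "\<And>k. k \<in> active \<Longrightarrow> lp_row m \<gamma> k x = lp_rhs m \<gamma> s $ k"
    note tight[OF this]
    then have "revenue_rate m x - ?R * weight m x
        = (\<Sum>j<?M. \<pi> j * usage_rate m x j) - (\<Sum>j<?M. \<pi> j * \<gamma>\<^sub>0 j) * weight m x + \<sigma>"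
      unfolding expand by linarith
    then show "revenue_rate m x = (\<Sum>j<?M. \<pi> j * usage_rate m x j) + \<sigma> * (1 + weight m x)"
      unfolding total[symmetric] by (simp add: algebra_simps)
  qed
qed

end

section \<open>Optima of the perturbed programs\<close>

lemma lp_row_cong_rate:
  assumes "k < n_res m + 2 * n_prod m + 2" "\<And>j. j < n_res m \<Longrightarrow> k = Suc j \<Longrightarrow> \<gamma> j = \<gamma>' j"
  shows "lp_row m \<gamma> k x = lp_row m \<gamma>' k x" "lp_rhs m \<gamma> s $ k = lp_rhs m \<gamma>' s $ k"
proof -
  have "\<gamma> (k - 1) = \<gamma>' (k - 1)" if "k \<noteq> 0" "k \<le> n_res m"
    using assms(2)[of "k - 1"] that by simp
  then show "lp_row m \<gamma> k x = lp_row m \<gamma>' k x" "lp_rhs m \<gamma> s $ k = lp_rhs m \<gamma>' s $ k"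
    using assms(1) by (auto simp: lp_row_def lp_mat_def lp_rhs_def Let_def intro!: sum.cong)
qed

lemma revenue_rate_add:
  "revenue_rate m (\<lambda>i. x i + t * y i) = revenue_rate m x + t * revenue_rate m y"
  by (simp add: revenue_rate_def sum_distrib_left sum.distrib[symmetric] algebra_simps)

lemma Psi_optimal_iff:
  "Psi_optimal m \<gamma> s x \<longleftrightarrow> x \<in> Psi_feasible m \<gamma> s \<and>
     (\<forall>y\<in>Psi_feasible m \<gamma> s. revenue_rate m y \<le> revenue_rate m x)"
  by (auto simp: Psi_optimal_def is_arg_max_linorder revenue_rate_def)

lemma zero_Psi_feasible:
  assumes "valid_model m" "1 \<le> s" "\<And>j. j < n_res m \<Longrightarrow> 0 \<le> \<gamma> j"
  shows "(\<lambda>_. 0) \<in> Psi_feasible m \<gamma> s"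
  using assms by (simp add: Psi_feasible_def Phi_feasible_iff usage_rate_def weight_def)

locale stable_fluid_optimum = fluid_optimum +
  fixes \<rho> :: real
  assumes rho_pos: "0 < \<rho>"
    and rho_less: "\<And>j. j < n_res m \<Longrightarrow> \<rho> < \<gamma>\<^sub>0 j"
    and rho_less_weight: "\<rho> < weight m xF"
    and stable: "\<And>\<delta> \<epsilon> x. (\<And>j. j < n_res m \<Longrightarrow> \<bar>\<delta> j\<bar> \<le> \<rho>) \<Longrightarrow> \<bar>\<epsilon>\<bar> \<le> \<rho> \<Longrightarrow>
      Psi_optimal m (\<lambda>j. \<gamma>\<^sub>0 j + \<delta> j) (V + \<epsilon>) x \<Longrightarrow> binding m (\<lambda>j. \<gamma>\<^sub>0 j + \<delta> j) (V + \<epsilon>) x = active"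
    and solvable: "\<And>\<gamma> s. Psi_feasible m \<gamma> s \<noteq> {} \<Longrightarrow> \<exists>x. Psi_optimal m \<gamma> s x"
begin

text \<open>Stability is assumed for small perturbations only, whereas resources that are not binding
  accumulate without bound. Their excess is cut off at \<open>\<rho>\<close>: an optimum \<open>y\<close> of the program so
  obtained is stable, and from \<open>y\<close> a short move towards the optimum \<open>x\<close> of the given program stays
  feasible for it. Hence points on the segment are optimal as well, and constraints that are tight
  at two of them are tight at \<open>x\<close>.\<close>

lemma active_stays_tight:
  assumes s: "\<bar>s - V\<bar> \<le> \<rho>"
    and low: "\<And>j. j < n_res m \<Longrightarrow> \<gamma>\<^sub>0 j - \<rho> \<le> \<gamma> j"
    and up: "\<And>j. j < n_res m \<Longrightarrow> Suc j \<in> active \<Longrightarrow> \<gamma> j \<le> \<gamma>\<^sub>0 j + \<rho>"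
    and x: "Psi_optimal m \<gamma> s x" and k: "k \<in> active"
  shows "lp_row m \<gamma> k x = lp_rhs m \<gamma> s $ k"
proof -
  let ?n = "n_res m + 2 * n_prod m + 2"
  define \<delta> where "\<delta> j = min (\<gamma> j - \<gamma>\<^sub>0 j) \<rho>" for j
  define \<gamma>' where "\<gamma>' = (\<lambda>j. \<gamma>\<^sub>0 j + \<delta> j)"
  have \<delta>: "\<bar>\<delta> j\<bar> \<le> \<rho>" if "j < n_res m" for j using low[OF that] rho_pos by (simp add: \<delta>_def)
  have le: "\<gamma>' j \<le> \<gamma> j" for j by (simp add: \<gamma>'_def \<delta>_def)
  have same: "\<gamma>' j = \<gamma> j" if "j < n_res m" "Suc j \<in> active" for j
    using up[OF that] by (simp add: \<gamma>'_def \<delta>_def)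
  have active_less: "k < ?n" if "k \<in> active" for k using that by (simp add: binding_iff_row)
  have same_row: "lp_row m \<gamma>' k z = lp_row m \<gamma> k z" "lp_rhs m \<gamma>' s $ k = lp_rhs m \<gamma> s $ k"
    if "k \<in> active" for k z
    using lp_row_cong_rate[OF active_less[OF that], of \<gamma>' \<gamma>] same that by metis+
  have stable': "binding m \<gamma>' s z = active" if "Psi_optimal m \<gamma>' s z" for z
    using stable[of \<delta> "s - V" z] \<delta> s that by (simp add: \<gamma>'_def)
  have "(\<lambda>_. 0) \<in> Psi_feasible m \<gamma>' s"
  proof (rule zero_Psi_feasible[OF valid])
    show "1 \<le> s" using s rho_less_weight by linarith
    show "0 \<le> \<gamma>' j" if "j < n_res m" for j
      using \<delta>[OF that] rho_less[OF that] by (simp add: \<gamma>'_def)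
  qed
  then obtain y where y: "Psi_optimal m \<gamma>' s y" using solvable by blast
  have y_feas: "y \<in> Psi_feasible m \<gamma>' s" using y by (simp add: Psi_optimal_iff)
  have x_feas: "x \<in> Psi_feasible m \<gamma> s" using x by (simp add: Psi_optimal_iff)
  have "y \<in> Psi_feasible m \<gamma> s"
  proof -
    have "0 \<le> 1 + weight m y"
      using y_feas weight_nonneg[OF valid, of y] by (auto simp: Psi_feasible_def Phi_feasible_def)
    then have "\<gamma>' j * (1 + weight m y) \<le> \<gamma> j * (1 + weight m y)" for j
      using le by (rule mult_right_mono[rotated])
    then show ?thesis
      using y_feas unfolding Psi_feasible_def mem_Collect_eq Phi_feasible_iff[OF valid]
      by (meson order_trans)
  qed
  then have better: "revenue_rate m y \<le> revenue_rate m x" using x by (simp add: Psi_optimal_iff)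
  have "lp_row m \<gamma>' k y < lp_rhs m \<gamma>' s $ k" if "k \<in> {..<?n} - active" for k
    using y_feas that stable'[OF y]
    by (auto simp: Psi_feasible_iff_rows[OF valid] binding_iff_row set_eq_iff order_less_le)
  then obtain \<epsilon> where \<epsilon>: "0 < \<epsilon>" "\<epsilon> \<le> 1" "\<And>k t. k \<in> {..<?n} - active \<Longrightarrow> \<bar>t\<bar> \<le> \<epsilon> \<Longrightarrow>
      lp_row m \<gamma>' k y + t * (lp_row m \<gamma>' k x - lp_row m \<gamma>' k y) < lp_rhs m \<gamma>' s $ k"
    using strict_inequalities_stable[of "{..<?n} - active" "\<lambda>k. lp_row m \<gamma>' k y"
        "\<lambda>k. lp_rhs m \<gamma>' s $ k" "\<lambda>k. lp_row m \<gamma>' k x - lp_row m \<gamma>' k y"] by auto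
  define z where "z i = y i + \<epsilon> * (x i + (- 1) * y i)" for i
  have row_z: "lp_row m \<gamma>' k z = lp_row m \<gamma>' k y + \<epsilon> * (lp_row m \<gamma>' k x - lp_row m \<gamma>' k y)" for k
    unfolding z_def lp_row_add by simp
  have "z \<in> Psi_feasible m \<gamma>' s"
    unfolding Psi_feasible_iff_rows[OF valid]
  proof (intro allI impI)
    fix k assume "k < ?n"
    show "lp_row m \<gamma>' k z \<le> lp_rhs m \<gamma>' s $ k"
    proof (cases "k \<in> active")
      case True
      have "lp_row m \<gamma>' k y \<le> lp_rhs m \<gamma>' s $ k" "lp_row m \<gamma>' k x \<le> lp_rhs m \<gamma>' s $ k"
        using y_feas x_feas active_less[OF True] same_row[OF True]
        by (auto simp: Psi_feasible_iff_rows[OF valid])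
      then have "(1 - \<epsilon>) * lp_row m \<gamma>' k y + \<epsilon> * lp_row m \<gamma>' k x \<le> lp_rhs m \<gamma>' s $ k"
        using \<epsilon>(1,2) by (intro convex_bound_le) auto
      then show ?thesis by (simp add: row_z algebra_simps)
    qed (use \<epsilon>(3)[of k \<epsilon>] \<epsilon>(1) \<open>k < ?n\<close> in \<open>simp add: row_z less_imp_le\<close>)
  qed
  moreover have "revenue_rate m y \<le> revenue_rate m z"
    using better \<epsilon>(1) unfolding z_def revenue_rate_add by simp
  ultimately have "Psi_optimal m \<gamma>' s z"
    using y unfolding Psi_optimal_iff by (meson order_trans)
  then have "lp_row m \<gamma>' k z = lp_rhs m \<gamma>' s $ k" "lp_row m \<gamma>' k y = lp_rhs m \<gamma>' s $ k"
    using stable' y k binding_iff_row[of k m \<gamma>' s] by blast+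
  then have "lp_row m \<gamma>' k x = lp_rhs m \<gamma>' s $ k"
    using \<epsilon>(1) by (simp add: row_z)
  then show ?thesis by (simp add: same_row[OF k])
qed

end

section \<open>The fluid revenue bounds the revenue of every policy\<close>

definition offer_weight :: "mnl_model \<Rightarrow> nat set \<Rightarrow> real" where
  "offer_weight m S = (\<Sum>i\<in>S. pref m i)"

definition offerable :: "mnl_model \<Rightarrow> nat set \<Rightarrow> bool" where
  "offerable m S \<longleftrightarrow> S \<subseteq> {..<n_prod m} \<and> card S \<le> cap m"

lemma offerable_finite: "offerable m S \<Longrightarrow> finite S"
  by (auto simp: offerable_def intro: finite_subset)

lemma offerable_pref:
  assumes "valid_model m" "offerable m S" "i \<in> S"
  shows "0 < pref m i" "0 \<le> profit m i" "profit m i \<le> 1"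
  using assms by (auto simp: valid_model_def offerable_def)

lemma offer_weight_nonneg: "valid_model m \<Longrightarrow> offerable m S \<Longrightarrow> 0 \<le> offer_weight m S"
  unfolding offer_weight_def by (intro sum_nonneg) (auto dest: offerable_pref less_imp_le)

lemma
  assumes "valid_model m" "offerable m S"
  shows finite_set_mnl_choice: "finite (set_pmf (mnl_choice m S))"
    and set_mnl_choice: "set_pmf (mnl_choice m S) \<subseteq> insert None (Some ` S)"
    and expectation_offer: "measure_pmf.expectation (mnl_choice m S) f
      = (f None + (\<Sum>i\<in>S. pref m i * f (Some i))) / (1 + offer_weight m S)"
proof -
  have S: "finite S" "\<And>i. i \<in> S \<Longrightarrow> 0 \<le> pref m i"
    using assms by (auto dest: offerable_finite offerable_pref(1))
  show "set_pmf (mnl_choice m S) \<subseteq> insert None (Some ` S)"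
    by (rule set_mnl_choice_subset[OF S])
  then show "finite (set_pmf (mnl_choice m S))"
    by (rule finite_subset) (use S in simp)
  show "measure_pmf.expectation (mnl_choice m S) f
      = (f None + (\<Sum>i\<in>S. pref m i * f (Some i))) / (1 + offer_weight m S)"
    unfolding offer_weight_def by (rule expectation_mnl_choice[OF S])
qed

lemma reward_bounds:
  assumes "valid_model m" "offerable m S" "p \<in> set_pmf (mnl_choice m S)"
  shows "0 \<le> reward m p" "reward m p \<le> 1"
  using set_mnl_choice[OF assms(1,2)] assms offerable_pref[OF assms(1,2)]
  by (auto simp: reward_def split: option.splits)

locale priced_fluid_optimum = fluid_optimum +
  fixes \<pi> :: "nat \<Rightarrow> real" and \<sigma> :: real
  assumes price_nonneg: "\<And>j. 0 \<le> \<pi> j" and time_price_nonneg: "0 \<le> \<sigma>"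
    and price_total: "(\<Sum>j<n_res m. \<pi> j * \<gamma>\<^sub>0 j) + \<sigma> = fluid_revenue m xF"
    and price_bound: "\<And>x. (\<And>i. i < n_prod m \<Longrightarrow> 0 \<le> x i \<and> x i \<le> 1) \<Longrightarrow>
       (\<Sum>i<n_prod m. x i) \<le> real (cap m) \<Longrightarrow>
       revenue_rate m x \<le> (\<Sum>j<n_res m. \<pi> j * usage_rate m x j) + \<sigma> * (1 + weight m x)"
    and price_exact: "\<And>\<gamma> s x. (\<And>k. k \<in> active \<Longrightarrow> lp_row m \<gamma> k x = lp_rhs m \<gamma> s $ k) \<Longrightarrow>
       revenue_rate m x = (\<Sum>j<n_res m. \<pi> j * usage_rate m x j) + \<sigma> * (1 + weight m x)"
    and price_support: "\<And>j. j < n_res m \<Longrightarrow> Suc j \<notin> active \<Longrightarrow> \<pi> j = 0"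
begin

text \<open>The value, at the dual prices, of an inventory with \<open>n\<close> periods to go.\<close>

definition worth :: "nat \<Rightarrow> (nat \<Rightarrow> real) \<Rightarrow> real" where
  "worth n C = (\<Sum>j<n_res m. \<pi> j * C j) + \<sigma> * real n"

definition markup :: "nat \<Rightarrow> real" where
  "markup i = pref m i * (profit m i - (\<Sum>j<n_res m. \<pi> j * usage m i j))"

text \<open>Expected revenue minus worth used up while \<open>S\<close> is offered until the first no-purchase.\<close>

definition surplus :: "nat set \<Rightarrow> real" where
  "surplus S = (\<Sum>i\<in>S. markup i) - \<sigma> * (1 + offer_weight m S)"

lemma sum_markup:
  "(\<Sum>i<n_prod m. markup i * x i) = revenue_rate m x - (\<Sum>j<n_res m. \<pi> j * usage_rate m x j)"
proof -
  have "(\<Sum>j<n_res m. \<pi> j * usage_rate m x j)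
      = (\<Sum>i<n_prod m. \<Sum>j<n_res m. \<pi> j * (usage m i j * pref m i * x i))"
    unfolding usage_rate_def sum_distrib_left by (rule sum.swap)
  then show ?thesis
    by (simp add: revenue_rate_def markup_def sum_subtractf[symmetric] sum_distrib_left
        sum_distrib_right algebra_simps)
qed

lemma sum_offer_indicator:
  fixes f :: "nat \<Rightarrow> real"
  assumes "offerable m S"
  shows "(\<Sum>i<n_prod m. f i * of_bool (i \<in> S)) = (\<Sum>i\<in>S. f i)"
proof -
  have "(\<Sum>i<n_prod m. f i * of_bool (i \<in> S)) = (\<Sum>i\<in>{i\<in>{..<n_prod m}. i \<in> S}. f i)"
    unfolding sum.inter_filter[OF finite_lessThan] by (intro sum.cong) auto
  also have "{i\<in>{..<n_prod m}. i \<in> S} = S" using assms by (auto simp: offerable_def)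
  finally show ?thesis .
qed

text \<open>The price bound at the indicator vector of \<open>S\<close>.\<close>

lemma surplus_nonpos:
  assumes "offerable m S"
  shows "surplus S \<le> 0"
proof -
  let ?x = "\<lambda>i. of_bool (i \<in> S) :: real"
  have "(\<Sum>i<n_prod m. ?x i) = real (card S)"
    using sum_offer_indicator[OF assms, of "\<lambda>_. 1"] by simp
  then have "revenue_rate m ?x \<le> (\<Sum>j<n_res m. \<pi> j * usage_rate m ?x j) + \<sigma> * (1 + weight m ?x)"
    using assms by (intro price_bound) (auto simp: offerable_def)
  moreover have "(\<Sum>i\<in>S. markup i) = revenue_rate m ?x - (\<Sum>j<n_res m. \<pi> j * usage_rate m ?x j)"
    unfolding sum_offer_indicator[OF assms, of markup, symmetric] by (rule sum_markup)
  moreover have "weight m ?x = offer_weight m S"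
    unfolding weight_def offer_weight_def by (rule sum_offer_indicator[OF assms])
  ultimately show ?thesis by (simp add: surplus_def)
qed

lemma worth_update:
  assumes "i \<in> S" "offerable m S"
  shows "pref m i * (profit m i + worth n (update_inventory m C (Some i)))
    = markup i + pref m i * worth n C"
  by (simp add: worth_def markup_def update_inventory_def right_diff_distrib sum_subtractf
      algebra_simps sum_distrib_left)

lemma worth_Suc: "worth (Suc n) C = worth n C + \<sigma>"
  by (simp add: worth_def algebra_simps)

lemma expectation_worth:
  assumes "offerable m S"
  shows "measure_pmf.expectation (mnl_choice m S) (\<lambda>p. reward m p + worth n (update_inventory m C p))
    = worth (Suc n) C + surplus S / (1 + offer_weight m S)"
proof -
  have pos: "0 < 1 + offer_weight m S" using offer_weight_nonneg[OF valid assms] by simp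
  have "(\<Sum>i\<in>S. pref m i * (profit m i + worth n (update_inventory m C (Some i))))
      = (\<Sum>i\<in>S. markup i) + offer_weight m S * worth n C"
    using assms by (simp add: worth_update sum.distrib offer_weight_def sum_distrib_right)
  then have "measure_pmf.expectation (mnl_choice m S) (\<lambda>p. reward m p + worth n (update_inventory m C p))
    = ((\<Sum>i\<in>S. markup i) + worth n C * (1 + offer_weight m S)) / (1 + offer_weight m S)"
    unfolding expectation_offer[OF valid assms]
    by (simp add: reward_def update_inventory_def algebra_simps)
  also have "\<dots> = worth (Suc n) C + surplus S / (1 + offer_weight m S)"
    using pos by (simp add: worth_Suc surplus_def field_simps)
  finally show ?thesis .
qed

lemma policy_run_support:
  assumes "admissible m T \<pi>'" "\<forall>j<n_res m. 0 \<le> C\<^sub>0 j" "t \<le> T"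
  shows "finite (set_pmf (policy_run m C\<^sub>0 \<pi>' t)) \<and>
    (\<forall>(C, w)\<in>set_pmf (policy_run m C\<^sub>0 \<pi>' t). \<forall>j<n_res m. 0 \<le> C j)"
  using assms(3)
proof (induction t)
  case 0
  then show ?case using assms(2) by simp
next
  case (Suc t)
  have offer: "offerable m (\<pi>' (Suc t) C)" "sufficient_inventory m C (\<pi>' (Suc t) C)" for C
    using assms(1) Suc.prems by (auto simp: admissible_def offerable_def)
  have "finite (set_pmf (policy_run m C\<^sub>0 \<pi>' (Suc t)))"
    using Suc finite_set_mnl_choice[OF valid offer(1)] by auto
  moreover have "0 \<le> update_inventory m C p j"
    if "(C, w) \<in> set_pmf (policy_run m C\<^sub>0 \<pi>' t)" "p \<in> set_pmf (mnl_choice m (\<pi>' (Suc t) C))"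
      "j < n_res m" for C w p j
    using Suc that set_mnl_choice[OF valid offer(1)] offer(2)[of C]
    by (fastforce simp: update_inventory_def sufficient_inventory_def split: option.splits)
  ultimately show ?case by auto
qed

text \<open>Weak duality: revenue plus remaining worth is a supermartingale, and no worth is negative at
  the end.\<close>

lemma policy_revenue_le:
  assumes adm: "admissible m T \<pi>'" and C: "\<forall>j<n_res m. 0 \<le> C\<^sub>0 j"
  shows "policy_revenue m C\<^sub>0 T \<pi>' \<le> worth T C\<^sub>0"
proof -
  let ?E = "\<lambda>t. measure_pmf.expectation (policy_run m C\<^sub>0 \<pi>' t) (\<lambda>(C, w). w + worth (T - t) C)"
  have "?E t \<le> worth T C\<^sub>0" if "t \<le> T" for t
    using that
  proof (induction t)
    case (Suc t)
    have offer: "offerable m (\<pi>' (Suc t) C)" for C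
      using adm Suc.prems by (auto simp: admissible_def offerable_def)
    have fin: "finite (set_pmf (policy_run m C\<^sub>0 \<pi>' t))"
      using policy_run_support[OF adm C, where t = t] Suc.prems by simp
    have n: "T - t = Suc (T - Suc t)" using Suc.prems by simp
    have step: "measure_pmf.expectation (mnl_choice m (\<pi>' (Suc t) C))
        (\<lambda>p. w + reward m p + worth (T - Suc t) (update_inventory m C p)) \<le> w + worth (T - t) C" for C w
    proof -
      have "measure_pmf.expectation (mnl_choice m (\<pi>' (Suc t) C))
          (\<lambda>p. w + (reward m p + worth (T - Suc t) (update_inventory m C p)))
        = w + (worth (T - t) C + surplus (\<pi>' (Suc t) C) / (1 + offer_weight m (\<pi>' (Suc t) C)))"
        unfolding n expectation_worth[OF offer, symmetric]
        by (subst Bochner_Integration.integral_add)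
          (auto intro!: integrable_measure_pmf_finite finite_set_mnl_choice[OF valid offer])
      moreover have "surplus (\<pi>' (Suc t) C) / (1 + offer_weight m (\<pi>' (Suc t) C)) \<le> 0"
        using surplus_nonpos[OF offer] offer_weight_nonneg[OF valid offer, of C]
        by (intro divide_nonpos_nonneg) auto
      ultimately show ?thesis by (simp add: add.assoc)
    qed
    have "?E (Suc t) = measure_pmf.expectation (policy_run m C\<^sub>0 \<pi>' t) (\<lambda>(C, w).
        measure_pmf.expectation (mnl_choice m (\<pi>' (Suc t) C))
          (\<lambda>p. w + reward m p + worth (T - Suc t) (update_inventory m C p)))"
      unfolding policy_run.simps using fin finite_set_mnl_choice[OF valid offer]
      by (subst expectation_bind_finite) (auto simp: case_prod_unfold)
    also have "\<dots> \<le> ?E t"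
      using fin step by (intro expectation_mono_finite) auto
    finally show ?case using Suc by simp
  qed simp
  from this[OF order_refl] have "?E T \<le> worth T C\<^sub>0" .
  moreover have "policy_revenue m C\<^sub>0 T \<pi>' \<le> ?E T"
    unfolding policy_revenue_def using policy_run_support[OF adm C, where t = T] price_nonneg
    by (intro expectation_mono_finite) (fastforce simp: worth_def intro!: sum_nonneg)+
  ultimately show ?thesis by simp
qed

lemma optimal_revenue_le:
  assumes "\<And>j. j < n_res m \<Longrightarrow> 0 \<le> \<gamma>\<^sub>0 j"
  shows "optimal_revenue m (initial_inventory T \<gamma>\<^sub>0) T \<le> worth T (initial_inventory T \<gamma>\<^sub>0)"
  unfolding optimal_revenue_def
proof (rule cSUP_least)
  have "admissible m T (\<lambda>_ _. {})" by (simp add: admissible_def sufficient_inventory_def)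
  then show "{\<pi>'. admissible m T \<pi>'} \<noteq> {}" by blast
qed (auto intro!: policy_revenue_le mult_nonneg_nonneg assms simp: initial_inventory_def)

end

section \<open>Expected revenue to go\<close>

primrec revenue_to_go ::
  "mnl_model \<Rightarrow> real \<Rightarrow> (nat \<Rightarrow> (nat \<Rightarrow> real) \<Rightarrow> real \<Rightarrow> nat set pmf) \<Rightarrow>
     nat \<Rightarrow> (nat \<Rightarrow> real) \<Rightarrow> phase \<Rightarrow> real"
where
  "revenue_to_go m \<tau>\<^sub>0 draw 0 C ph = 0"
| "revenue_to_go m \<tau>\<^sub>0 draw (Suc n) C ph =
     measure_pmf.expectation (resolve m \<tau>\<^sub>0 draw (Suc n) C ph) (\<lambda>ph'.
     measure_pmf.expectation (mnl_choice m (offered ph')) (\<lambda>p.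
       reward m p + revenue_to_go m \<tau>\<^sub>0 draw n (update_inventory m C p) (next_phase ph' p)))"

lemma resolve_support:
  assumes "resolving_rule m draw" "offerable m (offered ph)"
  shows "finite (set_pmf (resolve m \<tau>\<^sub>0 draw n C ph)) \<and>
    (\<forall>ph'\<in>set_pmf (resolve m \<tau>\<^sub>0 draw n C ph). offerable m (offered ph'))"
proof (cases ph)
  case (Start k)
  let ?\<gamma> = "\<lambda>j. C j / real n" and ?s = "real n / (\<tau>\<^sub>0 - real k)"
  show ?thesis
  proof (cases "\<tau>\<^sub>0 - real k < 1 \<or> Psi_feasible m ?\<gamma> ?s = {}")
    case False
    then obtain x where x: "sample_assortment m x (draw k ?\<gamma> ?s)"
      using assms(1) unfolding resolving_rule_def by blast
    have "resolve m \<tau>\<^sub>0 draw n C ph = map_pmf (check_inventory m C k) (draw k ?\<gamma> ?s)"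
      using False by (auto simp: resolve_def Start Let_def)
    moreover have "offerable m S" if "S \<in> set_pmf (draw k ?\<gamma> ?s)" for S
      using sample_assortment_card[OF x that] by (simp add: offerable_def)
    moreover have "offerable m {}" by (simp add: offerable_def)
    ultimately show ?thesis
      using sample_assortment_finite[OF x] by (auto simp: check_inventory_def offered_def)
  qed (use Start in \<open>auto simp: resolve_def offered_def offerable_def\<close>)
qed (use assms(2) in \<open>auto simp: resolve_def check_inventory_def offered_def offerable_def\<close>)

lemma offered_next_phase: "offered (next_phase ph p) = offered ph \<or> offered (next_phase ph p) = {}"
  by (cases ph) (auto simp: offered_def next_phase_def)

lemma offerable_next_phase: "offerable m (offered ph) \<Longrightarrow> offerable m (offered (next_phase ph p))"
  using offered_next_phase[of ph p] by (auto simp: offerable_def)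

lemma revenue_to_go_nonneg:
  assumes "valid_model m" "resolving_rule m draw" "offerable m (offered ph)"
  shows "0 \<le> revenue_to_go m \<tau>\<^sub>0 draw n C ph"
  using assms(3)
proof (induction n arbitrary: C ph)
  case (Suc n)
  have "0 \<le> reward m p + revenue_to_go m \<tau>\<^sub>0 draw n (update_inventory m C p) (next_phase ph' p)"
    if "ph' \<in> set_pmf (resolve m \<tau>\<^sub>0 draw (Suc n) C ph)" "p \<in> set_pmf (mnl_choice m (offered ph'))"
    for ph' p
  proof -
    have off: "offerable m (offered ph')" using resolve_support[OF assms(2) Suc.prems] that(1) by blast
    show ?thesis
      using reward_bounds(1)[OF assms(1) off that(2)] Suc.IH[OF offerable_next_phase[OF off]]
      by (rule add_nonneg_nonneg)
  qed
  then show ?case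
    unfolding revenue_to_go.simps by (auto intro!: integral_nonneg_AE simp: AE_measure_pmf_iff)
qed simp

text \<open>Accumulated revenue plus revenue to go has the same expectation after every period.\<close>

lemma resolving_revenue_eq_revenue_to_go:
  assumes "valid_model m" "resolving_rule m draw"
  shows "resolving_revenue m C\<^sub>0 T xF draw
    = revenue_to_go m (real T / (1 + weight m xF)) draw T C\<^sub>0 (Start 0)"
proof -
  let ?\<tau> = "real T / (1 + weight m xF)"
  let ?run = "resolving_run m C\<^sub>0 T ?\<tau> draw"
  have supp: "finite (set_pmf (?run t)) \<and> (\<forall>(C, w, ph)\<in>set_pmf (?run t). offerable m (offered ph))" for t
  proof (induction t)
    case (Suc t)
    have fin: "finite (set_pmf (resolve m ?\<tau> draw (T - t) C ph))"
      and off: "ph' \<in> set_pmf (resolve m ?\<tau> draw (T - t) C ph) \<Longrightarrow> offerable m (offered ph')"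
      if "(C, w, ph) \<in> set_pmf (?run t)" for C w ph ph'
      using Suc that resolve_support[OF assms(2), of ph] by fast+
    show ?case
      using Suc fin off finite_set_mnl_choice[OF assms(1)] offerable_next_phase
      by (fastforce simp: case_prod_unfold)
  qed (simp add: offered_def offerable_def)
  have "measure_pmf.expectation (?run t) (\<lambda>(C, w, ph). w + revenue_to_go m ?\<tau> draw (T - t) C ph)
      = revenue_to_go m ?\<tau> draw T C\<^sub>0 (Start 0)" if "t \<le> T" for t
    using that
  proof (induction t)
    case (Suc t)
    have n: "T - t = Suc (T - Suc t)" using Suc.prems by simp
    let ?next = "\<lambda>C w ph. bind_pmf (resolve m ?\<tau> draw (T - t) C ph) (\<lambda>ph'.
      map_pmf (\<lambda>p. (update_inventory m C p, w + reward m p, next_phase ph' p))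
        (mnl_choice m (offered ph')))"
    have fin_next: "finite (set_pmf (?next C w ph))"
      and step: "measure_pmf.expectation (?next C w ph)
          (\<lambda>(C, w, ph). w + revenue_to_go m ?\<tau> draw (T - Suc t) C ph)
        = w + revenue_to_go m ?\<tau> draw (T - t) C ph"
      if "(C, w, ph) \<in> set_pmf (?run t)" for C w ph
    proof -
      have "offerable m (offered ph)" using supp[of t] that by auto
      note R = resolve_support[OF assms(2) this, of ?\<tau> "T - t" C]
      have fin: "finite (set_pmf (mnl_choice m (offered ph')))"
        if "ph' \<in> set_pmf (resolve m ?\<tau> draw (T - t) C ph)" for ph'
        using finite_set_mnl_choice[OF assms(1)] R that by blast
      show "finite (set_pmf (?next C w ph))" using R fin by auto
      have "measure_pmf.expectation (?next C w ph)
          (\<lambda>(C, w, ph). w + revenue_to_go m ?\<tau> draw (T - Suc t) C ph)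
        = measure_pmf.expectation (resolve m ?\<tau> draw (T - t) C ph) (\<lambda>ph'.
           measure_pmf.expectation (mnl_choice m (offered ph')) (\<lambda>p. w + (reward m p +
             revenue_to_go m ?\<tau> draw (T - Suc t) (update_inventory m C p) (next_phase ph' p))))"
        using R fin by (subst expectation_bind_finite) (auto simp: add.assoc)
      also have "\<dots> = measure_pmf.expectation (resolve m ?\<tau> draw (T - t) C ph) (\<lambda>ph'.
           w + measure_pmf.expectation (mnl_choice m (offered ph')) (\<lambda>p. reward m p +
             revenue_to_go m ?\<tau> draw (T - Suc t) (update_inventory m C p) (next_phase ph' p)))"
        using fin by (intro expectation_cong_set_pmf)
          (subst Bochner_Integration.integral_add, auto intro: integrable_measure_pmf_finite)
      also have "\<dots> = w + revenue_to_go m ?\<tau> draw (T - t) C ph"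
        unfolding n revenue_to_go.simps using R unfolding n
        by (subst Bochner_Integration.integral_add) (auto intro: integrable_measure_pmf_finite)
      finally show "measure_pmf.expectation (?next C w ph)
          (\<lambda>(C, w, ph). w + revenue_to_go m ?\<tau> draw (T - Suc t) C ph)
        = w + revenue_to_go m ?\<tau> draw (T - t) C ph" .
    qed
    have "measure_pmf.expectation (?run (Suc t))
        (\<lambda>(C, w, ph). w + revenue_to_go m ?\<tau> draw (T - Suc t) C ph)
      = measure_pmf.expectation (?run t) (\<lambda>(C, w, ph). w + revenue_to_go m ?\<tau> draw (T - t) C ph)"
      unfolding resolving_run.simps using supp[of t] fin_next step
      by (subst expectation_bind_finite) (auto simp: case_prod_unfold intro!: expectation_cong_set_pmf)
    then show ?case using Suc by simp
  qed simp
  from this[of T] show ?thesis by (simp add: resolving_revenue_def case_prod_unfold)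
qed

text \<open>Drawing the assortment at the start of an epoch does not use up a period.\<close>

lemma revenue_to_go_Start:
  fixes k n :: nat and C :: "nat \<Rightarrow> real" and \<tau>\<^sub>0 :: real
  defines "\<gamma> \<equiv> \<lambda>j. C j / real n" and "s \<equiv> real n / (\<tau>\<^sub>0 - real k)"
  assumes "1 \<le> n" "1 \<le> \<tau>\<^sub>0 - real k" "Psi_feasible m \<gamma> s \<noteq> {}"
  shows "revenue_to_go m \<tau>\<^sub>0 draw n C (Start k)
    = measure_pmf.expectation (draw k \<gamma> s) (\<lambda>S. revenue_to_go m \<tau>\<^sub>0 draw n C (Offering k S))"
proof -
  obtain n' where n': "n = Suc n'" using assms(3) by (cases n) auto
  have "resolve m \<tau>\<^sub>0 draw n C (Start k) = map_pmf (check_inventory m C k) (draw k \<gamma> s)"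
    using assms(4,5) unfolding \<gamma>_def s_def by (auto simp: resolve_def Let_def)
  then show ?thesis
    unfolding n' by (simp add: resolve_def)
qed

lemma revenue_to_go_Offering:
  assumes "valid_model m" "offerable m S" "sufficient_inventory m C S"
  shows "revenue_to_go m \<tau>\<^sub>0 draw (Suc n) C (Offering k S)
    = (revenue_to_go m \<tau>\<^sub>0 draw n C (Start (Suc k)) +
       (\<Sum>i\<in>S. pref m i * (profit m i +
         revenue_to_go m \<tau>\<^sub>0 draw n (update_inventory m C (Some i)) (Offering k S))))
      / (1 + offer_weight m S)"
  using assms(3)
  by (simp add: resolve_def check_inventory_def offered_def next_phase_def reward_def
      update_inventory_def expectation_offer[OF assms(1,2)])

section \<open>A quadratic potential\<close>

text \<open>The square of this function has a Lipschitz derivative even if only negative deviations count, so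
  that both kinds of coordinates obey the same one-step estimates.\<close>

definition shortfall :: "bool \<Rightarrow> real \<Rightarrow> real" where
  "shortfall two_sided z = (if two_sided then z else min z 0)"

lemma shortfall_step: "(shortfall b (z + x))\<^sup>2 \<le> (shortfall b z)\<^sup>2 + 2 * shortfall b z * x + x\<^sup>2"
proof (cases b)
  case True
  then show ?thesis by (simp add: shortfall_def power2_sum)
next
  case False
  consider "z \<le> 0" "z + x \<le> 0" | "z + x > 0" | "z > 0" "z + x \<le> 0" by linarith
  then show ?thesis
  proof cases
    case 1
    then show ?thesis using False by (simp add: shortfall_def power2_sum)
  next
    case 2
    have "0 \<le> (min z 0 + x)\<^sup>2" by simp
    then show ?thesis using False 2 by (simp add: shortfall_def power2_sum)
  next
    case 3
    then have "(- (z + x))\<^sup>2 \<le> (- x)\<^sup>2" by (intro power_mono) auto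
    then have "(z + x)\<^sup>2 \<le> x\<^sup>2" by (simp only: power2_minus)
    then show ?thesis using False 3 by (simp add: shortfall_def)
  qed
qed

lemma shortfall_lipschitz: "\<bar>shortfall b (z + x) - shortfall b z\<bar> \<le> \<bar>x\<bar>"
  by (auto simp: shortfall_def)

lemma shortfall_mult: "shortfall b z * z = (shortfall b z)\<^sup>2"
  by (auto simp: shortfall_def power2_eq_square min_def)

text \<open>While an assortment with purchase weights \<open>v\<close> is offered until the first no-purchase, a
  coordinate moves by \<open>x i\<close> at a purchase of \<open>i\<close> and by \<open>x\<^sub>0\<close> at the end, in expectation by \<open>\<mu>\<close> over
  the whole epoch. The right-hand side without the factor is therefore an upper bound, valid in
  every period of the epoch, for the expected square at its end; the remaining variance is the
  same in each period, because the geometric law has no memory.\<close>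

lemma epoch_square_step:
  fixes v x :: "nat \<Rightarrow> real"
  assumes S: "finite S" "\<And>i. i \<in> S \<Longrightarrow> 0 \<le> v i"
    and x: "\<bar>x\<^sub>0\<bar> \<le> c" "\<And>i. i \<in> S \<Longrightarrow> \<bar>x i\<bar> \<le> c"
  defines "W \<equiv> 1 + (\<Sum>i\<in>S. v i)" and "\<mu> \<equiv> x\<^sub>0 + (\<Sum>i\<in>S. v i * x i)"
  assumes Q: "3 * c\<^sup>2 * W\<^sup>2 \<le> Q"
  shows "(shortfall b (z + x\<^sub>0))\<^sup>2 +
      (\<Sum>i\<in>S. v i * ((shortfall b (z + x i))\<^sup>2 + 2 * shortfall b (z + x i) * \<mu> + Q))
    \<le> W * ((shortfall b z)\<^sup>2 + 2 * shortfall b z * \<mu> + Q)"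
proof -
  let ?d = "shortfall b z"
  have sq: "y\<^sup>2 \<le> c\<^sup>2" if "\<bar>y\<bar> \<le> c" for y :: real
    using that by (metis abs_ge_zero power2_abs power_mono)
  have c: "0 \<le> c" using x(1) by linarith
  have W: "1 \<le> W" unfolding W_def using S by (simp add: sum_nonneg)
  have \<mu>: "\<bar>\<mu>\<bar> \<le> c * W"
  proof -
    have "\<bar>\<mu>\<bar> \<le> \<bar>x\<^sub>0\<bar> + (\<Sum>i\<in>S. \<bar>v i * x i\<bar>)"
      unfolding \<mu>_def by (intro order_trans[OF abs_triangle_ineq] add_left_mono sum_abs)
    also have "\<dots> \<le> c + (\<Sum>i\<in>S. v i * c)"
      using S x by (intro add_mono sum_mono) (auto simp: abs_mult intro!: mult_left_mono)
    finally show ?thesis by (simp add: W_def distrib_left sum_distrib_left mult.commute)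
  qed
  define r where "r = 2 * ?d * \<mu> + 2 * c * \<bar>\<mu>\<bar> + Q"
  have last: "(shortfall b (z + x\<^sub>0))\<^sup>2 \<le> ?d\<^sup>2 + 2 * ?d * x\<^sub>0 + c\<^sup>2"
    using shortfall_step[of b z x\<^sub>0] sq[OF x(1)] by linarith
  have purchase: "(shortfall b (z + x i))\<^sup>2 + 2 * shortfall b (z + x i) * \<mu> + Q
      \<le> ?d\<^sup>2 + c\<^sup>2 + r + 2 * ?d * x i" if "i \<in> S" for i
  proof -
    have "(shortfall b (z + x i) - ?d) * \<mu> \<le> \<bar>shortfall b (z + x i) - ?d\<bar> * \<bar>\<mu>\<bar>"
      by (metis abs_ge_self abs_mult)
    also have "\<dots> \<le> c * \<bar>\<mu>\<bar>"
      using shortfall_lipschitz[of b z "x i"] x(2)[OF that] by (intro mult_right_mono) auto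
    finally have "2 * shortfall b (z + x i) * \<mu> \<le> 2 * ?d * \<mu> + 2 * c * \<bar>\<mu>\<bar>"
      by (simp add: algebra_simps)
    then show ?thesis
      using shortfall_step[of b z "x i"] sq[OF x(2)[OF that]] unfolding r_def by linarith
  qed
  have "(\<Sum>i\<in>S. v i * ((shortfall b (z + x i))\<^sup>2 + 2 * shortfall b (z + x i) * \<mu> + Q))
      \<le> (\<Sum>i\<in>S. v i * (?d\<^sup>2 + c\<^sup>2 + r + 2 * ?d * x i))"
    using purchase S(2) by (intro sum_mono mult_left_mono) auto
  also have "\<dots> = (W - 1) * (?d\<^sup>2 + c\<^sup>2 + r) + 2 * ?d * (\<mu> - x\<^sub>0)"
  proof -
    have "(\<Sum>i\<in>S. v i * (?d\<^sup>2 + c\<^sup>2 + r + 2 * ?d * x i))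
        = (\<Sum>i\<in>S. v i * (?d\<^sup>2 + c\<^sup>2 + r)) + (\<Sum>i\<in>S. 2 * ?d * (v i * x i))"
      by (simp only: distrib_left sum.distrib mult.left_commute mult.assoc)
    then show ?thesis by (simp add: W_def \<mu>_def sum_distrib_left sum_distrib_right)
  qed
  finally have "(shortfall b (z + x\<^sub>0))\<^sup>2 +
      (\<Sum>i\<in>S. v i * ((shortfall b (z + x i))\<^sup>2 + 2 * shortfall b (z + x i) * \<mu> + Q))
    \<le> W * (?d\<^sup>2 + 2 * ?d * \<mu> + Q) + (W * c\<^sup>2 + (W - 1) * (2 * c * \<bar>\<mu>\<bar>) - Q)"
    using last by (simp add: r_def algebra_simps)
  moreover have "W * c\<^sup>2 + (W - 1) * (2 * c * \<bar>\<mu>\<bar>) \<le> Q"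
  proof -
    have "(W - 1) * (2 * c * \<bar>\<mu>\<bar>) \<le> W * (2 * c * (c * W))"
      using W c \<mu> by (intro mult_mono) auto
    moreover have "W * c\<^sup>2 \<le> W\<^sup>2 * c\<^sup>2"
      using W by (intro mult_right_mono) (auto simp: power2_eq_square)
    ultimately show ?thesis using Q by (simp add: power2_eq_square algebra_simps)
  qed
  ultimately show ?thesis by linarith
qed

lemma square_with_drift_ge:
  fixes d \<mu> :: real
  shows "d\<^sup>2 / 2 - 2 * \<mu>\<^sup>2 \<le> d\<^sup>2 + 2 * d * \<mu>"
proof -
  have "0 \<le> (d + 2 * \<mu>)\<^sup>2" by simp
  then show ?thesis by (simp add: power2_eq_square algebra_simps)
qed

locale resolving_setting =
  stable_fluid_optimum m \<gamma>\<^sub>0 xF \<rho> + priced_fluid_optimum m \<gamma>\<^sub>0 xF \<pi> \<sigma>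
  for m \<gamma>\<^sub>0 xF \<rho> \<pi> \<sigma> +
  fixes A\<^sub>0 B\<^sub>0 :: real and draw :: "nat \<Rightarrow> (nat \<Rightarrow> real) \<Rightarrow> real \<Rightarrow> nat set pmf"
  assumes A0: "1 \<le> A\<^sub>0" and B0: "1 \<le> B\<^sub>0"
    and pref_le: "\<And>i. i < n_prod m \<Longrightarrow> pref m i \<le> B\<^sub>0"
    and usage_le: "\<And>i j. i < n_prod m \<Longrightarrow> j < n_res m \<Longrightarrow> usage m i j \<le> A\<^sub>0"
    and rule: "resolving_rule m draw"
begin

definition B :: real where "B = real (cap m) * B\<^sub>0"

lemma cap_pos: "1 \<le> cap m"
  using valid by (simp add: valid_model_def)

lemma usage_nonneg: "i < n_prod m \<Longrightarrow> j < n_res m \<Longrightarrow> 0 \<le> usage m i j"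
  using valid by (simp add: valid_model_def)

lemma pref_nonneg: "i < n_prod m \<Longrightarrow> 0 \<le> pref m i"
  using valid by (simp add: valid_model_def less_imp_le)

lemma B_ge_1: "1 \<le> B"
  unfolding B_def using B0 cap_pos mult_mono[of 1 "real (cap m)" 1 "B\<^sub>0"] by simp

lemma offer_weight_le:
  assumes "offerable m S"
  shows "1 + offer_weight m S \<le> 2 * B"
proof -
  have "offer_weight m S \<le> (\<Sum>i\<in>S. B\<^sub>0)"
    unfolding offer_weight_def using assms pref_le by (intro sum_mono) (auto simp: offerable_def)
  also have "\<dots> \<le> B"
    using assms B0 by (simp add: B_def offerable_def mult_right_mono)
  finally show ?thesis using B_ge_1 by simp
qed

lemma weight_le:
  assumes "x \<in> Phi_feasible m \<gamma>"
  shows "weight m x \<le> B"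
proof -
  have "weight m x \<le> (\<Sum>i<n_prod m. B\<^sub>0 * x i)"
    unfolding weight_def using assms pref_le
    by (intro sum_mono mult_right_mono) (auto simp: Phi_feasible_iff[OF valid])
  also have "\<dots> = B\<^sub>0 * (\<Sum>i<n_prod m. x i)" by (simp add: sum_distrib_left)
  also have "\<dots> \<le> B\<^sub>0 * real (cap m)"
    using assms B0 by (intro mult_left_mono) (auto simp: Phi_feasible_iff[OF valid])
  finally show ?thesis by (simp add: B_def mult.commute)
qed

lemma revenue_rate_le_B:
  assumes "x \<in> Phi_feasible m \<gamma>"
  shows "revenue_rate m x \<le> B"
proof -
  have "revenue_rate m x \<le> weight m x"
    unfolding revenue_rate_def weight_def using assms valid
    by (intro sum_mono mult_right_mono mult_left_le_one_le)
      (auto simp: Phi_feasible_iff[OF valid] valid_model_def less_imp_le)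
  then show ?thesis using weight_le[OF assms] by simp
qed

lemma rho_le_B: "\<rho> \<le> B"
  using rho_less_weight weight_le[OF xF_feasible] by simp

text \<open>At \<open>xF\<close> a period uses in expectation at most \<open>A\<^sub>0\<close> of each resource, and it uses a binding
  resource at the full rate.\<close>

lemma active_rate_le:
  assumes "j < n_res m" "Suc j \<in> active"
  shows "\<gamma>\<^sub>0 j \<le> A\<^sub>0"
proof -
  have "usage_rate m xF j \<le> (\<Sum>i<n_prod m. A\<^sub>0 * (pref m i * xF i))"
    unfolding usage_rate_def mult.assoc using assms(1) usage_le pref_nonneg xF_feasible
    by (intro sum_mono mult_right_mono) (auto simp: Phi_feasible_iff[OF valid])
  then have "usage_rate m xF j \<le> A\<^sub>0 * weight m xF"
    by (simp add: weight_def sum_distrib_left)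
  also have "\<dots> \<le> A\<^sub>0 * V" using A0 by (intro mult_left_mono) auto
  finally have "\<gamma>\<^sub>0 j * V \<le> A\<^sub>0 * V"
    using active_tight[OF assms(2)] assms(1)
    by (simp add: lp_row_usage lp_rhs_explicit algebra_simps)
  then show ?thesis using V_ge_1 by simp
qed

text \<open>Coordinate \<open>0\<close> compares the remaining time with the number \<open>\<tau>\<close> of epochs to go, and coordinate
  \<open>Suc j\<close> the inventory of resource \<open>j\<close> with the remaining time. Resources that are not binding
  may be in excess. Those with \<open>\<gamma>\<^sub>0 j > A\<^sub>0\<close> never become scarce and are left out, so that a single
  period moves each coordinate by at most \<open>A\<^sub>0\<close>.\<close>

definition tracked :: "nat set" where
  "tracked = insert 0 (Suc ` {j. j < n_res m \<and> \<gamma>\<^sub>0 j \<le> A\<^sub>0})"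

definition position :: "nat \<Rightarrow> nat \<Rightarrow> (nat \<Rightarrow> real) \<Rightarrow> real \<Rightarrow> real" where
  "position k n C \<tau> = (case k of 0 \<Rightarrow> real n - V * \<tau> | Suc j \<Rightarrow> C j - \<gamma>\<^sub>0 j * real n)"

definition step :: "nat \<Rightarrow> nat option \<Rightarrow> real" where
  "step k p = (case k of 0 \<Rightarrow> - 1
     | Suc j \<Rightarrow> \<gamma>\<^sub>0 j - (case p of None \<Rightarrow> 0 | Some i \<Rightarrow> usage m i j))"

definition deviation :: "nat \<Rightarrow> nat \<Rightarrow> (nat \<Rightarrow> real) \<Rightarrow> real \<Rightarrow> real" where
  "deviation k n C \<tau> = shortfall (k = 0 \<or> k \<in> active) (position k n C \<tau>)"

text \<open>The expected motion of a coordinate over an epoch that offers \<open>S\<close>.\<close>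

definition drift :: "nat \<Rightarrow> nat set \<Rightarrow> real" where
  "drift k S = step k None + (\<Sum>i\<in>S. pref m i * step k (Some i))"

text \<open>An epoch has expected length at most \<open>2 B\<close>, so it moves a coordinate by \<open>2 A\<^sub>0 B\<close> in expectation and
  adds to its square, apart from the drift, at most \<open>12 A\<^sub>0\<^sup>2 B\<^sup>2\<close>. The larger factor leaves half of each squared deviation even if the
  drift term is negative (\<open>epoch_potential_ge\<close>).\<close>

definition noise :: real where "noise = 16 * A\<^sub>0\<^sup>2 * B\<^sup>2"

definition potential :: "nat \<Rightarrow> (nat \<Rightarrow> real) \<Rightarrow> real \<Rightarrow> real" where
  "potential n C \<tau> = (\<Sum>k\<in>tracked. (deviation k n C \<tau>)\<^sup>2)"

text \<open>Within an epoch \<open>\<tau>\<close> is the number of epochs to go after it, so that the time coordinate does not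
  jump when the epoch ends.\<close>

definition epoch_potential :: "nat \<Rightarrow> (nat \<Rightarrow> real) \<Rightarrow> real \<Rightarrow> nat set \<Rightarrow> real" where
  "epoch_potential n C \<tau> S =
     (\<Sum>k\<in>tracked. (deviation k n C \<tau>)\<^sup>2 + 2 * deviation k n C \<tau> * drift k S + noise)"

text \<open>Invariant for the resources left out of the potential.\<close>

definition plentiful :: "nat \<Rightarrow> (nat \<Rightarrow> real) \<Rightarrow> bool" where
  "plentiful n C \<longleftrightarrow> (\<forall>j<n_res m. A\<^sub>0 < \<gamma>\<^sub>0 j \<longrightarrow> \<gamma>\<^sub>0 j * real n \<le> C j)"

lemma finite_tracked: "finite tracked" and card_tracked: "card tracked \<le> n_res m + 1"
proof -
  let ?J = "{j. j < n_res m \<and> \<gamma>\<^sub>0 j \<le> A\<^sub>0}"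
  have J: "finite ?J" by simp
  then show "finite tracked" by (simp add: tracked_def)
  have "card ?J \<le> card {..<n_res m}" by (intro card_mono) auto
  then have "card (Suc ` ?J) \<le> n_res m" using card_image_le[OF J, of Suc] by simp
  then show "card tracked \<le> n_res m + 1"
    unfolding tracked_def using card_insert_le_m1[of "n_res m + 1" "Suc ` ?J" 0] by simp
qed

lemma tracked_cases:
  assumes "k \<in> tracked"
  obtains "k = 0" | j where "k = Suc j" "j < n_res m" "\<gamma>\<^sub>0 j \<le> A\<^sub>0"
  using assms by (auto simp: tracked_def)

lemma gamma_nonneg: "j < n_res m \<Longrightarrow> 0 \<le> \<gamma>\<^sub>0 j"
  using rho_less[of j] rho_pos by simp

lemma position_update:
  assumes "k \<in> tracked"
  shows "position k n (update_inventory m C p) \<tau> = position k (Suc n) C \<tau> + step k p"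
  using assms
  by (cases rule: tracked_cases)
    (auto simp: position_def step_def update_inventory_def algebra_simps split: option.splits)

lemma abs_step_le:
  assumes "k \<in> tracked" "p = None \<or> (\<exists>i<n_prod m. p = Some i)"
  shows "\<bar>step k p\<bar> \<le> A\<^sub>0"
  using assms(1)
proof (cases rule: tracked_cases)
  case (2 j)
  then show ?thesis
    using assms(2) gamma_nonneg[of j] usage_nonneg[of _ j] usage_le[of _ j] A0
    by (fastforce simp: step_def abs_le_iff)
qed (use A0 in \<open>simp add: step_def\<close>)

lemma abs_drift_le:
  assumes "k \<in> tracked" "offerable m S"
  shows "\<bar>drift k S\<bar> \<le> 2 * A\<^sub>0 * B"
proof -
  have "\<bar>drift k S\<bar> \<le> \<bar>step k None\<bar> + (\<Sum>i\<in>S. \<bar>pref m i * step k (Some i)\<bar>)"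
    unfolding drift_def by (intro order_trans[OF abs_triangle_ineq] add_left_mono sum_abs)
  also have "\<dots> \<le> A\<^sub>0 + (\<Sum>i\<in>S. pref m i * A\<^sub>0)"
  proof (intro add_mono sum_mono)
    fix i assume "i \<in> S"
    then have i: "i < n_prod m" using assms(2) by (auto simp: offerable_def)
    then show "\<bar>pref m i * step k (Some i)\<bar> \<le> pref m i * A\<^sub>0"
      using abs_step_le[OF assms(1), of "Some i"] pref_nonneg[OF i]
      by (simp add: abs_mult mult_left_mono)
  qed (use abs_step_le[OF assms(1), of None] in simp)
  also have "\<dots> = A\<^sub>0 * (1 + offer_weight m S)"
    by (simp add: offer_weight_def distrib_left sum_distrib_left mult.commute)
  also have "\<dots> \<le> A\<^sub>0 * (2 * B)"
    using A0 offer_weight_le[OF assms(2)] by (intro mult_left_mono) auto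
  finally show ?thesis by simp
qed

lemma potential_nonneg: "0 \<le> potential n C \<tau>"
  by (simp add: potential_def sum_nonneg)

lemma epoch_potential_step:
  assumes S: "offerable m S"
  shows "potential n C \<tau> +
      (\<Sum>i\<in>S. pref m i * epoch_potential n (update_inventory m C (Some i)) \<tau> S)
    \<le> (1 + offer_weight m S) * epoch_potential (Suc n) C \<tau> S"
proof -
  let ?U = "\<lambda>k C. (deviation k n C \<tau>)\<^sup>2 + 2 * deviation k n C \<tau> * drift k S + noise"
  have coord: "(deviation k n C \<tau>)\<^sup>2 + (\<Sum>i\<in>S. pref m i * ?U k (update_inventory m C (Some i)))
      \<le> (1 + offer_weight m S) *
        ((deviation k (Suc n) C \<tau>)\<^sup>2 + 2 * deviation k (Suc n) C \<tau> * drift k S + noise)"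
    if k: "k \<in> tracked" for k
  proof -
    have "3 * A\<^sub>0\<^sup>2 * (1 + offer_weight m S)\<^sup>2 \<le> 3 * A\<^sub>0\<^sup>2 * (2 * B)\<^sup>2"
      using offer_weight_le[OF S] offer_weight_nonneg[OF valid S] by (intro mult_left_mono power_mono) auto
    also have "\<dots> = 12 * (A\<^sub>0\<^sup>2 * B\<^sup>2)" by (simp add: power_mult_distrib)
    also have "\<dots> \<le> noise" by (simp add: noise_def)
    finally have Q: "3 * A\<^sub>0\<^sup>2 * (1 + (\<Sum>i\<in>S. pref m i))\<^sup>2 \<le> noise" by (simp add: offer_weight_def)
    have C: "position k n C \<tau> = position k (Suc n) C \<tau> + step k None"
      using position_update[OF k, of n C None] by (simp add: update_inventory_def)
    show ?thesis
      unfolding deviation_def position_update[OF k] C drift_def offer_weight_def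
      by (rule epoch_square_step[OF offerable_finite[OF S] _ _ _ Q])
        (use S pref_nonneg abs_step_le[OF k] in \<open>auto simp: offerable_def\<close>)
  qed
  have "(\<Sum>i\<in>S. pref m i * epoch_potential n (update_inventory m C (Some i)) \<tau> S)
      = (\<Sum>k\<in>tracked. \<Sum>i\<in>S. pref m i * ?U k (update_inventory m C (Some i)))"
    unfolding epoch_potential_def sum_distrib_left by (rule sum.swap)
  then have "potential n C \<tau> +
      (\<Sum>i\<in>S. pref m i * epoch_potential n (update_inventory m C (Some i)) \<tau> S)
    = (\<Sum>k\<in>tracked. (deviation k n C \<tau>)\<^sup>2
        + (\<Sum>i\<in>S. pref m i * ?U k (update_inventory m C (Some i))))"
    by (simp only: potential_def sum.distrib)
  also have "\<dots> \<le> (1 + offer_weight m S) * epoch_potential (Suc n) C \<tau> S"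
    unfolding epoch_potential_def sum_distrib_left[of "1 + offer_weight m S"]
    by (rule sum_mono) (rule coord)
  finally show ?thesis .
qed

lemma epoch_potential_ge:
  assumes "offerable m S" "k \<in> tracked"
  shows "(deviation k n C \<tau>)\<^sup>2 / 2 + 8 * A\<^sub>0\<^sup>2 * B\<^sup>2 \<le> epoch_potential n C \<tau> S"
proof -
  have ge: "(deviation k n C \<tau>)\<^sup>2 / 2 + 8 * A\<^sub>0\<^sup>2 * B\<^sup>2
      \<le> (deviation k n C \<tau>)\<^sup>2 + 2 * deviation k n C \<tau> * drift k S + noise"
    if "k \<in> tracked" for k
  proof -
    have "(drift k S)\<^sup>2 \<le> (2 * A\<^sub>0 * B)\<^sup>2"
      using abs_drift_le[OF that assms(1)] by (metis abs_ge_zero power2_abs power_mono)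
    then show ?thesis
      using square_with_drift_ge[of "deviation k n C \<tau>" "drift k S"]
      by (simp add: noise_def power_mult_distrib)
  qed
  have "0 \<le> (deviation k n C \<tau>)\<^sup>2 + 2 * deviation k n C \<tau> * drift k S + noise"
    if "k \<in> tracked" for k
    by (rule order_trans[OF _ ge[OF that]]) simp
  then have "(deviation k n C \<tau>)\<^sup>2 + 2 * deviation k n C \<tau> * drift k S + noise
      \<le> epoch_potential n C \<tau> S"
    unfolding epoch_potential_def using assms(2) finite_tracked
    by (intro member_le_sum) auto
  then show ?thesis using ge[OF assms(2)] by linarith
qed

text \<open>When time or some resource has run out with \<open>\<tau>\<close> epochs to follow, either the number of periods
  is off by \<open>\<rho> \<tau>\<close>, or at least \<open>\<tau>\<close> periods remain and the exhausted resource lacks about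
  \<open>\<gamma>\<^sub>0 j \<tau> > \<rho> \<tau>\<close> units. Up to \<open>A\<^sub>0\<close> units of it may still be left, which is what
  the second summand in \<open>quarter\<close> makes up for.\<close>

lemma epoch_potential_large_if_exhausted:
  assumes S: "offerable m S" and C: "plentiful n C" and \<tau>: "0 \<le> \<tau>"
    and stop: "n = 0 \<or> \<not> sufficient_inventory m C S"
  shows "\<rho>\<^sup>2 * \<tau>\<^sup>2 / 4 \<le> epoch_potential n C \<tau> S"
proof (cases "\<rho> * \<tau> \<le> \<bar>real n - V * \<tau>\<bar>")
  case True
  have 0: "0 \<in> tracked" by (simp add: tracked_def)
  have "(\<rho> * \<tau>)\<^sup>2 \<le> \<bar>real n - V * \<tau>\<bar>\<^sup>2"
    using True rho_pos \<tau> by (intro power_mono) auto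
  then have "\<rho>\<^sup>2 * \<tau>\<^sup>2 \<le> (deviation 0 n C \<tau>)\<^sup>2"
    by (simp add: deviation_def shortfall_def position_def power_mult_distrib)
  moreover have "0 \<le> \<rho>\<^sup>2 * \<tau>\<^sup>2" "0 \<le> A\<^sub>0\<^sup>2 * B\<^sup>2" by simp_all
  ultimately show ?thesis using epoch_potential_ge[OF S 0, of n C \<tau>] by linarith
next
  case False
  have "(1 + \<rho>) * \<tau> \<le> V * \<tau>" using rho_less_weight \<tau> by (intro mult_right_mono) auto
  then have n: "\<tau> < real n" using False by (simp add: algebra_simps)
  then obtain i j where ij: "i \<in> S" "j < n_res m" "C j < usage m i j"
    using stop \<tau> by (fastforce simp: sufficient_inventory_def not_le)
  have Cj: "C j < A\<^sub>0" using ij S usage_le[of i j] by (auto simp: offerable_def)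
  have "\<gamma>\<^sub>0 j \<le> A\<^sub>0"
  proof (rule ccontr)
    assume "\<not> \<gamma>\<^sub>0 j \<le> A\<^sub>0"
    then have "\<gamma>\<^sub>0 j * real n \<le> C j" using C ij(2) by (simp add: plentiful_def)
    moreover have "\<gamma>\<^sub>0 j * 1 \<le> \<gamma>\<^sub>0 j * real n"
      using n \<tau> gamma_nonneg[OF ij(2)] by (intro mult_left_mono) auto
    ultimately show False using Cj \<open>\<not> \<gamma>\<^sub>0 j \<le> A\<^sub>0\<close> by simp
  qed
  then have k: "Suc j \<in> tracked" using ij(2) by (simp add: tracked_def)
  have "\<rho> * \<tau> \<le> \<gamma>\<^sub>0 j * real n"
    using n \<tau> rho_less[OF ij(2)] rho_pos by (intro mult_mono) auto
  then have y: "position (Suc j) n C \<tau> < A\<^sub>0 - \<rho> * \<tau>" using Cj by (simp add: position_def)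
  have AB: "A\<^sub>0\<^sup>2 * 1 \<le> A\<^sub>0\<^sup>2 * B\<^sup>2" using B_ge_1 by (intro mult_left_mono) auto
  have quarter: "p\<^sup>2 / 4 \<le> d / 2 + 8 * a\<^sup>2" if "(p - a)\<^sup>2 \<le> d" for p a d :: real
  proof -
    have "4 * (p * a) \<le> p\<^sup>2 + 4 * a\<^sup>2"
      using zero_le_power2[of "p - 2 * a"] by (simp add: power2_diff power_mult_distrib)
    moreover have "p\<^sup>2 + a\<^sup>2 - 2 * (p * a) \<le> d" using that by (simp add: power2_diff)
    ultimately show ?thesis using zero_le_power2[of a] by linarith
  qed
  have "(\<rho> * \<tau>)\<^sup>2 / 4 \<le> (deviation (Suc j) n C \<tau>)\<^sup>2 / 2 + 8 * A\<^sub>0\<^sup>2"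
  proof (cases "\<rho> * \<tau> \<le> A\<^sub>0")
    case True
    then have "(\<rho> * \<tau>)\<^sup>2 \<le> A\<^sub>0\<^sup>2" using rho_pos \<tau> by (intro power_mono) auto
    moreover have "0 \<le> (deviation (Suc j) n C \<tau>)\<^sup>2" "0 \<le> A\<^sub>0\<^sup>2" by simp_all
    ultimately show ?thesis by linarith
  next
    case False
    then have "deviation (Suc j) n C \<tau> = position (Suc j) n C \<tau>"
      using y by (simp add: deviation_def shortfall_def)
    moreover have "(\<rho> * \<tau> - A\<^sub>0)\<^sup>2 \<le> (- position (Suc j) n C \<tau>)\<^sup>2"
      using y False by (intro power_mono) auto
    ultimately show ?thesis by (intro quarter) simp
  qed
  then show ?thesis
    using epoch_potential_ge[OF S k, of n C \<tau>] AB by (simp add: power_mult_distrib)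
qed

section \<open>One epoch of the re-solving policy\<close>

text \<open>The stable region in terms of the potential: \<open>active_stays_tight\<close> applies to the program that is
  solved at the start of the epoch.\<close>

lemma small_potential:
  assumes \<tau>: "1 \<le> \<tau>" and C: "plentiful n C" and U: "potential n C \<tau> \<le> (\<rho> * \<tau>)\<^sup>2"
  shows "\<tau> \<le> real n" "\<bar>real n / \<tau> - V\<bar> \<le> \<rho>"
    "\<And>j. j < n_res m \<Longrightarrow> \<gamma>\<^sub>0 j - \<rho> \<le> C j / real n"
    "\<And>j. j < n_res m \<Longrightarrow> Suc j \<in> active \<Longrightarrow> C j / real n \<le> \<gamma>\<^sub>0 j + \<rho>"
proof -
  have dev: "\<bar>deviation k n C \<tau>\<bar> \<le> \<rho> * \<tau>" if "k \<in> tracked" for k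
  proof -
    have "(deviation k n C \<tau>)\<^sup>2 \<le> potential n C \<tau>"
      unfolding potential_def using that finite_tracked by (intro member_le_sum) auto
    then have "\<bar>deviation k n C \<tau>\<bar> \<le> \<bar>\<rho> * \<tau>\<bar>"
      using U unfolding abs_le_square_iff by linarith
    then show ?thesis using rho_pos \<tau> by simp
  qed
  have time: "\<bar>real n - V * \<tau>\<bar> \<le> \<rho> * \<tau>"
    using dev[of 0] by (simp add: tracked_def deviation_def shortfall_def position_def)
  have "(1 + \<rho>) * \<tau> \<le> V * \<tau>" using rho_less_weight \<tau> by (intro mult_right_mono) auto
  then show n: "\<tau> \<le> real n" using time by (simp add: algebra_simps)
  have "real n / \<tau> - V = (real n - V * \<tau>) / \<tau>"
    using \<tau> by (simp add: diff_divide_distrib)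
  then have "\<bar>real n / \<tau> - V\<bar> = \<bar>real n - V * \<tau>\<bar> / \<tau>" using \<tau> by simp
  then show "\<bar>real n / \<tau> - V\<bar> \<le> \<rho>" using time \<tau> by (simp add: pos_divide_le_eq)
  have n0: "0 < real n" using n \<tau> by simp
  have \<rho>n: "\<rho> * \<tau> \<le> \<rho> * real n" using n rho_pos by (intro mult_left_mono) auto
  show "\<gamma>\<^sub>0 j - \<rho> \<le> C j / real n" if j: "j < n_res m" for j
  proof (cases "\<gamma>\<^sub>0 j \<le> A\<^sub>0")
    case True
    then have "\<bar>deviation (Suc j) n C \<tau>\<bar> \<le> \<rho> * \<tau>" using j dev by (simp add: tracked_def)
    moreover have "deviation (Suc j) n C \<tau> \<le> C j - \<gamma>\<^sub>0 j * real n"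
      by (simp add: deviation_def shortfall_def position_def)
    ultimately have "(\<gamma>\<^sub>0 j - \<rho>) * real n \<le> C j" using \<rho>n unfolding left_diff_distrib by linarith
    then show ?thesis using n0 by (simp only: pos_le_divide_eq)
  next
    case False
    then have "\<gamma>\<^sub>0 j * real n \<le> C j" using C j by (simp add: plentiful_def)
    moreover have "0 \<le> \<rho> * real n" using n0 rho_pos by simp
    ultimately have "(\<gamma>\<^sub>0 j - \<rho>) * real n \<le> C j" unfolding left_diff_distrib by linarith
    then show ?thesis using n0 by (simp only: pos_le_divide_eq)
  qed
  show "C j / real n \<le> \<gamma>\<^sub>0 j + \<rho>" if j: "j < n_res m" "Suc j \<in> active" for j
  proof -
    have "\<bar>C j - \<gamma>\<^sub>0 j * real n\<bar> \<le> \<rho> * \<tau>"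
      using dev[of "Suc j"] j active_rate_le[OF j]
      by (simp add: tracked_def deviation_def shortfall_def position_def)
    then have "C j \<le> (\<gamma>\<^sub>0 j + \<rho>) * real n" using \<rho>n unfolding distrib_right by linarith
    then show ?thesis using n0 by (simp only: pos_divide_le_eq)
  qed
qed

context
  fixes n :: nat and C :: "nat \<Rightarrow> real" and \<tau> :: real and x :: "nat \<Rightarrow> real" and p :: "nat set pmf"
  assumes tau: "1 \<le> \<tau>" and plentiful: "plentiful n C"
    and small: "potential n C \<tau> \<le> (\<rho> * \<tau>)\<^sup>2"
    and optimum: "Psi_optimal m (\<lambda>j. C j / real n) (real n / \<tau>) x"
    and sampled: "sample_assortment m x p"
begin

lemma
  shows epoch_weight: "1 + weight m x = real n / \<tau>"
    and epoch_usage: "\<And>j. j < n_res m \<Longrightarrow> Suc j \<in> active \<Longrightarrow> usage_rate m x j = C j / \<tau>"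
    and epoch_usage_le: "\<And>j. j < n_res m \<Longrightarrow> usage_rate m x j \<le> C j / \<tau>"
    and epoch_revenue:
      "revenue_rate m x = (\<Sum>j<n_res m. \<pi> j * usage_rate m x j) + \<sigma> * (1 + weight m x)"
proof -
  let ?\<gamma> = "\<lambda>j. C j / real n" and ?s = "real n / \<tau>"
  note region = small_potential[OF tau plentiful small]
  have tight: "lp_row m ?\<gamma> k x = lp_rhs m ?\<gamma> ?s $ k" if "k \<in> active" for k
    by (rule active_stays_tight[OF region(2,3,4) optimum that])
  show weight: "1 + weight m x = real n / \<tau>"
    using tight[OF weight_row_active] lp_row_weight[of m ?\<gamma> x] lp_rhs_explicit(3)[of m ?\<gamma> ?s] by simp
  have per_epoch: "C j / real n * (1 + weight m x) = C j / \<tau>" for j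
    using region(1) tau by (simp add: weight)
  show "usage_rate m x j = C j / \<tau>" if "j < n_res m" "Suc j \<in> active" for j
  proof -
    have "usage_rate m x j - ?\<gamma> j * weight m x = ?\<gamma> j"
      using tight[OF that(2)] unfolding lp_row_usage[OF that(1)] lp_rhs_explicit(2)[OF that(1)] .
    then have "usage_rate m x j = ?\<gamma> j * (1 + weight m x)" unfolding distrib_left by linarith
    then show ?thesis using per_epoch[of j] by simp
  qed
  show "usage_rate m x j \<le> C j / \<tau>" if "j < n_res m" for j
    using optimum that per_epoch[of j]
    by (auto simp: Psi_optimal_iff Psi_feasible_def Phi_feasible_iff[OF valid])
  show "revenue_rate m x = (\<Sum>j<n_res m. \<pi> j * usage_rate m x j) + \<sigma> * (1 + weight m x)"
    by (rule price_exact[OF tight])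
qed

text \<open>The solution earns per epoch an equal share of the worth of what remains.\<close>

lemma worth_eq_epoch_revenue: "worth n C = \<tau> * revenue_rate m x"
proof -
  have "\<tau> * (\<pi> j * usage_rate m x j) = \<pi> j * C j" if "j < n_res m" for j
    using epoch_usage[OF that] price_support[OF that] tau by (cases "Suc j \<in> active") auto
  then have "\<tau> * (\<Sum>j<n_res m. \<pi> j * usage_rate m x j) = (\<Sum>j<n_res m. \<pi> j * C j)"
    unfolding sum_distrib_left by (intro sum.cong) auto
  then show ?thesis
    using tau by (simp add: worth_def epoch_revenue epoch_weight distrib_left)
qed

lemma expectation_affine:
  "measure_pmf.expectation p (\<lambda>S. a + (\<Sum>i\<in>S. h i)) = a + (\<Sum>i<n_prod m. h i * x i)"
  using expectation_sample_assortment[OF sampled cap_pos, of h]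
  by (subst Bochner_Integration.integral_add)
    (auto intro: integrable_measure_pmf_finite sample_assortment_finite[OF sampled])

lemma expectation_surplus: "measure_pmf.expectation p surplus = 0"
proof -
  have "surplus = (\<lambda>S. - \<sigma> + (\<Sum>i\<in>S. markup i - \<sigma> * pref m i))"
    by (simp add: fun_eq_iff surplus_def offer_weight_def sum_subtractf sum_distrib_left algebra_simps)
  then have "measure_pmf.expectation p surplus
      = - \<sigma> + (\<Sum>i<n_prod m. (markup i - \<sigma> * pref m i) * x i)"
    by (simp only: expectation_affine)
  also have "\<dots> = - \<sigma> + ((\<Sum>i<n_prod m. markup i * x i) - \<sigma> * weight m x)"
    by (simp add: weight_def sum_subtractf sum_distrib_left algebra_simps)
  also have "\<dots> = 0" unfolding sum_markup epoch_revenue by (simp add: algebra_simps)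
  finally show ?thesis .
qed

text \<open>The expected motion during the epoch pulls every coordinate back by the fraction \<open>1 / \<tau>\<close>,
  because the program distributes the remaining time and inventory evenly over the remaining
  epochs. Coordinate \<open>0\<close> is measured from \<open>V (\<tau> - 1)\<close>, its target at the end of the epoch.\<close>

lemma expectation_epoch_potential:
  "measure_pmf.expectation p (epoch_potential n C (\<tau> - 1))
    \<le> potential n C \<tau> * (1 - 2 / \<tau>) + real (n_res m + 1) * (noise + \<rho>\<^sup>2)"
proof -
  define d where "d k = deviation k n C (\<tau> - 1)" for k
  define mean where "mean k = step k None + (\<Sum>i<n_prod m. pref m i * step k (Some i) * x i)" for k
  have fin: "finite (set_pmf p)" by (rule sample_assortment_finite[OF sampled])
  have "measure_pmf.expectation p (epoch_potential n C (\<tau> - 1))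
      = (\<Sum>k\<in>tracked. measure_pmf.expectation p (\<lambda>S. (d k)\<^sup>2 + 2 * d k * drift k S + noise))"
    unfolding epoch_potential_def d_def
    by (rule Bochner_Integration.integral_sum) (rule integrable_measure_pmf_finite[OF fin])
  also have "\<dots> = (\<Sum>k\<in>tracked. (d k)\<^sup>2 + 2 * d k * mean k + noise)"
  proof (rule sum.cong[OF refl])
    fix k
    have "(\<lambda>S. (d k)\<^sup>2 + 2 * d k * drift k S + noise)
        = (\<lambda>S. ((d k)\<^sup>2 + 2 * d k * step k None + noise) + (\<Sum>i\<in>S. 2 * d k * (pref m i * step k (Some i))))"
      by (simp add: fun_eq_iff drift_def distrib_left sum_distrib_left)
    then show "measure_pmf.expectation p (\<lambda>S. (d k)\<^sup>2 + 2 * d k * drift k S + noise)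
        = (d k)\<^sup>2 + 2 * d k * mean k + noise"
      by (simp add: expectation_affine mean_def distrib_left sum_distrib_left mult.assoc)
  qed
  also have "\<dots> \<le> (\<Sum>k\<in>tracked. (deviation k n C \<tau>)\<^sup>2 * (1 - 2 / \<tau>) + (noise + \<rho>\<^sup>2))"
  proof (rule sum_mono)
    fix k assume "k \<in> tracked"
    then show "(d k)\<^sup>2 + 2 * d k * mean k + noise
        \<le> (deviation k n C \<tau>)\<^sup>2 * (1 - 2 / \<tau>) + (noise + \<rho>\<^sup>2)"
    proof (cases rule: tracked_cases)
      case 1
      define z where "z = real n - V * \<tau>"
      have "mean 0 = - (1 + weight m x)"
        by (simp add: mean_def step_def weight_def sum_negf)
      also have "\<dots> = - (V + z / \<tau>)" using tau by (simp add: epoch_weight z_def field_simps)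
      finally have mean: "mean 0 = - (V + z / \<tau>)" .
      have d: "d 0 = z + V"
        by (simp add: d_def deviation_def shortfall_def position_def z_def algebra_simps)
      have "(d 0)\<^sup>2 + 2 * d 0 * mean 0 = z\<^sup>2 * (1 - 2 / \<tau>) + (z / \<tau>)\<^sup>2 - (V + z / \<tau>)\<^sup>2"
        unfolding d mean using tau by (simp add: power2_eq_square field_simps)
      moreover have "(z / \<tau>)\<^sup>2 \<le> \<rho>\<^sup>2"
      proof -
        have "\<bar>z / \<tau>\<bar> \<le> \<rho>"
          using small_potential(2)[OF tau plentiful small] tau by (simp add: z_def diff_divide_distrib)
        then show ?thesis by (metis abs_ge_zero power2_abs power_mono)
      qed
      moreover have "0 \<le> (V + z / \<tau>)\<^sup>2" by simp
      ultimately have "(d 0)\<^sup>2 + 2 * d 0 * mean 0 \<le> z\<^sup>2 * (1 - 2 / \<tau>) + \<rho>\<^sup>2" by linarith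
      moreover have "deviation 0 n C \<tau> = z"
        by (simp add: deviation_def shortfall_def position_def z_def)
      ultimately show ?thesis unfolding 1 by simp
    next
      case (2 j)
      define y where "y = C j - \<gamma>\<^sub>0 j * real n"
      have d: "d (Suc j) = deviation (Suc j) n C \<tau>"
        by (simp add: d_def deviation_def position_def)
      have dev: "deviation (Suc j) n C \<tau> = shortfall (Suc j \<in> active) y"
        by (simp add: deviation_def position_def y_def)
      have mean: "mean (Suc j) = \<gamma>\<^sub>0 j * (1 + weight m x) - usage_rate m x j"
        by (simp add: mean_def step_def weight_def usage_rate_def sum_distrib_left sum_subtractf
            algebra_simps)
      have y: "y / \<tau> = C j / \<tau> - \<gamma>\<^sub>0 j * (1 + weight m x)"
        by (simp add: epoch_weight y_def diff_divide_distrib)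
      have "d (Suc j) * mean (Suc j) \<le> d (Suc j) * - (y / \<tau>)"
      proof (cases "Suc j \<in> active")
        case True
        then show ?thesis using epoch_usage[OF 2(2) True] by (simp add: mean y)
      next
        case False
        then have "d (Suc j) \<le> 0" by (simp add: d dev shortfall_def)
        then show ?thesis
          using epoch_usage_le[OF 2(2)] by (intro mult_left_mono_neg) (auto simp: mean y)
      qed
      also have "\<dots> = - (d (Suc j))\<^sup>2 / \<tau>"
        unfolding d dev shortfall_mult[symmetric] by simp
      finally have "(d (Suc j))\<^sup>2 + 2 * d (Suc j) * mean (Suc j) \<le> (d (Suc j))\<^sup>2 * (1 - 2 / \<tau>)"
        by (simp add: algebra_simps)
      then show ?thesis unfolding 2(1) d[symmetric] using zero_le_power2[of \<rho>] by linarith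
    qed
  qed
  also have "\<dots> = potential n C \<tau> * (1 - 2 / \<tau>) + real (card tracked) * (noise + \<rho>\<^sup>2)"
    by (simp add: potential_def sum.distrib sum_distrib_right)
  also have "\<dots> \<le> potential n C \<tau> * (1 - 2 / \<tau>) + real (n_res m + 1) * (noise + \<rho>\<^sup>2)"
    using card_tracked by (intro add_left_mono mult_right_mono) (auto simp: noise_def)
  finally show ?thesis .
qed

end

section \<open>The loss of the re-solving policy\<close>

definition noise_total :: real where
  "noise_total = real (n_res m + 1) * (noise + \<rho>\<^sup>2)"

text \<open>Bounds on the loss from the start of an epoch and from within an epoch. The quotients exceed the
  worth of what remains once the potential is of order \<open>(\<rho> \<tau>)\<^sup>2\<close>, so stopping is paid for; the
  additive constant does this for the last epochs, where \<open>\<tau>\<close> is small; the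
  logarithm accumulates \<open>noise_total / \<tau>\<close> over the epochs to go.\<close>

definition loss :: "nat \<Rightarrow> (nat \<Rightarrow> real) \<Rightarrow> real \<Rightarrow> real" where
  "loss n C \<tau> = 4 * B / \<rho>\<^sup>2 * (potential n C \<tau> / (\<tau> + 1) + 2 * noise_total * ln (1 + \<tau>)) + 4 * B"

definition epoch_loss :: "nat \<Rightarrow> (nat \<Rightarrow> real) \<Rightarrow> real \<Rightarrow> nat set \<Rightarrow> real" where
  "epoch_loss n C \<tau> S =
     4 * B / \<rho>\<^sup>2 * (epoch_potential n C (\<tau> - 1) S / \<tau> + 2 * noise_total * ln \<tau>) + 4 * B"

lemma noise_total_nonneg: "0 \<le> noise_total"
  by (simp add: noise_total_def noise_def)

lemma scale_nonneg: "0 \<le> 4 * B / \<rho>\<^sup>2"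
  using B_ge_1 by simp

lemma loss_ge_const: "0 \<le> \<tau> \<Longrightarrow> 4 * B \<le> loss n C \<tau>"
  unfolding loss_def using potential_nonneg noise_total_nonneg scale_nonneg
  by (simp del: times_divide_eq_left)

lemma loss_if_potential_large:
  assumes "1 \<le> \<tau>" "(\<rho> * \<tau>)\<^sup>2 \<le> potential n C \<tau>"
  shows "B * (\<tau> + 1) \<le> loss n C \<tau>"
proof -
  have "(\<tau> + 1) * (\<tau> + 1) \<le> (2 * \<tau>) * (2 * \<tau>)" using assms(1) by (intro mult_mono) auto
  then have "\<tau> + 1 \<le> (2 * \<tau>) * (2 * \<tau>) / (\<tau> + 1)"
    using assms(1) by (subst pos_le_divide_eq) auto
  also have "\<dots> = 4 * (\<tau>\<^sup>2 / (\<tau> + 1))" by (simp add: power2_eq_square)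
  finally have "\<tau> + 1 \<le> 4 * (\<tau>\<^sup>2 / (\<tau> + 1))" .
  then have "B * (\<tau> + 1) \<le> B * (4 * (\<tau>\<^sup>2 / (\<tau> + 1)))"
    using B_ge_1 by (intro mult_left_mono) auto
  also have "\<dots> = 4 * B / \<rho>\<^sup>2 * ((\<rho> * \<tau>)\<^sup>2 / (\<tau> + 1))"
    using rho_pos by (simp add: power_mult_distrib)
  also have "\<dots> \<le> 4 * B / \<rho>\<^sup>2 * (potential n C \<tau> / (\<tau> + 1) + 2 * noise_total * ln (1 + \<tau>))"
    using assms noise_total_nonneg
    by (intro mult_left_mono scale_nonneg add_increasing2 divide_right_mono mult_nonneg_nonneg) auto
  finally show ?thesis unfolding loss_def using B_ge_1 by simp
qed

lemma epoch_loss_if_exhausted: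
  assumes "1 \<le> \<tau>" "\<rho>\<^sup>2 * (\<tau> - 1)\<^sup>2 / 4 \<le> epoch_potential n C (\<tau> - 1) S"
  shows "B * \<tau> \<le> epoch_loss n C \<tau> S"
proof -
  have "\<tau> * \<tau> \<le> (\<tau> - 1)\<^sup>2 + 4 * \<tau>"
    using assms(1) by (simp add: power2_eq_square algebra_simps)
  then have "\<tau> \<le> (\<tau> - 1)\<^sup>2 / \<tau> + 4"
    using assms(1) by (simp add: field_simps)
  then have "B * \<tau> \<le> B * ((\<tau> - 1)\<^sup>2 / \<tau> + 4)" using B_ge_1 by (intro mult_left_mono) auto
  also have "\<dots> = 4 * B / \<rho>\<^sup>2 * ((\<rho>\<^sup>2 * (\<tau> - 1)\<^sup>2 / 4) / \<tau>) + 4 * B"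
    using rho_pos by (simp add: distrib_left)
  also have "\<dots> \<le> epoch_loss n C \<tau> S"
    unfolding epoch_loss_def using assms noise_total_nonneg
    by (intro add_right_mono mult_left_mono scale_nonneg add_increasing2 divide_right_mono
        mult_nonneg_nonneg) auto
  finally show ?thesis .
qed

text \<open>Within an epoch the loss is a supermartingale. The denominator \<open>\<tau>\<close> of \<open>epoch_loss\<close> is that of \<open>loss\<close>
  for the epoch that follows.\<close>

lemma epoch_loss_step:
  assumes "1 \<le> \<tau>" "offerable m S"
  shows "loss n C (\<tau> - 1) + (\<Sum>i\<in>S. pref m i * epoch_loss n (update_inventory m C (Some i)) \<tau> S)
    \<le> (1 + offer_weight m S) * epoch_loss (Suc n) C \<tau> S"
proof -
  let ?c = "4 * B / \<rho>\<^sup>2" and ?L = "2 * noise_total * ln \<tau>"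
  let ?C = "\<lambda>i. update_inventory m C (Some i)"
  let ?P = "potential n C (\<tau> - 1)" and ?U = "\<lambda>i. epoch_potential n (?C i) (\<tau> - 1) S"
  have "loss n C (\<tau> - 1) + (\<Sum>i\<in>S. pref m i * epoch_loss n (?C i) \<tau> S)
      = ?c * ((?P + (\<Sum>i\<in>S. pref m i * ?U i)) / \<tau>) + (1 + offer_weight m S) * (?c * ?L + 4 * B)"
  proof -
    have "(\<Sum>i\<in>S. pref m i * epoch_loss n (?C i) \<tau> S)
        = (\<Sum>i\<in>S. ?c / \<tau> * (pref m i * ?U i) + pref m i * (?c * ?L + 4 * B))"
      by (intro sum.cong refl) (simp add: epoch_loss_def algebra_simps)
    also have "\<dots> = ?c / \<tau> * (\<Sum>i\<in>S. pref m i * ?U i) + offer_weight m S * (?c * ?L + 4 * B)"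
      unfolding sum.distrib sum_distrib_left[symmetric] offer_weight_def sum_distrib_right[symmetric] ..
    finally show ?thesis by (simp add: loss_def algebra_simps add_divide_distrib)
  qed
  also have "\<dots> \<le> ?c * ((1 + offer_weight m S) * epoch_potential (Suc n) C (\<tau> - 1) S / \<tau>)
      + (1 + offer_weight m S) * (?c * ?L + 4 * B)"
    using assms(1) epoch_potential_step[OF assms(2)]
    by (intro add_right_mono mult_left_mono scale_nonneg divide_right_mono) auto
  also have "\<dots> = (1 + offer_weight m S) * epoch_loss (Suc n) C \<tau> S"
  proof -
    have "c * (W * u / \<tau>) + W * (c * l + b) = W * (c * (u / \<tau> + l) + b)" for c W u l b :: real
      by (simp add: algebra_simps)
    then show ?thesis unfolding epoch_loss_def .
  qed
  finally show ?thesis .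
qed

lemma inverse_le_ln_increment:
  assumes "1 \<le> (\<tau>::real)"
  shows "1 / \<tau> \<le> 2 * (ln (1 + \<tau>) - ln \<tau>)"
proof -
  have "ln (\<tau> / (1 + \<tau>)) \<le> \<tau> / (1 + \<tau>) - 1"
    using assms by (intro ln_le_minus_one) auto
  also have "\<dots> = - (1 / (1 + \<tau>))" using assms by (simp add: field_simps)
  finally have "1 / (1 + \<tau>) \<le> ln (1 + \<tau>) - ln \<tau>" using assms by (simp add: ln_div)
  then have "2 * (1 / (1 + \<tau>)) \<le> 2 * (ln (1 + \<tau>) - ln \<tau>)" by (rule mult_left_mono) simp
  moreover have "1 / \<tau> \<le> 2 * (1 / (1 + \<tau>))" using assms by (simp add: field_simps)
  ultimately show ?thesis by (rule order_trans[rotated])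
qed

text \<open>The pull towards the target shrinks the quotient by more than the step from \<open>\<tau>\<close> to \<open>\<tau> - 1\<close> enlarges
  it, and the logarithm absorbs the noise.\<close>

lemma expectation_epoch_loss:
  assumes "1 \<le> \<tau>" "plentiful n C" "potential n C \<tau> \<le> (\<rho> * \<tau>)\<^sup>2"
    and "Psi_optimal m (\<lambda>j. C j / real n) (real n / \<tau>) x" and p: "sample_assortment m x p"
  shows "measure_pmf.expectation p (epoch_loss n C \<tau>) \<le> loss n C \<tau>"
proof -
  let ?c = "4 * B / \<rho>\<^sup>2" and ?U = "potential n C \<tau>"
  have int: "integrable p f" for f :: "nat set \<Rightarrow> real"
    by (rule integrable_measure_pmf_finite[OF sample_assortment_finite[OF p]])
  have "measure_pmf.expectation p (epoch_loss n C \<tau>)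
      = ?c * (measure_pmf.expectation p (epoch_potential n C (\<tau> - 1)) / \<tau> + 2 * noise_total * ln \<tau>) + 4 * B"
    unfolding epoch_loss_def by (simp add: int del: times_divide_eq_left)
  also have "\<dots> \<le> ?c * ((?U * (1 - 2 / \<tau>) + noise_total) / \<tau> + 2 * noise_total * ln \<tau>) + 4 * B"
    using expectation_epoch_potential[OF assms] assms(1) unfolding noise_total_def
    by (intro add_right_mono mult_left_mono scale_nonneg divide_right_mono) auto
  also have "\<dots> \<le> ?c * (?U / (\<tau> + 1) + 2 * noise_total * ln (1 + \<tau>)) + 4 * B"
  proof (intro add_right_mono mult_left_mono scale_nonneg)
    have "(1 - 2 / \<tau>) / \<tau> \<le> 1 / (\<tau> + 1)"
      using assms(1) by (simp add: field_simps)
    then have "?U * ((1 - 2 / \<tau>) / \<tau>) \<le> ?U * (1 / (\<tau> + 1))"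
      using potential_nonneg by (intro mult_left_mono) auto
    moreover have "noise_total * (1 / \<tau>) \<le> noise_total * (2 * (ln (1 + \<tau>) - ln \<tau>))"
      using inverse_le_ln_increment[OF assms(1)] noise_total_nonneg by (intro mult_left_mono)
    moreover have "(?U * (1 - 2 / \<tau>) + noise_total) / \<tau>
        = ?U * ((1 - 2 / \<tau>) / \<tau>) + noise_total * (1 / \<tau>)"
      by (simp add: add_divide_distrib)
    moreover have "noise_total * (2 * (ln (1 + \<tau>) - ln \<tau>))
        = 2 * noise_total * ln (1 + \<tau>) - 2 * noise_total * ln \<tau>"
      by (simp add: algebra_simps)
    moreover have "?U * (1 / (\<tau> + 1)) = ?U / (\<tau> + 1)" by simp
    ultimately show "(?U * (1 - 2 / \<tau>) + noise_total) / \<tau> + 2 * noise_total * ln \<tau>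
        \<le> ?U / (\<tau> + 1) + 2 * noise_total * ln (1 + \<tau>)"
      by linarith
  qed
  finally show ?thesis by (simp add: loss_def)
qed

lemma worth_update_le:
  assumes "i < n_prod m"
  shows "worth n (update_inventory m C (Some i)) \<le> worth (Suc n) C"
proof -
  have "(\<Sum>j<n_res m. \<pi> j * update_inventory m C (Some i) j) \<le> (\<Sum>j<n_res m. \<pi> j * C j)"
    using assms usage_nonneg price_nonneg
    by (intro sum_mono mult_left_mono) (auto simp: update_inventory_def)
  then show ?thesis using time_price_nonneg by (simp add: worth_def algebra_simps)
qed

lemma plentiful_update:
  assumes "plentiful (Suc n) C" "p = None \<or> (\<exists>i<n_prod m. p = Some i)"
  shows "plentiful n (update_inventory m C p)"
  unfolding plentiful_def
proof (intro allI impI)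
  fix j assume j: "j < n_res m" "A\<^sub>0 < \<gamma>\<^sub>0 j"
  then have "\<gamma>\<^sub>0 j * real n + \<gamma>\<^sub>0 j \<le> C j"
    using assms(1) by (auto simp: plentiful_def algebra_simps)
  then show "\<gamma>\<^sub>0 j * real n \<le> update_inventory m C p j"
    using assms(2) j usage_le[of _ j] gamma_nonneg[of j]
    by (fastforce simp: update_inventory_def split: option.splits)
qed

text \<open>The bound on the worth of what remains says that it is at most the revenue \<open>B\<close> per epoch to go; at
  the start of an epoch it is inherited from the epoch before, hence \<open>\<tau> + 1\<close>. It holds whenever the program is solved within the stable region, and persists because worth
  only decreases.\<close>

definition start_covered :: "real \<Rightarrow> nat \<Rightarrow> bool" where
  "start_covered \<tau>\<^sub>0 n \<longleftrightarrow> (\<forall>k C. plentiful n C \<longrightarrow> 0 \<le> \<tau>\<^sub>0 - real k \<longrightarrow>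
     worth n C \<le> B * (\<tau>\<^sub>0 - real k + 1) \<longrightarrow>
     worth n C - loss n C (\<tau>\<^sub>0 - real k) \<le> revenue_to_go m \<tau>\<^sub>0 draw n C (Start k))"

definition offering_covered :: "real \<Rightarrow> nat \<Rightarrow> bool" where
  "offering_covered \<tau>\<^sub>0 n \<longleftrightarrow> (\<forall>k C S. plentiful n C \<longrightarrow> 1 \<le> \<tau>\<^sub>0 - real k \<longrightarrow> offerable m S \<longrightarrow>
     worth n C \<le> B * (\<tau>\<^sub>0 - real k) \<longrightarrow>
     worth n C + surplus S - epoch_loss n C (\<tau>\<^sub>0 - real k) S
       \<le> revenue_to_go m \<tau>\<^sub>0 draw n C (Offering k S))"

lemma offering_covered_if_exhausted:
  assumes "plentiful n C" "1 \<le> \<tau>" "offerable m S" "worth n C \<le> B * \<tau>"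
    "n = 0 \<or> \<not> sufficient_inventory m C S"
  shows "worth n C + surplus S - epoch_loss n C \<tau> S \<le> revenue_to_go m \<tau>\<^sub>0 draw n C (Offering k S)"
proof -
  have "\<rho>\<^sup>2 * (\<tau> - 1)\<^sup>2 / 4 \<le> epoch_potential n C (\<tau> - 1) S"
    using assms by (intro epoch_potential_large_if_exhausted) auto
  then have "B * \<tau> \<le> epoch_loss n C \<tau> S" by (rule epoch_loss_if_exhausted[OF assms(2)])
  moreover have "0 \<le> revenue_to_go m \<tau>\<^sub>0 draw n C (Offering k S)"
    using assms(3) by (intro revenue_to_go_nonneg[OF valid rule]) (simp add: offered_def)
  ultimately show ?thesis using assms(4) surplus_nonpos[OF assms(3)] by linarith
qed

text \<open>At the start of an epoch there are three cases. With less than one epoch to go the constant in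
  \<open>loss\<close> pays for what remains; outside the stable region the potential does; inside it the drawn
  assortment has surplus zero in expectation.\<close>

lemma start_covered_if_offering_covered:
  assumes offering: "offering_covered \<tau>\<^sub>0 n"
  shows "start_covered \<tau>\<^sub>0 n"
  unfolding start_covered_def
proof (intro allI impI)
  fix k :: nat and C :: "nat \<Rightarrow> real"
  define \<tau> where "\<tau> = \<tau>\<^sub>0 - real k"
  let ?\<gamma> = "\<lambda>j. C j / real n" and ?s = "real n / \<tau>"
  assume C: "plentiful n C" and "0 \<le> \<tau>\<^sub>0 - real k" and "worth n C \<le> B * (\<tau>\<^sub>0 - real k + 1)"
  then have \<tau>: "0 \<le> \<tau>" and worth: "worth n C \<le> B * (\<tau> + 1)" by (simp_all add: \<tau>_def)
  have value_nonneg: "0 \<le> revenue_to_go m \<tau>\<^sub>0 draw n C (Start k)"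
    by (rule revenue_to_go_nonneg[OF valid rule]) (simp add: offered_def offerable_def)
  consider "\<tau> < 1" | "1 \<le> \<tau>" "(\<rho> * \<tau>)\<^sup>2 < potential n C \<tau>"
    | "1 \<le> \<tau>" "potential n C \<tau> \<le> (\<rho> * \<tau>)\<^sup>2" by linarith
  then have "worth n C - loss n C \<tau> \<le> revenue_to_go m \<tau>\<^sub>0 draw n C (Start k)"
  proof cases
    case 1
    then have "B * (\<tau> + 1) \<le> B * 2" using B_ge_1 by (intro mult_left_mono) auto
    then show ?thesis using worth value_nonneg loss_ge_const[OF \<tau>, of n C] B_ge_1 by linarith
  next
    case 2
    then show ?thesis using loss_if_potential_large[of \<tau> n C] worth value_nonneg by linarith
  next
    case 3
    note region = small_potential[OF 3(1) C 3(2)]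
    have "(\<lambda>_. 0) \<in> Psi_feasible m ?\<gamma> ?s"
    proof (rule zero_Psi_feasible[OF valid])
      show "1 \<le> ?s" using region(1) 3(1) by simp
      show "0 \<le> ?\<gamma> j" if "j < n_res m" for j
        using region(3)[OF that] rho_less[OF that] by linarith
    qed
    then have feas: "Psi_feasible m ?\<gamma> ?s \<noteq> {}" by blast
    then obtain x where x: "Psi_optimal m ?\<gamma> ?s x" and p: "sample_assortment m x (draw k ?\<gamma> ?s)"
      using rule unfolding resolving_rule_def by blast
    let ?p = "draw k ?\<gamma> ?s"
    have fin: "finite (set_pmf ?p)" by (rule sample_assortment_finite[OF p])
    have int: "integrable ?p f" for f :: "nat set \<Rightarrow> real"
      by (rule integrable_measure_pmf_finite[OF fin])
    have "x \<in> Phi_feasible m ?\<gamma>" using x by (simp add: Psi_optimal_iff Psi_feasible_def)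
    then have "\<tau> * revenue_rate m x \<le> \<tau> * B"
      using revenue_rate_le_B \<tau> by (intro mult_left_mono) auto
    then have worth: "worth n C \<le> B * \<tau>"
      using worth_eq_epoch_revenue[OF 3(1) C 3(2) x p] by (simp add: mult.commute)
    have n: "1 \<le> n" using region(1) 3(1) by linarith
    have "worth n C - loss n C \<tau> \<le> worth n C + measure_pmf.expectation ?p surplus
        - measure_pmf.expectation ?p (epoch_loss n C \<tau>)"
      using expectation_surplus[OF 3(1) C 3(2) x p] expectation_epoch_loss[OF 3(1) C 3(2) x p]
      by linarith
    also have "\<dots> = measure_pmf.expectation ?p (\<lambda>S. worth n C + surplus S - epoch_loss n C \<tau> S)"
      by (simp add: int)
    also have "\<dots> \<le> measure_pmf.expectation ?p (\<lambda>S. revenue_to_go m \<tau>\<^sub>0 draw n C (Offering k S))"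
    proof (rule expectation_mono_finite[OF fin])
      fix S assume "S \<in> set_pmf ?p"
      then have "offerable m S" using sample_assortment_card[OF p] by (simp add: offerable_def)
      then show "worth n C + surplus S - epoch_loss n C \<tau> S
          \<le> revenue_to_go m \<tau>\<^sub>0 draw n C (Offering k S)"
        using offering C 3(1) worth unfolding offering_covered_def \<tau>_def by blast
    qed
    also have "\<dots> = revenue_to_go m \<tau>\<^sub>0 draw n C (Start k)"
      using revenue_to_go_Start[OF n 3(1)[unfolded \<tau>_def] feas[unfolded \<tau>_def], of draw]
      unfolding \<tau>_def by (rule sym)
    finally show ?thesis .
  qed
  then show "worth n C - loss n C (\<tau>\<^sub>0 - real k) \<le> revenue_to_go m \<tau>\<^sub>0 draw n C (Start k)"
    by (simp add: \<tau>_def)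
qed

lemma offering_covered_Suc:
  assumes start: "start_covered \<tau>\<^sub>0 n" and offering: "offering_covered \<tau>\<^sub>0 n"
  shows "offering_covered \<tau>\<^sub>0 (Suc n)"
  unfolding offering_covered_def
proof (intro allI impI)
  fix k :: nat and C :: "nat \<Rightarrow> real" and S :: "nat set"
  let ?\<tau> = "\<tau>\<^sub>0 - real k" and ?C = "\<lambda>i. update_inventory m C (Some i)" and ?W = "1 + offer_weight m S"
  let ?J = "\<lambda>i. revenue_to_go m \<tau>\<^sub>0 draw n (?C i) (Offering k S)"
  assume C: "plentiful (Suc n) C" and \<tau>: "1 \<le> ?\<tau>" and S: "offerable m S"
    and worth: "worth (Suc n) C \<le> B * ?\<tau>"
  show "worth (Suc n) C + surplus S - epoch_loss (Suc n) C ?\<tau> S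
      \<le> revenue_to_go m \<tau>\<^sub>0 draw (Suc n) C (Offering k S)"
  proof (cases "sufficient_inventory m C S")
    case False
    then show ?thesis using offering_covered_if_exhausted[OF C \<tau> S worth] by blast
  next
    case True
    have W: "1 \<le> ?W" using offer_weight_nonneg[OF valid S] by simp
    have less: "i < n_prod m" if "i \<in> S" for i using S that by (auto simp: offerable_def)
    have none: "worth n C - loss n C (?\<tau> - 1) \<le> revenue_to_go m \<tau>\<^sub>0 draw n C (Start (Suc k))"
    proof -
      have eq: "\<tau>\<^sub>0 - real (Suc k) = ?\<tau> - 1" by simp
      have "plentiful n C"
        using plentiful_update[OF C, of None] by (simp add: update_inventory_def)
      moreover have "worth n C \<le> B * (\<tau>\<^sub>0 - real (Suc k) + 1)"
        using worth time_price_nonneg by (simp add: worth_Suc)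
      moreover have "0 \<le> \<tau>\<^sub>0 - real (Suc k)" using \<tau> by simp
      ultimately show ?thesis using start unfolding start_covered_def eq[symmetric] by blast
    qed
    have some: "worth n (?C i) + surplus S - epoch_loss n (?C i) ?\<tau> S \<le> ?J i" if "i \<in> S" for i
    proof -
      have "plentiful n (?C i)" using plentiful_update[OF C, of "Some i"] less[OF that] by simp
      moreover have "worth n (?C i) \<le> B * ?\<tau>"
        using worth worth_update_le[OF less[OF that], of n C] by linarith
      ultimately show ?thesis using offering \<tau> S unfolding offering_covered_def by blast
    qed
    \<comment> \<open>In expectation a period adds \<open>surplus S / ?W\<close> to revenue plus worth, and with probability
      \<open>1 - 1 / ?W\<close> the epoch goes on, with all of \<open>surplus S\<close> still to come.\<close>
    have balance: "?W * (worth (Suc n) C + surplus S)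
        = worth n C + (\<Sum>i\<in>S. pref m i * (profit m i + (worth n (?C i) + surplus S)))"
    proof -
      have "(\<Sum>i\<in>S. pref m i * (profit m i + (worth n (?C i) + surplus S)))
          = (\<Sum>i\<in>S. markup i + pref m i * (worth n C + surplus S))"
        using worth_update[OF _ S] by (intro sum.cong refl) (simp add: distrib_left add.assoc[symmetric])
      also have "\<dots> = (\<Sum>i\<in>S. markup i) + offer_weight m S * (worth n C + surplus S)"
        by (simp add: sum.distrib offer_weight_def sum_distrib_right)
      finally show ?thesis by (simp add: worth_Suc surplus_def algebra_simps)
    qed
    have "?W * (worth (Suc n) C + surplus S - epoch_loss (Suc n) C ?\<tau> S)
        \<le> worth n C + (\<Sum>i\<in>S. pref m i * (profit m i + (worth n (?C i) + surplus S)))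
          - (loss n C (?\<tau> - 1) + (\<Sum>i\<in>S. pref m i * epoch_loss n (?C i) ?\<tau> S))"
      using epoch_loss_step[OF \<tau> S, of n C] unfolding right_diff_distrib balance by linarith
    also have "\<dots> = (worth n C - loss n C (?\<tau> - 1)) + (\<Sum>i\<in>S. pref m i *
        (profit m i + (worth n (?C i) + surplus S)) - pref m i * epoch_loss n (?C i) ?\<tau> S)"
      by (simp add: sum_subtractf)
    also have "\<dots> \<le> revenue_to_go m \<tau>\<^sub>0 draw n C (Start (Suc k))
        + (\<Sum>i\<in>S. pref m i * (profit m i + ?J i))"
    proof (intro add_mono none sum_mono)
      fix i assume i: "i \<in> S"
      have "pref m i * (profit m i + (worth n (?C i) + surplus S - epoch_loss n (?C i) ?\<tau> S))
          \<le> pref m i * (profit m i + ?J i)"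
        using some[OF i] pref_nonneg[OF less[OF i]] by (intro mult_left_mono add_left_mono)
      then show "pref m i * (profit m i + (worth n (?C i) + surplus S)) - pref m i * epoch_loss n (?C i) ?\<tau> S
          \<le> pref m i * (profit m i + ?J i)"
        by (simp only: right_diff_distrib[symmetric] add_diff_eq)
    qed
    finally show ?thesis
      unfolding revenue_to_go_Offering[OF valid S True] using W
      by (simp add: pos_le_divide_eq mult.commute)
  qed
qed

lemma all_covered: "start_covered \<tau>\<^sub>0 n \<and> offering_covered \<tau>\<^sub>0 n"
proof (induction n)
  case 0
  have "offering_covered \<tau>\<^sub>0 0"
    using offering_covered_if_exhausted[of 0] unfolding offering_covered_def by blast
  then show ?case using start_covered_if_offering_covered by blast
next
  case (Suc n)
  then have "offering_covered \<tau>\<^sub>0 (Suc n)" using offering_covered_Suc by blast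
  then show ?case using start_covered_if_offering_covered by blast
qed

text \<open>The initial state has deviation zero, and its worth is the upper bound for every policy.\<close>

lemma resolving_regret_le_loss:
  "resolving_regret m (initial_inventory T \<gamma>\<^sub>0) T xF draw
    \<le> loss T (initial_inventory T \<gamma>\<^sub>0) (real T / V)"
proof -
  let ?C = "initial_inventory T \<gamma>\<^sub>0" and ?\<tau> = "real T / V"
  have "worth T ?C = real T * ((\<Sum>j<n_res m. \<pi> j * \<gamma>\<^sub>0 j) + \<sigma>)"
    by (simp add: worth_def initial_inventory_def sum_distrib_left distrib_left mult_ac)
  also have "\<dots> = ?\<tau> * revenue_rate m xF"
    using V_ge_1 by (simp add: price_total revenue_rate_xF)
  also have "\<dots> \<le> ?\<tau> * B"
    using revenue_rate_le_B[OF xF_feasible] V_ge_1 by (intro mult_left_mono) auto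
  finally have "worth T ?C \<le> B * (?\<tau> + 1)" using B_ge_1 by (simp add: algebra_simps)
  moreover have "plentiful T ?C" by (simp add: plentiful_def initial_inventory_def mult.commute)
  moreover have "0 \<le> ?\<tau> - real 0" using V_ge_1 by simp
  ultimately have "worth T ?C - loss T ?C ?\<tau> \<le> revenue_to_go m ?\<tau> draw T ?C (Start 0)"
    using all_covered[of ?\<tau> T] unfolding start_covered_def
    by (metis diff_zero of_nat_0)
  moreover have "optimal_revenue m ?C T \<le> worth T ?C"
    by (rule optimal_revenue_le[OF gamma_nonneg])
  ultimately show ?thesis
    unfolding resolving_regret_def resolving_revenue_eq_revenue_to_go[OF valid rule] by linarith
qed

text \<open>The constant consists of \<open>4 * 2 * 34 * 2\<close> from the noise and \<open>8\<close> from the additive term of \<open>loss\<close>,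
  which \<open>\<rho> \<le> B\<close> and \<open>1 \<le> 2 ln T\<close> bring into the same form.\<close>

lemma resolving_regret_le:
  assumes T: "2 \<le> T"
  shows "resolving_regret m (initial_inventory T \<gamma>\<^sub>0) T xF draw
    \<le> 552 * (A\<^sub>0\<^sup>2 * B ^ 3 * real (n_res m) * ln (real T)) / \<rho>\<^sup>2"
proof -
  let ?C = "initial_inventory T \<gamma>\<^sub>0" and ?\<tau> = "real T / V" and ?M = "real (n_res m)"
  let ?X = "A\<^sub>0\<^sup>2 * ?M"
  have M: "1 \<le> ?M" using valid by (simp add: valid_model_def)
  have A: "1 \<le> A\<^sub>0\<^sup>2" using A0 by simp
  have X: "1 \<le> ?X" using mult_mono[OF A M] by simp
  have lnT: "1 \<le> 2 * ln (real T)"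
  proof -
    have "ln 2 \<le> ln (real T)" using T by (subst ln_le_cancel_iff) auto
    then show ?thesis using ln2_ge_two_thirds by linarith
  qed
  have "potential T ?C ?\<tau> = 0"
  proof -
    have "position k T ?C ?\<tau> = 0" for k
      using V_ge_1 by (cases k) (simp_all add: position_def initial_inventory_def)
    then have "deviation k T ?C ?\<tau> = 0" for k by (simp add: deviation_def shortfall_def)
    then show ?thesis by (simp add: potential_def)
  qed
  then have loss: "loss T ?C ?\<tau> = 4 * B / \<rho>\<^sup>2 * (2 * noise_total * ln (1 + ?\<tau>)) + 4 * B"
    by (simp add: loss_def)
  have noise: "noise_total \<le> 34 * (?X * B\<^sup>2)"
  proof -
    have "\<rho>\<^sup>2 \<le> 1 * B\<^sup>2" using rho_le_B rho_pos by (simp add: power_mono)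
    also have "\<dots> \<le> A\<^sub>0\<^sup>2 * B\<^sup>2" using A by (intro mult_right_mono) auto
    finally have "noise + \<rho>\<^sup>2 \<le> 17 * (A\<^sub>0\<^sup>2 * B\<^sup>2)" by (simp add: noise_def)
    then have "noise_total \<le> (2 * ?M) * (17 * (A\<^sub>0\<^sup>2 * B\<^sup>2))"
      unfolding noise_total_def using M by (intro mult_mono) (auto simp: noise_def)
    then show ?thesis by (simp add: mult_ac)
  qed
  have ln: "ln (1 + ?\<tau>) \<le> 2 * ln (real T)"
  proof -
    have "?\<tau> \<le> real T" using V_ge_1 by (simp add: pos_divide_le_eq mult_le_cancel_left1)
    moreover have "2 * real T \<le> real T * real T" using T by (intro mult_right_mono) auto
    ultimately have "1 + ?\<tau> \<le> real T * real T" using T by linarith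
    moreover have "0 < 1 + ?\<tau>" using V_ge_1 by (simp add: add_pos_nonneg)
    ultimately have "ln (1 + ?\<tau>) \<le> ln (real T * real T)" by (intro ln_mono) auto
    then show ?thesis using T by (simp add: ln_mult)
  qed
  have "loss T ?C ?\<tau> \<le> 4 * B / \<rho>\<^sup>2 * (2 * (34 * (?X * B\<^sup>2)) * (2 * ln (real T)))
      + 4 * B / \<rho>\<^sup>2 * (B\<^sup>2 * (2 * ln (real T) * ?X))"
    unfolding loss
  proof (intro add_mono mult_left_mono scale_nonneg)
    have "0 \<le> ln (1 + ?\<tau>)" using V_ge_1 by (intro ln_ge_zero) simp
    then show "2 * noise_total * ln (1 + ?\<tau>) \<le> 2 * (34 * (?X * B\<^sup>2)) * (2 * ln (real T))"
      using noise noise_total_nonneg ln X by (intro mult_mono) auto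
    have "\<rho>\<^sup>2 * 1 \<le> B\<^sup>2 * (2 * ln (real T) * ?X)"
      using rho_le_B rho_pos mult_mono[OF lnT X] lnT X by (intro mult_mono power_mono) auto
    then have "4 * B / \<rho>\<^sup>2 * \<rho>\<^sup>2 \<le> 4 * B / \<rho>\<^sup>2 * (B\<^sup>2 * (2 * ln (real T) * ?X))"
      by (intro mult_left_mono scale_nonneg) simp
    then show "4 * B \<le> 4 * B / \<rho>\<^sup>2 * (B\<^sup>2 * (2 * ln (real T) * ?X))"
      using rho_pos by simp
  qed
  also have "\<dots> = 552 * (A\<^sub>0\<^sup>2 * B ^ 3 * ?M * ln (real T)) / \<rho>\<^sup>2"
    using rho_pos by (simp add: field_simps power2_eq_square power3_eq_cube)
  finally show ?thesis using resolving_regret_le_loss[of T] by linarith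
qed

end

theorem theorem1:
  shows "\<exists>c::real. \<forall>(m::mnl_model) (\<gamma>\<^sub>0::nat \<Rightarrow> real) (A\<^sub>0::real) (B\<^sub>0::real)
      (\<gamma>_min::real) (\<rho>\<^sub>0::real) (\<chi>\<^sub>0::real) (xF::nat \<Rightarrow> real) (T::nat)
      (draw::nat \<Rightarrow> (nat \<Rightarrow> real) \<Rightarrow> real \<Rightarrow> nat set pmf).
    valid_model m \<longrightarrow>
    (\<forall>j<n_res m. 0 \<le> \<gamma>\<^sub>0 j) \<longrightarrow>
    Phi_optimal m \<gamma>\<^sub>0 xF \<longrightarrow>
    1 \<le> A\<^sub>0 \<longrightarrow> 1 \<le> B\<^sub>0 \<longrightarrow>
    assumption_A1 m A\<^sub>0 B\<^sub>0 \<longrightarrow>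
    assumption_A2 m \<gamma>\<^sub>0 \<gamma>_min \<longrightarrow>
    assumption_A3 m \<gamma>\<^sub>0 \<gamma>_min \<rho>\<^sub>0 \<chi>\<^sub>0 xF \<longrightarrow>
    resolving_rule m draw \<longrightarrow>
    2 \<le> T \<longrightarrow>
    resolving_regret m (initial_inventory T \<gamma>\<^sub>0) T xF draw
      \<le> c * (A\<^sub>0 ^ 2 * B\<^sub>0 ^ 7 * real (cap m) ^ 5 * real (n_res m) ^ 2 * real (n_prod m) * ln (real T))
          / min (\<rho>\<^sub>0 ^ 2) (\<chi>\<^sub>0 ^ 2)"
proof (intro exI[of _ 552] allI impI)
  fix m \<gamma>\<^sub>0 A\<^sub>0 B\<^sub>0 \<gamma>_min \<rho>\<^sub>0 \<chi>\<^sub>0 xF T draw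
  assume valid: "valid_model m" and opt: "Phi_optimal m \<gamma>\<^sub>0 xF"
    and A0: "(1::real) \<le> A\<^sub>0" and B0: "(1::real) \<le> B\<^sub>0" and A1: "assumption_A1 m A\<^sub>0 B\<^sub>0"
    and A2: "assumption_A2 m \<gamma>\<^sub>0 \<gamma>_min" and A3: "assumption_A3 m \<gamma>\<^sub>0 \<gamma>_min \<rho>\<^sub>0 \<chi>\<^sub>0 xF"
    and rule: "resolving_rule m draw" and T: "(2::nat) \<le> T"
  interpret fluid_optimum m \<gamma>\<^sub>0 xF using valid opt by unfold_locales
  have rho: "0 < \<rho>\<^sub>0" "\<rho>\<^sub>0 < \<gamma>_min" "\<rho>\<^sub>0 < weight m xF" and chi: "0 < \<chi>\<^sub>0"
    using A3 by (auto simp: assumption_A3_def)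
  have stable: "binding m (\<lambda>j. \<gamma>\<^sub>0 j + \<delta> j) (V + \<epsilon>) x = active"
    and invertible: "invertible_mat (binding_mat m (\<lambda>j. \<gamma>\<^sub>0 j + \<delta> j) (V + \<epsilon>) x)"
    if "\<And>j. j < n_res m \<Longrightarrow> \<bar>\<delta> j\<bar> \<le> \<rho>\<^sub>0" "\<bar>\<epsilon>\<bar> \<le> \<rho>\<^sub>0"
      "Psi_optimal m (\<lambda>j. \<gamma>\<^sub>0 j + \<delta> j) (V + \<epsilon>) x" for \<delta> \<epsilon> x
    using A3 that xF_Psi_optimal unfolding assumption_A3_def by blast+
  have "invertible_mat (binding_mat m \<gamma>\<^sub>0 V xF)"
    using invertible[of "\<lambda>_. 0" 0 xF] xF_Psi_optimal rho(1) by simp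
  from dual_prices[OF this] obtain \<pi> \<sigma> where prices: "\<And>j. 0 \<le> \<pi> j" "0 \<le> \<sigma>"
    "(\<Sum>j<n_res m. \<pi> j * \<gamma>\<^sub>0 j) + \<sigma> = fluid_revenue m xF"
    "\<And>x. (\<And>i. i < n_prod m \<Longrightarrow> 0 \<le> x i \<and> x i \<le> 1) \<Longrightarrow> (\<Sum>i<n_prod m. x i) \<le> real (cap m) \<Longrightarrow>
       revenue_rate m x \<le> (\<Sum>j<n_res m. \<pi> j * usage_rate m x j) + \<sigma> * (1 + weight m x)"
    "\<And>\<gamma> s x. (\<And>k. k \<in> active \<Longrightarrow> lp_row m \<gamma> k x = lp_rhs m \<gamma> s $ k) \<Longrightarrow>
       revenue_rate m x = (\<Sum>j<n_res m. \<pi> j * usage_rate m x j) + \<sigma> * (1 + weight m x)"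
    "\<And>j. j < n_res m \<Longrightarrow> Suc j \<notin> active \<Longrightarrow> \<pi> j = 0"
    by blast
  interpret priced_fluid_optimum m \<gamma>\<^sub>0 xF \<pi> \<sigma> by unfold_locales (fact prices)+
  interpret stable_fluid_optimum m \<gamma>\<^sub>0 xF \<rho>\<^sub>0
  proof
    show "\<rho>\<^sub>0 < \<gamma>\<^sub>0 j" if "j < n_res m" for j
      using A2 rho(2) that by (force simp: assumption_A2_def)
    show "\<exists>x. Psi_optimal m \<gamma> s x" if "Psi_feasible m \<gamma> s \<noteq> {}" for \<gamma> s
      using rule that unfolding resolving_rule_def by blast
  qed (fact rho stable)+
  interpret resolving_setting m \<gamma>\<^sub>0 xF \<rho>\<^sub>0 \<pi> \<sigma> A\<^sub>0 B\<^sub>0 draw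
    using A0 B0 A1 rule by unfold_locales (auto simp: assumption_A1_def)
  let ?K = "real (cap m)" and ?M = "real (n_res m)" and ?N = "real (n_prod m)"
  have ge1: "1 \<le> ?K" "1 \<le> ?M" "1 \<le> ?N" using valid by (auto simp: valid_model_def)
  have lnT: "0 \<le> ln (real T)" using T by simp
  have "A\<^sub>0\<^sup>2 * B ^ 3 * ?M * ln (real T)
      = A\<^sub>0\<^sup>2 * B\<^sub>0 ^ 3 * ?K ^ 3 * ?M ^ 1 * 1 * ln (real T)"
    by (simp add: B_def power_mult_distrib mult_ac)
  also have "\<dots> \<le> A\<^sub>0\<^sup>2 * B\<^sub>0 ^ 7 * ?K ^ 5 * ?M\<^sup>2 * ?N * ln (real T)"
    using A0 B0 ge1 lnT by (intro mult_mono power_increasing) auto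
  finally have "552 * (A\<^sub>0\<^sup>2 * B ^ 3 * ?M * ln (real T)) / \<rho>\<^sub>0\<^sup>2
      \<le> 552 * (A\<^sub>0\<^sup>2 * B\<^sub>0 ^ 7 * ?K ^ 5 * ?M\<^sup>2 * ?N * ln (real T)) / min (\<rho>\<^sub>0\<^sup>2) (\<chi>\<^sub>0\<^sup>2)"
    using rho(1) chi A0 B0 lnT by (intro frac_le mult_left_mono) auto
  then show "resolving_regret m (initial_inventory T \<gamma>\<^sub>0) T xF draw
      \<le> 552 * (A\<^sub>0 ^ 2 * B\<^sub>0 ^ 7 * ?K ^ 5 * ?M ^ 2 * ?N * ln (real T)) / min (\<rho>\<^sub>0 ^ 2) (\<chi>\<^sub>0 ^ 2)"
    using resolving_regret_le[OF T] by linarith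
qed

end
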